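(* For all integers $\Delta\ge 2$ and $q\ge\Delta+2$, the Glauber dynamics for $q$-edge-colorings of the $\Delta$-regular complete tree with $n$ vertices has mixing time $O_{\Delta,q}(n\log^2 n)$. Moreover, for an arbitrary tree $T$ with $n$ vertices and maximum degree $\Delta$, the Glauber dynamics for $q$-edge-colorings of $T$ has mixing time $O_{\Delta,q}(nD\log n)$, where $D$ is the diameter of $T$. (Here $O_{\Delta,q}$ hides factors depending only on $\Delta$ and $q$.)
   Context: A tree is $\Delta$-regular complete if every non-leaf vertex has degree $\Delta$ and all leaves are at the same level (the root has $\Delta$ children, every other non-leaf vertex has $\Delta-1$ children). A proper $q$-edge-coloring assigns colors in $[q]$ to edges so that edges sharing an endpoint get distinct colors; $\mu$ is the uniform distribution on these. Glauber dynamics: from $X_t$, choose an edge $e$ and a color $c\in[q]$ uniformly at random; if no edge adjacent to $e$ has color $c$, recolor $e$ with $c$, otherwise do nothing. The mixing time is the smallest $t$ such that from every initial state the distribution of $X_t$ is within total variation distance $1/4$ of $\mu$. *)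

theory Defs
  imports "HOL-Probability.Probability"
begin

text \<open>Finite simple undirected graphs are given by a vertex set \<open>V\<close> and a set \<open>E\<close> of
  two-element subsets of \<open>V\<close>.\<close>

definition simple_graph :: "'a set \<Rightarrow> 'a set set \<Rightarrow> bool" where
  "simple_graph V E \<longleftrightarrow> finite V \<and> (\<forall>e\<in>E. e \<subseteq> V \<and> card e = 2)"

definition is_walk :: "'a set \<Rightarrow> 'a set set \<Rightarrow> 'a list \<Rightarrow> bool" where
  "is_walk V E xs \<longleftrightarrow> xs \<noteq> [] \<and> set xs \<subseteq> V \<and> successively (\<lambda>u v. {u, v} \<in> E) xs"

definition walk_between :: "'a set \<Rightarrow> 'a set set \<Rightarrow> 'a \<Rightarrow> 'a list \<Rightarrow> 'a \<Rightarrow> bool" where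
  "walk_between V E u xs v \<longleftrightarrow> is_walk V E xs \<and> hd xs = u \<and> last xs = v"

text \<open>A cycle is listed without repeating its starting vertex.\<close>

definition is_cycle :: "'a set \<Rightarrow> 'a set set \<Rightarrow> 'a list \<Rightarrow> bool" where
  "is_cycle V E xs \<longleftrightarrow> is_walk V E xs \<and> distinct xs \<and> length xs \<ge> 3 \<and> {last xs, hd xs} \<in> E"

definition connected_graph :: "'a set \<Rightarrow> 'a set set \<Rightarrow> bool" where
  "connected_graph V E \<longleftrightarrow> V \<noteq> {} \<and> (\<forall>u\<in>V. \<forall>v\<in>V. \<exists>xs. walk_between V E u xs v)"

definition is_tree :: "'a set \<Rightarrow> 'a set set \<Rightarrow> bool" where
  "is_tree V E \<longleftrightarrow> simple_graph V E \<and> connected_graph V E \<and> (\<nexists>xs. is_cycle V E xs)"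

definition vdegree :: "'a set set \<Rightarrow> 'a \<Rightarrow> nat" where
  "vdegree E v = card {e\<in>E. v \<in> e}"

definition max_degree :: "'a set \<Rightarrow> 'a set set \<Rightarrow> nat" where
  "max_degree V E = Max (vdegree E ` V)"

text \<open>The length of a walk is its number of edges, i.e. one less than the length of its vertex
  list. Only used for connected graphs.\<close>

definition gdist :: "'a set \<Rightarrow> 'a set set \<Rightarrow> 'a \<Rightarrow> 'a \<Rightarrow> nat" where
  "gdist V E u v = (LEAST k. \<exists>xs. walk_between V E u xs v \<and> length xs = Suc k)"

definition gdiameter :: "'a set \<Rightarrow> 'a set set \<Rightarrow> nat" where
  "gdiameter V E = Max ((\<lambda>(u, v). gdist V E u v) ` (V \<times> V))"

text \<open>With this convention the single vertex is the complete tree of height \<open>0\<close>.\<close>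

definition is_leaf :: "'a set set \<Rightarrow> 'a \<Rightarrow> bool" where
  "is_leaf E v \<longleftrightarrow> vdegree E v \<le> 1"

text \<open>The level of a vertex is its distance from the root \<open>r\<close>. A non-root vertex of degree
  \<open>\<Delta>\<close> has \<open>\<Delta> - 1\<close> children.\<close>

definition regular_complete_tree :: "nat \<Rightarrow> 'a set \<Rightarrow> 'a set set \<Rightarrow> bool" where
  "regular_complete_tree \<Delta> V E \<longleftrightarrow> is_tree V E \<and>
     (\<forall>v\<in>V. \<not> is_leaf E v \<longrightarrow> vdegree E v = \<Delta>) \<and>
     (\<exists>r\<in>V. \<exists>h. \<forall>v\<in>V. is_leaf E v \<longrightarrow> gdist V E r v = h)"

definition adjacent_edges :: "'a set \<Rightarrow> 'a set \<Rightarrow> bool" where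
  "adjacent_edges e e' \<longleftrightarrow> e \<noteq> e' \<and> e \<inter> e' \<noteq> {}"

text \<open>Colorings are extensional functions on \<open>E\<close>, so that there are finitely many of them.\<close>

definition proper_edge_colorings :: "'a set set \<Rightarrow> nat \<Rightarrow> ('a set \<Rightarrow> nat) set" where
  "proper_edge_colorings E q =
     {X \<in> E \<rightarrow>\<^sub>E {1..q}. \<forall>e\<in>E. \<forall>e'\<in>E. adjacent_edges e e' \<longrightarrow> X e \<noteq> X e'}"

definition uniform_coloring :: "'a set set \<Rightarrow> nat \<Rightarrow> ('a set \<Rightarrow> nat) pmf" where
  "uniform_coloring E q = pmf_of_set (proper_edge_colorings E q)"

definition glauber_step :: "'a set set \<Rightarrow> nat \<Rightarrow> ('a set \<Rightarrow> nat) \<Rightarrow> ('a set \<Rightarrow> nat) pmf" where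
  "glauber_step E q X =
     do {
       e \<leftarrow> pmf_of_set E;
       c \<leftarrow> pmf_of_set {1..q};
       return_pmf (if \<exists>e'\<in>E. adjacent_edges e e' \<and> X e' = c then X else X(e := c))
     }"

text \<open>The law at time \<open>t\<close> of the Markov chain with transition kernel \<open>K\<close> started at \<open>x\<close>.\<close>

primrec chain_law :: "('s \<Rightarrow> 's pmf) \<Rightarrow> 's \<Rightarrow> nat \<Rightarrow> 's pmf" where
  "chain_law K x 0 = return_pmf x"
| "chain_law K x (Suc t) = bind_pmf (chain_law K x t) K"

definition tv_dist :: "'s pmf \<Rightarrow> 's pmf \<Rightarrow> real" where
  "tv_dist p p' = (SUP A. \<bar>measure_pmf.prob p A - measure_pmf.prob p' A\<bar>)"

text \<open>Extended-valued: the mixing time is \<open>\<infinity>\<close> if the threshold is never reached, so an upper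
  bound on it includes the assertion that it is finite.\<close>

definition mixing_time :: "'s set \<Rightarrow> ('s \<Rightarrow> 's pmf) \<Rightarrow> 's pmf \<Rightarrow> enat" where
  "mixing_time S K p = (INF t \<in> {t. \<forall>x\<in>S. tv_dist (chain_law K x t) p \<le> 1 / 4}. enat t)"

definition glauber_mixing_time :: "'a set set \<Rightarrow> nat \<Rightarrow> enat" where
  "glauber_mixing_time E q =
     mixing_time (proper_edge_colorings E q) (glauber_step E q) (uniform_coloring E q)"

end

theory Submission
  imports Defs "HOL-Combinatorics.Transposition"
begin

text \<open>
  Root the tree and look at the colors from the top down. Given the color of an
  edge, the row of its child edges is a uniformly random injective assignment of the other colors,
  and by color symmetry every row extends downwards in equally many ways.

  Let \<open>J v\<close> be the energy of recoloring the edge \<open>v\<close> in the function averaged over all colors below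
  \<open>v\<close>. Recoloring \<open>v\<close> from \<open>a\<close> to \<open>b\<close> is an ordinary Glauber move unless the row below
  uses \<open>b\<close>. Comparing the mean over all rows with the mean over the rows avoiding \<open>b\<close> costs only
  increments of single children, and summing over \<open>b\<close> exploits that these are nearly orthogonal. This
  gives \<open>J v \<le> \<theta> (\<Sum>u. J u) + K D v\<close>, with \<open>u\<close> ranging over the children of \<open>v\<close>, \<open>D v\<close> the
  Glauber energy at \<open>v\<close>, and \<open>\<theta> < 1\<close> because \<open>q \<ge> \<Delta> + 2\<close>. Summing over the tree bounds the
  variance by a constant multiple of the Glauber energy.

  By the chain rule, the entropy splits into contributions of single rows. Such a contribution is at
  most a constant times the variance of \<open>sqrt F\<close> below the row, so that entropy is tensorized with
  a constant proportional to the depth, and the Glauber dynamics contracts entropy accordingly. In a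
  complete tree with \<open>\<Delta> \<ge> 3\<close> the depth is logarithmic. For \<open>\<Delta> = 2\<close> it is not, but there
  rows have at most one edge and the recursion for \<open>J\<close> also holds for square roots, with
  \<open>\<theta> = 3/4\<close>, which removes the depth from the constant.
\<close>

section \<open>Elementary inequalities\<close>

text \<open>The block move that exchanges two colors throughout a subtree is never obstructed from
  below, and it compares the means of two families of rows. The contraction is a counting effect:
  for two colors b and c, rows containing both cancel, a row containing only b is matched with one
  containing only c that differs at a single child, and over all ordered pairs each recoloring of a
  child is used once. With d children this gives the factor 2d / ((q - 2)(q - 1 - d)), at most 1 -
  1/\<Delta> when d \<le> \<Delta> - 1 and q \<ge> \<Delta> + 2.

  The cancellation is linear in the row sums, hence it serves variances but not square roots of
  averages, which entropy requires. Returning from the variance of the square root below a row to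
  Glauber energies charges an edge once for each row above it; this is where the depth enters. If a
  row is a single color, two families of rows can be coupled explicitly: one pair of exchanged
  parent and child colors is left over, and detours through further colors cost only a factor
  slightly above 2/3. Rows are then charged to the block energies of their own children, without
  repetition.\<close>

lemma square_sum_split:
  fixes x y \<eta> :: real
  assumes "\<eta> > 0"
  shows "(x + y)\<^sup>2 \<le> (1 + \<eta>) * x\<^sup>2 + (1 + 1 / \<eta>) * y\<^sup>2"
proof -
  have "0 \<le> (\<eta> * x - y)\<^sup>2 / \<eta>" using assms by simp
  also have "\<dots> = \<eta> * x\<^sup>2 + y\<^sup>2 / \<eta> - 2 * x * y"
    using assms by (simp add: power2_eq_square field_simps)
  finally show ?thesis by (simp add: power2_eq_square algebra_simps)
qed

lemma square_diff_le:
  fixes x y :: real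
  shows "(x - y)\<^sup>2 \<le> 2 * (x\<^sup>2 + y\<^sup>2)"
  using square_sum_split[of 1 x "- y"] by simp

lemma square_sum_split3:
  fixes x y z \<eta> :: real
  assumes "\<eta> > 0"
  shows "(x + (y - z))\<^sup>2 \<le> (1 + \<eta>) * x\<^sup>2 + 2 * (1 + 1 / \<eta>) * (y\<^sup>2 + z\<^sup>2)"
    and "((y - z) + x)\<^sup>2 \<le> 2 * (1 + \<eta>) * (y\<^sup>2 + z\<^sup>2) + (1 + 1 / \<eta>) * x\<^sup>2"
proof -
  have "(1 + 1 / \<eta>) * (y - z)\<^sup>2 \<le> (1 + 1 / \<eta>) * (2 * (y\<^sup>2 + z\<^sup>2))"
    using assms by (intro mult_left_mono square_diff_le) auto
  then show "(x + (y - z))\<^sup>2 \<le> (1 + \<eta>) * x\<^sup>2 + 2 * (1 + 1 / \<eta>) * (y\<^sup>2 + z\<^sup>2)"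
    using square_sum_split[OF assms, of x "y - z"] by linarith
  have "(1 + \<eta>) * (y - z)\<^sup>2 \<le> (1 + \<eta>) * (2 * (y\<^sup>2 + z\<^sup>2))"
    using assms by (intro mult_left_mono square_diff_le) auto
  then show "((y - z) + x)\<^sup>2 \<le> 2 * (1 + \<eta>) * (y\<^sup>2 + z\<^sup>2) + (1 + 1 / \<eta>) * x\<^sup>2"
    using square_sum_split[OF assms, of "y - z" x] by linarith
qed

lemma sum_sum_square_diff:
  fixes y :: "'b \<Rightarrow> real"
  shows "(\<Sum>i\<in>I. \<Sum>j\<in>I. (y i - y j)\<^sup>2) = 2 * (real (card I) * (\<Sum>i\<in>I. (y i)\<^sup>2) - (\<Sum>i\<in>I. y i)\<^sup>2)"
proof -
  have "(\<Sum>i\<in>I. \<Sum>j\<in>I. (y i - y j)\<^sup>2)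
      = (\<Sum>i\<in>I. \<Sum>j\<in>I. (y i)\<^sup>2) + (\<Sum>i\<in>I. \<Sum>j\<in>I. (y j)\<^sup>2) - 2 * (\<Sum>i\<in>I. \<Sum>j\<in>I. y i * y j)"
    by (simp add: power2_diff sum.distrib sum_subtractf sum_distrib_left mult.assoc)
  also have "(\<Sum>i\<in>I. \<Sum>j\<in>I. y i * y j) = (\<Sum>i\<in>I. y i)\<^sup>2"
    by (simp add: power2_eq_square sum_product)
  finally show ?thesis by (simp add: sum_distrib_left)
qed

lemma sum_square_dev:
  fixes x :: "'b \<Rightarrow> real" and m :: real
  assumes "finite I" "I \<noteq> {}" "m = (\<Sum>i\<in>I. x i) / card I"
  shows "(\<Sum>i\<in>I. (x i - m)\<^sup>2) = (\<Sum>i\<in>I. (x i)\<^sup>2) - card I * m\<^sup>2"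
proof -
  have "(\<Sum>i\<in>I. x i) = card I * m" using assms by simp
  then show ?thesis
    by (simp add: power2_diff sum.distrib sum_subtractf power2_eq_square algebra_simps
        flip: sum_distrib_left sum_distrib_right)
qed

lemma sum_square_dev_le:
  fixes x :: "'b \<Rightarrow> real" and c m :: real
  assumes "finite I" "I \<noteq> {}" "m = (\<Sum>i\<in>I. x i) / card I"
  shows "(\<Sum>i\<in>I. (x i - m)\<^sup>2) \<le> (\<Sum>i\<in>I. (x i - c)\<^sup>2)"
proof -
  have S: "(\<Sum>i\<in>I. x i) = card I * m" using assms by simp
  have "(\<Sum>i\<in>I. (x i - c)\<^sup>2) = (\<Sum>i\<in>I. (x i)\<^sup>2) - 2 * c * (\<Sum>i\<in>I. x i) + card I * c\<^sup>2"
    by (simp add: power2_diff sum.distrib sum_subtractf mult.commute mult.left_commute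
        flip: sum_distrib_left sum_distrib_right)
  also have "\<dots> = (\<Sum>i\<in>I. (x i - m)\<^sup>2) + card I * (m - c)\<^sup>2"
    unfolding sum_square_dev[OF assms] S by (simp add: power2_eq_square algebra_simps)
  finally show ?thesis by simp
qed

lemma jensen_square_mean:
  fixes x :: "'b \<Rightarrow> real"
  assumes "finite I" "I \<noteq> {}"
  shows "((\<Sum>i\<in>I. x i) / card I)\<^sup>2 \<le> (\<Sum>i\<in>I. (x i)\<^sup>2) / card I"
proof -
  have c: "real (card I) > 0" using assms by (simp add: card_gt_0_iff)
  have "0 \<le> (\<Sum>i\<in>I. (x i - (\<Sum>i\<in>I. x i) / card I)\<^sup>2)" by (rule sum_nonneg) simp
  then have "card I * ((\<Sum>i\<in>I. x i) / card I)\<^sup>2 \<le> (\<Sum>i\<in>I. (x i)\<^sup>2)"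
    using sum_square_dev[OF assms refl, of x] by simp
  with c show ?thesis by (simp add: pos_le_divide_eq mult.commute)
qed

text \<open>For \<open>sqrt\<close> this is the joint convexity of x + y - 2 sqrt(x y), which
  reduces to Cauchy-Schwarz. Keeping \<open>G\<close> outside the average in one statement lets the
  same energy argument run for a function and for square roots of its averages.\<close>

lemma jensen_square_diff:
  fixes x y :: "'b \<Rightarrow> real"
  assumes "G = (\<lambda>t. t) \<or> G = sqrt" and I: "finite I" "I \<noteq> {}"
    and nonneg: "\<And>i. i \<in> I \<Longrightarrow> 0 \<le> x i" "\<And>i. i \<in> I \<Longrightarrow> 0 \<le> y i"
  shows "(G ((\<Sum>i\<in>I. x i) / card I) - G ((\<Sum>i\<in>I. y i) / card I))\<^sup>2
      \<le> (\<Sum>i\<in>I. (G (x i) - G (y i))\<^sup>2) / card I"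
  using assms(1)
proof
  assume G: "G = (\<lambda>t. t)"
  show ?thesis unfolding G
    using jensen_square_mean[OF I, of "\<lambda>i. x i - y i"] by (simp add: sum_subtractf diff_divide_distrib)
next
  assume G: "G = sqrt"
  have c: "real (card I) > 0" using I by (simp add: card_gt_0_iff)
  have "(\<Sum>i\<in>I. sqrt (x i) * sqrt (y i)) = (\<Sum>i\<in>I. \<bar>sqrt (x i)\<bar> * \<bar>sqrt (y i)\<bar>)"
    using nonneg by (intro sum.cong) auto
  also have "\<dots> \<le> L2_set (\<lambda>i. sqrt (x i)) I * L2_set (\<lambda>i. sqrt (y i)) I"
    by (rule L2_set_mult_ineq)
  also have "\<dots> = sqrt (\<Sum>i\<in>I. x i) * sqrt (\<Sum>i\<in>I. y i)"
    using nonneg by (simp add: L2_set_def cong: sum.cong)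
  finally have cs: "(\<Sum>i\<in>I. sqrt (x i) * sqrt (y i)) \<le> sqrt (\<Sum>i\<in>I. x i) * sqrt (\<Sum>i\<in>I. y i)" .
  have e: "(\<Sum>i\<in>I. (sqrt (x i) - sqrt (y i))\<^sup>2)
      = (\<Sum>i\<in>I. x i) + (\<Sum>i\<in>I. y i) - 2 * (\<Sum>i\<in>I. sqrt (x i) * sqrt (y i))"
    using nonneg by (simp add: power2_diff sum.distrib sum_subtractf sum_distrib_left mult.assoc cong: sum.cong)
  have s: "0 \<le> (\<Sum>i\<in>I. x i)" "0 \<le> (\<Sum>i\<in>I. y i)" using nonneg by (auto intro: sum_nonneg)
  have "(sqrt ((\<Sum>i\<in>I. x i) / card I) - sqrt ((\<Sum>i\<in>I. y i) / card I))\<^sup>2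
      = ((\<Sum>i\<in>I. x i) + (\<Sum>i\<in>I. y i) - 2 * (sqrt (\<Sum>i\<in>I. x i) * sqrt (\<Sum>i\<in>I. y i))) / card I"
    using s c by (simp add: real_sqrt_divide power2_diff power_divide field_simps)
  also have "\<dots> \<le> (\<Sum>i\<in>I. (sqrt (x i) - sqrt (y i))\<^sup>2) / card I"
    unfolding e using cs c by (intro divide_right_mono) auto
  finally show ?thesis unfolding G .
qed

section \<open>Entropy against the variance of the square root\<close>

lemma ln_ge_one_minus_inverse:
  fixes x :: real
  assumes "x > 0"
  shows "ln x \<ge> 1 - 1 / x"
  using ln_le_minus_one[of "1 / x"] assms by (simp add: ln_div)

text \<open>By ln y \<le> y - 1 the entropy is at most the variance divided by the mean
  \<open>m\<close>. Positivity gives \<open>x i \<le> card I * m\<close>, and factoring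
  \<open>x i - s\<^sup>2\<close> into sum and difference of roots turns the variance into that of
  the square roots. The loss of the factor \<open>card I\<close> is harmless: it will be the number
  of rows, at most \<open>q ^ \<Delta>\<close>.\<close>

lemma sum_xlnx_le_sqrt_dev:
  fixes x :: "'b \<Rightarrow> real" and m s :: real
  assumes I: "finite I" "I \<noteq> {}" and pos: "\<And>i. i \<in> I \<Longrightarrow> x i > 0"
    and m: "m = (\<Sum>i\<in>I. x i) / card I" and s: "s = (\<Sum>i\<in>I. sqrt (x i)) / card I"
  shows "(\<Sum>i\<in>I. x i * ln (x i)) - card I * (m * ln m) \<le> 4 * real (card I) * (\<Sum>i\<in>I. (sqrt (x i) - s)\<^sup>2)"
proof -
  let ?n = "real (card I)"
  have n: "?n \<ge> 1" using I by (simp add: Suc_le_eq card_gt_0_iff)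
  have S: "(\<Sum>i\<in>I. x i) = ?n * m" using m n by simp
  have m0: "m > 0" unfolding m using n pos I by (auto intro!: divide_pos_pos sum_pos)
  have s0: "s \<ge> 0" unfolding s using pos by (intro divide_nonneg_nonneg sum_nonneg) (auto intro: less_imp_le)
  have "s\<^sup>2 \<le> (\<Sum>i\<in>I. (sqrt (x i))\<^sup>2) / ?n" unfolding s by (rule jensen_square_mean[OF I])
  also have "\<dots> = m" unfolding m using pos by (auto intro!: arg_cong[of _ _ "\<lambda>t. t / ?n"] sum.cong simp: less_imp_le)
  finally have sm: "s\<^sup>2 \<le> m" .
  have "(\<Sum>i\<in>I. x i * ln (x i)) - ?n * (m * ln m) = (\<Sum>i\<in>I. x i * ln (x i / m))"
  proof -
    have "(\<Sum>i\<in>I. x i * ln (x i / m)) = (\<Sum>i\<in>I. x i * ln (x i) - x i * ln m)"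
      using pos m0 by (intro sum.cong) (auto simp: ln_div algebra_simps)
    then show ?thesis by (simp add: sum_subtractf S flip: sum_distrib_right)
  qed
  also have "\<dots> \<le> (\<Sum>i\<in>I. x i * (x i / m - 1))"
    using pos m0 by (intro sum_mono mult_left_mono ln_le_minus_one) (auto intro: less_imp_le)
  also have "\<dots> = ((\<Sum>i\<in>I. (x i)\<^sup>2) - ?n * m\<^sup>2) / m"
    using m0 by (simp add: sum_subtractf right_diff_distrib S power2_eq_square diff_divide_distrib
        flip: sum_divide_distrib)
  also have "\<dots> = (\<Sum>i\<in>I. (x i - m)\<^sup>2) / m" using sum_square_dev[OF I m] by simp
  \<comment> \<open>The mean minimizes the squared deviation, so the center may be moved to
    \<open>s\<^sup>2\<close>, where the difference of squares factors.\<close>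
  also have "\<dots> \<le> (\<Sum>i\<in>I. (x i - s\<^sup>2)\<^sup>2) / m"
    using sum_square_dev_le[OF I m] m0 by (intro divide_right_mono) auto
  also have "\<dots> \<le> (\<Sum>i\<in>I. (sqrt (x i) - s)\<^sup>2 * (4 * ?n * m)) / m"
  proof (intro divide_right_mono sum_mono)
    fix i assume i: "i \<in> I"
    have "x i \<le> (\<Sum>i\<in>I. x i)" by (rule member_le_sum) (use i pos I in \<open>auto intro: less_imp_le\<close>)
    then have x: "x i \<le> ?n * m" using S by simp
    have "s\<^sup>2 \<le> ?n * m" using sm n m0 mult_right_mono[of 1 ?n m] by linarith
    then have "s \<le> sqrt (?n * m)" using real_le_rsqrt by blast
    moreover have "sqrt (x i) \<le> sqrt (?n * m)" using x by simp
    ultimately have "(sqrt (x i) + s)\<^sup>2 \<le> (2 * sqrt (?n * m))\<^sup>2"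
      using s0 pos[OF i] \<open>s \<le> sqrt (?n * m)\<close> by (intro power_mono) (linarith, simp)
    also have "\<dots> = 4 * ?n * m" using n m0 by (simp add: power_mult_distrib)
    finally have *: "(sqrt (x i) + s)\<^sup>2 \<le> 4 * ?n * m" .
    have "x i - s\<^sup>2 = (sqrt (x i) - s) * (sqrt (x i) + s)"
      using pos[OF i] by (simp add: algebra_simps power2_eq_square)
    then have "(x i - s\<^sup>2)\<^sup>2 = (sqrt (x i) - s)\<^sup>2 * (sqrt (x i) + s)\<^sup>2" by (simp add: power_mult_distrib)
    also have "\<dots> \<le> (sqrt (x i) - s)\<^sup>2 * (4 * ?n * m)" using * by (intro mult_left_mono) auto
    finally show "(x i - s\<^sup>2)\<^sup>2 \<le> (sqrt (x i) - s)\<^sup>2 * (4 * ?n * m)" .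
  qed (use m0 in auto)
  also have "\<dots> = 4 * ?n * (\<Sum>i\<in>I. (sqrt (x i) - s)\<^sup>2)"
    using m0 by (simp add: mult.commute flip: sum_distrib_right)
  finally show ?thesis .
qed

text \<open>Relative entropy dominates the squared Hellinger distance: ln y \<ge> 1 - 1/y is applied
  to y = sqrt (x i / m), whose logarithm is half of the one wanted. In this direction no factor
  depending on \<open>card I\<close> is lost.\<close>

lemma sqrt_dev_le_sum_xlnx:
  fixes x :: "'b \<Rightarrow> real" and m s :: real
  assumes I: "finite I" "I \<noteq> {}" and pos: "\<And>i. i \<in> I \<Longrightarrow> x i > 0"
    and m: "m = (\<Sum>i\<in>I. x i) / card I" and s: "s = (\<Sum>i\<in>I. sqrt (x i)) / card I"
  shows "(\<Sum>i\<in>I. (sqrt (x i) - s)\<^sup>2) \<le> (\<Sum>i\<in>I. x i * ln (x i)) - card I * (m * ln m)"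
proof -
  let ?n = "real (card I)"
  have n: "?n \<ge> 1" using I by (simp add: Suc_le_eq card_gt_0_iff)
  have S: "(\<Sum>i\<in>I. x i) = ?n * m" using m n by simp
  have T: "(\<Sum>i\<in>I. sqrt (x i)) = ?n * s" using s n by simp
  have m0: "m > 0" unfolding m using n pos I by (auto intro!: divide_pos_pos sum_pos)
  have "(\<Sum>i\<in>I. (sqrt (x i) - s)\<^sup>2) = (\<Sum>i\<in>I. (sqrt (x i))\<^sup>2) - ?n * s\<^sup>2"
    by (rule sum_square_dev[OF I s])
  also have "(\<Sum>i\<in>I. (sqrt (x i))\<^sup>2) = ?n * m"
    unfolding S[symmetric] using pos by (intro sum.cong) (auto simp: less_imp_le)
  \<comment> \<open>The variance is replaced by the larger squared deviation of the roots from
    \<open>sqrt m\<close>.\<close>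
  also have "?n * m - ?n * s\<^sup>2 \<le> 2 * ?n * m - 2 * sqrt m * (?n * s)"
  proof -
    have "0 \<le> ?n * (sqrt m - s)\<^sup>2" by simp
    also have "\<dots> = ?n * m - 2 * sqrt m * (?n * s) + ?n * s\<^sup>2"
      using m0 by (simp add: power2_diff algebra_simps)
    finally show ?thesis by (simp add: algebra_simps)
  qed
  also have "2 * ?n * m - 2 * sqrt m * (?n * s) = (\<Sum>i\<in>I. 2 * x i - 2 * sqrt m * sqrt (x i))"
    by (simp add: sum_subtractf S T flip: sum_distrib_left)
  also have "\<dots> \<le> (\<Sum>i\<in>I. x i * ln (x i / m))"
  proof (intro sum_mono)
    fix i assume i: "i \<in> I"
    have p: "sqrt (x i) > 0" "sqrt m > 0" using pos[OF i] m0 by auto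
    have "2 * x i - 2 * sqrt m * sqrt (x i) = 2 * x i * (1 - 1 / (sqrt (x i) / sqrt m))"
    proof -
      have "x i / sqrt (x i) = sqrt (x i)" using pos[OF i] by (simp add: real_div_sqrt)
      moreover have "2 * x i * (1 - 1 / (sqrt (x i) / sqrt m)) = 2 * x i - 2 * sqrt m * (x i / sqrt (x i))"
        using p by (simp add: field_simps)
      ultimately show ?thesis by simp
    qed
    also have "\<dots> \<le> 2 * x i * ln (sqrt (x i) / sqrt m)"
      using ln_ge_one_minus_inverse[of "sqrt (x i) / sqrt m"] p pos[OF i] by (intro mult_left_mono) auto
    also have "\<dots> = x i * ln (x i / m)"
      using pos[OF i] m0 p by (simp add: ln_div ln_sqrt algebra_simps)
    finally show "2 * x i - 2 * sqrt m * sqrt (x i) \<le> x i * ln (x i / m)" .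
  qed
  also have "\<dots> = (\<Sum>i\<in>I. x i * ln (x i)) - ?n * (m * ln m)"
  proof -
    have "(\<Sum>i\<in>I. x i * ln (x i / m)) = (\<Sum>i\<in>I. x i * ln (x i) - x i * ln m)"
      using pos m0 by (intro sum.cong) (auto simp: ln_div algebra_simps)
    then show ?thesis by (simp add: sum_subtractf S flip: sum_distrib_right)
  qed
  finally show ?thesis .
qed

section \<open>Rows of distinct colors\<close>

text \<open>Sibling edges are pairwise adjacent, so the colors of the children of one edge form an
  injection.\<close>

definition injs :: "'b set \<Rightarrow> nat set \<Rightarrow> ('b \<Rightarrow> nat) set" where
  "injs D N = {R \<in> D \<rightarrow>\<^sub>E N. inj_on R D}"

lemma finite_injs: "finite D \<Longrightarrow> finite N \<Longrightarrow> finite (injs D N)"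
  unfolding injs_def by (simp add: finite_PiE)

lemma injs_mono: "N \<subseteq> M \<Longrightarrow> injs D N \<subseteq> injs D M"
  unfolding injs_def by (auto simp: PiE_def Pi_def)

lemma injs_avoid: "injs D (N - B) = {R \<in> injs D N. R ` D \<inter> B = {}}"
  unfolding injs_def by (auto simp: PiE_def Pi_def)

lemma injs_image: "R \<in> injs D N \<Longrightarrow> R ` D \<subseteq> N"
  unfolding injs_def by auto

lemma card_injs_image: "R \<in> injs D N \<Longrightarrow> card (R ` D) = card D"
  unfolding injs_def by (auto simp: card_image)

lemma injs_update:
  assumes "R \<in> injs D N" "u \<in> D" "x \<in> N" "x \<notin> R ` (D - {u})"
  shows "R(u := x) \<in> injs D N"
  using assms unfolding injs_def by (auto simp: PiE_def Pi_def extensional_def inj_on_def)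

lemma card_injs_le:
  assumes "finite D" "finite N" "finite M" "card N \<le> card M"
  shows "card (injs D N) \<le> card (injs D M)"
proof -
  obtain h where h: "h ` N \<subseteq> M" "inj_on h N"
    using card_le_inj[OF assms(2-4)] by blast
  show ?thesis
  proof (rule card_inj_on_le)
    show "inj_on (\<lambda>R. restrict (h \<circ> R) D) (injs D N)"
    proof (rule inj_onI)
      fix R R' assume R: "R \<in> injs D N" "R' \<in> injs D N"
        and eq: "restrict (h \<circ> R) D = restrict (h \<circ> R') D"
      show "R = R'"
      proof (rule ext)
        fix u show "R u = R' u"
        proof (cases "u \<in> D")
          case True
          then have "h (R u) = h (R' u)" using fun_cong[OF eq, of u] by simp
          with True R h(2) show ?thesis unfolding injs_def by (auto simp: inj_on_def PiE_def Pi_def)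
        next
          case False
          with R show ?thesis unfolding injs_def by (auto simp: PiE_def extensional_def)
        qed
      qed
    qed
    show "(\<lambda>R. restrict (h \<circ> R) D) ` injs D N \<subseteq> injs D M"
    proof clarify
      fix R assume "R \<in> injs D N"
      then have R: "R ` D \<subseteq> N" "inj_on R D" unfolding injs_def by auto
      have "inj_on (h \<circ> R) D" using R h(2) by (auto intro!: comp_inj_on inj_on_subset[OF h(2)])
      then have "inj_on (restrict (h \<circ> R) D) D" by (simp add: inj_on_def)
      moreover have "restrict (h \<circ> R) D \<in> D \<rightarrow>\<^sub>E M" using R h(1) by fastforce
      ultimately show "restrict (h \<circ> R) D \<in> injs D M" unfolding injs_def by blast
    qed
    show "finite (injs D M)" using assms by (simp add: finite_injs)
  qed
qed

lemma card_injs_cong: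
  assumes "finite D" "finite N" "finite M" "card N = card M"
  shows "card (injs D N) = card (injs D M)"
  using card_injs_le[of D N M] card_injs_le[of D M N] assms by simp

text \<open>Double counting of pairs of a row and a color missing from it: each row misses
  \<open>card N - card D\<close> colors, and by symmetry all colors are missed equally
  often.\<close>

lemma card_injs_remove:
  assumes D: "finite D" and N: "finite N" and b: "b \<in> N"
  shows "card N * real (card (injs D (N - {b}))) = (real (card N) - card D) * card (injs D N)"
proof -
  have "(\<Sum>c\<in>N. real (card (injs D (N - {c})))) = (\<Sum>c\<in>N. \<Sum>R\<in>injs D N. if c \<notin> R ` D then 1 else 0)"
    unfolding injs_avoid
    by (intro sum.cong refl) (simp add: finite_injs[OF D N] flip: sum.inter_filter)
  also have "\<dots> = (\<Sum>R\<in>injs D N. \<Sum>c\<in>N. if c \<notin> R ` D then 1 else 0)" by (rule sum.swap)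
  also have "\<dots> = (\<Sum>R\<in>injs D N. real (card N) - card D)"
  proof (intro sum.cong refl)
    fix R assume R: "R \<in> injs D N"
    have "(\<Sum>c\<in>N. if c \<notin> R ` D then 1 else 0) = real (card {c \<in> N. c \<notin> R ` D})"
      using N by (simp flip: sum.inter_filter)
    also have "{c \<in> N. c \<notin> R ` D} = N - R ` D" by auto
    also have "real (card (N - R ` D)) = real (card N) - card D"
      using R D N injs_image[OF R] by (simp add: card_Diff_subset card_injs_image[OF R] of_nat_diff card_mono
          flip: card_injs_image[OF R])
    finally show "(\<Sum>c\<in>N. if c \<notin> R ` D then 1 else 0) = real (card N) - card D" .
  qed
  also have "(\<Sum>c\<in>N. real (card (injs D (N - {c})))) = (\<Sum>c\<in>N. real (card (injs D (N - {b}))))"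
  proof (intro sum.cong refl arg_cong[of _ _ real] card_injs_cong)
    fix c assume "c \<in> N"
    then show "card (N - {c}) = card (N - {b})" using b N by simp
  qed (use D N in auto)
  finally show ?thesis by (simp add: mult.commute)
qed

section \<open>Recoloring single children: connectivity, Poincare inequality, and means over
  restricted rows\<close>

definition row_energy :: "'b set \<Rightarrow> nat set \<Rightarrow> (('b \<Rightarrow> nat) \<Rightarrow> real) \<Rightarrow> real" where
  "row_energy D N \<phi> = (\<Sum>R\<in>injs D N. \<Sum>u\<in>D. \<Sum>x\<in>N - R ` D. (\<phi> R - \<phi> (R(u := x)))\<^sup>2)"

lemma row_energy_nonneg: "0 \<le> row_energy D N \<phi>"
  unfolding row_energy_def by (intro sum_nonneg) auto

text \<open>Induction on the number of mismatched positions, each of which is repaired by at most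
  two moves. The assumption \<open>card D < card N\<close> supplies the spare color; a row using
  every color would admit no move at all.\<close>

lemma injs_connected:
  fixes \<phi> :: "('b \<Rightarrow> nat) \<Rightarrow> real"
  assumes D: "finite D" and N: "finite N" and dN: "card D < card N"
    and move: "\<And>R u x. R \<in> injs D N \<Longrightarrow> u \<in> D \<Longrightarrow> x \<in> N - R ` D \<Longrightarrow> \<bar>\<phi> R - \<phi> (R(u := x))\<bar> \<le> T"
    and R': "R' \<in> injs D N" and "R \<in> injs D N"
  shows "\<bar>\<phi> R - \<phi> R'\<bar> \<le> 2 * real (card {u\<in>D. R u \<noteq> R' u}) * T"
  using assms(6)
proof (induction "card {u\<in>D. R u \<noteq> R' u}" arbitrary: R rule: less_induct)
  case less
  let ?m = "\<lambda>R. card {u\<in>D. R u \<noteq> R' u}"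
  note R = less.prems
  show ?case
  proof (cases "?m R = 0")
    case True
    then have "\<forall>u\<in>D. R u = R' u" using D by auto
    moreover have "R \<in> D \<rightarrow>\<^sub>E N" "R' \<in> D \<rightarrow>\<^sub>E N" using R R' unfolding injs_def by auto
    ultimately have "R = R'" by (intro PiE_ext) auto
    then show ?thesis by simp
  next
    case False
    have dec: "?m Q + 1 \<le> ?m R" if "{u\<in>D. Q u \<noteq> R' u} \<subset> {u\<in>D. R u \<noteq> R' u}" for Q
      using psubset_card_mono[OF _ that] D by simp
    show ?thesis
    proof (cases "\<exists>u\<in>D. R u \<noteq> R' u \<and> R' u \<notin> R ` D")
      case True
      then obtain u where u: "u \<in> D" "R u \<noteq> R' u" "R' u \<notin> R ` D" by blast
      have x: "R' u \<in> N - R ` D" using u R' injs_image by blast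
      let ?Q = "R(u := R' u)"
      have Q: "?Q \<in> injs D N" using R u x by (intro injs_update) auto
      have m: "?m ?Q + 1 \<le> ?m R" by (rule dec) (use u in auto)
      have T: "\<bar>\<phi> R - \<phi> ?Q\<bar> \<le> T" by (rule move[OF R u(1) x])
      have "\<bar>\<phi> ?Q - \<phi> R'\<bar> \<le> 2 * real (?m ?Q) * T" using less.hyps[OF _ Q] m by simp
      moreover have "2 * real (?m ?Q) * T + T \<le> 2 * real (?m R) * T"
      proof -
        have "T \<ge> 0" using T by linarith
        then have "(2 * real (?m ?Q) + 1) * T \<le> (2 * real (?m R)) * T"
          using m by (intro mult_right_mono) auto
        then show ?thesis by (simp add: algebra_simps)
      qed
      ultimately show ?thesis using T by linarith
    next
      case False
      text \<open>All colors wanted by the mismatched positions are in use, so one position has to be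
        parked at a spare color first.\<close>
      let ?M = "{u\<in>D. R u \<noteq> R' u}"
      have inj: "inj_on R D" "inj_on R' D" using R R' unfolding injs_def by auto
      have sub: "R' ` ?M \<subseteq> R ` ?M"
      proof clarify
        fix u assume u: "u \<in> D" "R u \<noteq> R' u"
        then have "R' u \<in> R ` D" using False by blast
        then obtain w where w: "w \<in> D" "R' u = R w" by blast
        have "R w \<noteq> R' w"
        proof
          assume "R w = R' w"
          then have "u = w" using w u inj(2) by (auto dest: inj_onD)
          then show False using w u by simp
        qed
        then show "R' u \<in> R ` ?M" using w by blast
      qed
      have "card (R' ` ?M) = card (R ` ?M)"
        using inj by (simp add: card_image inj_on_def)
      then have eq: "R' ` ?M = R ` ?M" using sub D by (intro card_subset_eq) auto
      obtain u where u: "u \<in> D" "R u \<noteq> R' u" using \<open>?m R \<noteq> 0\<close> D by auto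
      then have "R u \<in> R' ` ?M" unfolding eq by blast
      then obtain w where w: "w \<in> D" "R w \<noteq> R' w" "R' w = R u" by auto
      have wu: "w \<noteq> u" using w u by auto
      have "\<not> N \<subseteq> R ` D"
        using dN card_injs_image[OF R] D card_mono[of "R ` D" N] by auto
      then obtain s where s: "s \<in> N - R ` D" by blast
      let ?Q = "R(u := s)"
      have Q: "?Q \<in> injs D N" using R u s by (intro injs_update) auto
      have T: "\<bar>\<phi> R - \<phi> ?Q\<bar> \<le> T" by (rule move[OF R u(1) s])
      have x: "R u \<in> N - ?Q ` D"
        using injs_image[OF R] u s inj(1) by (auto dest: inj_onD)
      let ?P = "?Q(w := R u)"
      have P: "?P \<in> injs D N" using x by (intro injs_update[OF Q w(1)]) blast+
      have T2: "\<bar>\<phi> ?Q - \<phi> ?P\<bar> \<le> T" by (rule move[OF Q w(1) x])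
      have sR: "s \<noteq> R' u" using False u s by auto
      have m: "?m ?P + 1 \<le> ?m R"
      proof (rule dec)
        have "w \<in> {u \<in> D. R u \<noteq> R' u}" "w \<notin> {u \<in> D. ?P u \<noteq> R' u}" using w by simp_all
        moreover have "{u \<in> D. ?P u \<noteq> R' u} \<subseteq> {u \<in> D. R u \<noteq> R' u}"
        proof
          fix a assume a: "a \<in> {u \<in> D. ?P u \<noteq> R' u}"
          then have "a \<noteq> w" using w by auto
          with a u show "a \<in> {u \<in> D. R u \<noteq> R' u}" by (cases "a = u") simp_all
        qed
        ultimately show "{u \<in> D. ?P u \<noteq> R' u} \<subset> {u \<in> D. R u \<noteq> R' u}" by blast
      qed
      have "\<bar>\<phi> ?P - \<phi> R'\<bar> \<le> 2 * real (?m ?P) * T" using less.hyps[OF _ P] m by simp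
      moreover have "2 * real (?m ?P) * T + 2 * T \<le> 2 * real (?m R) * T"
      proof -
        have "T \<ge> 0" using T by linarith
        then have "(2 * real (?m ?P) + 2) * T \<le> (2 * real (?m R)) * T"
          using m by (intro mult_right_mono) auto
        then show ?thesis by (simp add: algebra_simps)
      qed
      ultimately show ?thesis using T T2 by linarith
    qed
  qed
qed

text \<open>Rows have bounded size, so a crude path argument suffices: every row is compared with
  one fixed row along at most \<open>2 * card D\<close> moves, and each increment is at most the
  square root of the whole energy.\<close>

lemma injs_poincare:
  fixes m :: real
  assumes D: "finite D" and N: "finite N" and dN: "card D < card N"
    and m: "m = (\<Sum>R\<in>injs D N. \<phi> R) / card (injs D N)"
  shows "(\<Sum>R\<in>injs D N. (\<phi> R - m)\<^sup>2) \<le> 4 * real (card D)^2 * card (injs D N) * row_energy D N \<phi>"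
proof (cases "injs D N = {}")
  case False
  then obtain R' where R': "R' \<in> injs D N" by blast
  note fin = finite_injs[OF D N]
  define T where "T = sqrt (row_energy D N \<phi>)"
  have T2: "T\<^sup>2 = row_energy D N \<phi>" unfolding T_def using row_energy_nonneg by simp
  have T0: "T \<ge> 0" unfolding T_def using row_energy_nonneg by simp
  have move: "\<bar>\<phi> R - \<phi> (R(u := x))\<bar> \<le> T" if "R \<in> injs D N" "u \<in> D" "x \<in> N - R ` D" for R u x
  proof -
    have "(\<phi> R - \<phi> (R(u := x)))\<^sup>2 \<le> (\<Sum>x\<in>N - R ` D. (\<phi> R - \<phi> (R(u := x)))\<^sup>2)"
      using that N by (intro member_le_sum) auto
    also have "\<dots> \<le> (\<Sum>u\<in>D. \<Sum>x\<in>N - R ` D. (\<phi> R - \<phi> (R(u := x)))\<^sup>2)"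
      using that D by (intro member_le_sum) (auto intro: sum_nonneg)
    also have "\<dots> \<le> row_energy D N \<phi>"
      unfolding row_energy_def
      using that fin by (intro member_le_sum[where f="\<lambda>R. \<Sum>u\<in>D. \<Sum>x\<in>N - R ` D. (\<phi> R - \<phi> (R(u := x)))\<^sup>2"]) (auto intro!: sum_nonneg)
    finally show ?thesis unfolding T_def by (simp add: real_le_rsqrt)
  qed
  have "(\<Sum>R\<in>injs D N. (\<phi> R - m)\<^sup>2) \<le> (\<Sum>R\<in>injs D N. (\<phi> R - \<phi> R')\<^sup>2)"
    by (rule sum_square_dev_le[OF fin False m])
  also have "\<dots> \<le> (\<Sum>R\<in>injs D N. (2 * real (card D) * T)\<^sup>2)"
  proof (rule sum_mono)
    fix R assume R: "R \<in> injs D N"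
    have "\<bar>\<phi> R - \<phi> R'\<bar> \<le> 2 * real (card {u\<in>D. R u \<noteq> R' u}) * T"
      by (rule injs_connected[OF D N dN move R' R])
    also have "\<dots> \<le> 2 * real (card D) * T"
      using D T0 by (intro mult_right_mono) (auto intro!: card_mono)
    finally show "(\<phi> R - \<phi> R')\<^sup>2 \<le> (2 * real (card D) * T)\<^sup>2"
      by (metis abs_ge_zero power2_abs power_mono)
  qed
  also have "\<dots> = 4 * real (card D)^2 * card (injs D N) * row_energy D N \<phi>"
    by (simp add: power_mult_distrib T2)
  finally show ?thesis .
qed (use row_energy_nonneg[of D N \<phi>] in auto)

text \<open>Up to the scale \<open>W'\<close>, the difference \<open>g - m b\<close> is the
  deviation of \<open>P b\<close>, the sum over the rows using b, from its mean over all b. The sum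
  of squares is therefore a sum of terms \<open>P b - P c\<close>. In such a term the rows with both
  colors cancel, and exchanging b and c pairs the others so that only one child changes.
  Cauchy-Schwarz costs the number \<open>cnt\<close> of paired rows, and over all (b, c) each move
  in \<open>row_energy\<close> occurs once.\<close>

lemma injs_mean_avoiding:
  fixes \<phi> :: "('b \<Rightarrow> nat) \<Rightarrow> real" and g :: real and m :: "nat \<Rightarrow> real"
  assumes D: "finite D" and N: "finite N" and n2: "card N \<ge> 2" and dN: "card D < card N"
    and g: "g = (\<Sum>R\<in>injs D N. \<phi> R) / card (injs D N)"
    and m: "\<And>b. m b = (\<Sum>R\<in>injs D (N - {b}). \<phi> R) / card (injs D (N - {b}))"
    and ne: "injs D N \<noteq> {}"
  shows "card (injs D N) * (\<Sum>b\<in>N. (g - m b)\<^sup>2)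
    \<le> card D / (2 * (real (card N) - 1) * (real (card N) - card D)) * row_energy D N \<phi>"
proof -
  define I where "I = injs D N"
  define n d W where "n = real (card N)" "d = real (card D)" "W = real (card I)"
  \<comment> \<open>The number of rows avoiding one given color, whichever color it is.\<close>
  define W' where "W' = W * (n - d) / n"
  define P where "P b = (\<Sum>R\<in>{R\<in>I. b \<in> R ` D}. \<phi> R)" for b
  have finI: "finite I" unfolding I_def using finite_injs[OF D N] .
  have W0: "W > 0" unfolding n_d_W_def(3) I_def using ne finI I_def by (simp add: card_gt_0_iff)
  have n0: "n \<ge> 2" "n - d > 0" "d \<ge> 0" unfolding n_d_W_def using n2 dN by auto
  have W'0: "W' > 0" unfolding W'_def using W0 n0 by simp
  have cardW': "real (card (injs D (N - {b}))) = W'" if "b \<in> N" for b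
    using card_injs_remove[OF D N that] n0 unfolding W'_def n_d_W_def I_def by (simp add: field_simps)
  have split: "W * g = P b + W' * m b" if b: "b \<in> N" for b
  proof -
    have "W * g = (\<Sum>R\<in>I. \<phi> R)" unfolding g n_d_W_def(3) I_def using W0 n_d_W_def(3) I_def by simp
    also have "\<dots> = P b + (\<Sum>R\<in>{R\<in>I. b \<notin> R ` D}. \<phi> R)"
      unfolding P_def using finI by (subst sum.union_disjoint[symmetric]) (auto intro!: sum.cong)
    also have "{R\<in>I. b \<notin> R ` D} = injs D (N - {b})" unfolding injs_avoid I_def by auto
    also have "(\<Sum>R\<in>injs D (N - {b}). \<phi> R) = W' * m b" unfolding m cardW'[OF b] using W'0 by simp
    finally show ?thesis .
  qed
  have sumP: "(\<Sum>b\<in>N. P b) = d * (W * g)"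
  proof -
    have "(\<Sum>b\<in>N. P b) = (\<Sum>b\<in>N. \<Sum>R\<in>I. if b \<in> R ` D then \<phi> R else 0)"
      unfolding P_def using finI by (simp add: sum.inter_filter)
    also have "\<dots> = (\<Sum>R\<in>I. \<Sum>b\<in>N. if b \<in> R ` D then \<phi> R else 0)" by (rule sum.swap)
    also have "\<dots> = (\<Sum>R\<in>I. d * \<phi> R)"
    proof (intro sum.cong refl)
      fix R assume R: "R \<in> I"
      then have "{b \<in> N. b \<in> R ` D} = R ` D" using injs_image unfolding I_def by blast
      then show "(\<Sum>b\<in>N. if b \<in> R ` D then \<phi> R else 0) = d * \<phi> R"
        using N card_injs_image[OF R[unfolded I_def]] unfolding n_d_W_def by (simp flip: sum.inter_filter)
    qed
    also have "\<dots> = d * (W * g)"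
      unfolding sum_distrib_left[symmetric] g n_d_W_def(3) I_def using W0 n_d_W_def(3) I_def by simp
    finally show ?thesis .
  qed
  define M where "M = (\<Sum>b\<in>N. P b) / card N"
  have dev: "W' * (g - m b) = P b - M" if "b \<in> N" for b
  proof -
    have "M = d * W * g / n" unfolding M_def sumP n_d_W_def by simp
    moreover have "W' = W - d * W / n" unfolding W'_def using n0 by (simp add: field_simps)
    moreover have "(W - d * W / n) * (g - m b) = W * g - d * W * g / n - (W - d * W / n) * m b"
      by (simp add: algebra_simps diff_divide_distrib)
    ultimately show ?thesis using split[OF that] by simp
  qed
  \<comment> \<open>The number of rows that use one given color and avoid another: of the
    \<open>W'\<close> rows avoiding the latter, the share \<open>d / (n - 1)\<close> uses the
    former.\<close>
  define cnt where "cnt = W' * d / (n - 1)"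
  have cnt: "real (card {R\<in>I. b \<in> R ` D \<and> c \<notin> R ` D}) = cnt" if bc: "b \<in> N" "c \<in> N" "b \<noteq> c" for b c
  proof -
    have "{R\<in>I. b \<in> R ` D \<and> c \<notin> R ` D} = injs D (N - {c}) - injs D (N - {c} - {b})"
      unfolding injs_avoid I_def by auto
    moreover have "injs D (N - {c} - {b}) \<subseteq> injs D (N - {c})" by (rule injs_mono) auto
    moreover have "real (card (N - {c})) = n - 1"
      unfolding n_d_W_def using bc N n2 by (simp add: of_nat_diff)
    ultimately have "real (card {R\<in>I. b \<in> R ` D \<and> c \<notin> R ` D}) = W' - real (card (injs D (N - {c} - {b})))"
      using D N finite_injs[of D "N - {c}"] finite_injs[of D "N - {c} - {b}"] cardW'[OF bc(2)]
      by (simp add: card_Diff_subset of_nat_diff card_mono)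
    moreover have "(n - 1) * real (card (injs D (N - {c} - {b}))) = (n - 1 - d) * W'"
      using card_injs_remove[OF D, of "N - {c}" b] N bc cardW'[OF bc(2)] \<open>real (card (N - {c})) = n - 1\<close>
      unfolding n_d_W_def by simp
    ultimately have "(n - 1) * real (card {R\<in>I. b \<in> R ` D \<and> c \<notin> R ` D}) = (n - 1) * W' - (n - 1 - d) * W'"
      by (simp add: right_diff_distrib)
    also have "\<dots> = W' * d" by (simp add: algebra_simps)
    finally have "(n - 1) * real (card {R\<in>I. b \<in> R ` D \<and> c \<notin> R ` D}) = W' * d" .
    then show ?thesis unfolding cnt_def using n0 by (simp add: eq_divide_eq mult.commute)
  qed
  define t where "t R u x = (\<phi> R - \<phi> (R(u := x)))\<^sup>2" for R u x
  have Pdiff: "(P b - P c)\<^sup>2 \<le> cnt * (\<Sum>R\<in>I. \<Sum>u\<in>D. if R u = b \<and> c \<notin> R ` D then t R u c else 0)"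
    if bc: "b \<in> N" "c \<in> N" for b c
  proof (cases "b = c")
    case True
    have "cnt \<ge> 0" unfolding cnt_def using W'0 n0 by simp
    then show ?thesis using True by (auto intro!: mult_nonneg_nonneg sum_nonneg simp: t_def)
  next
    case False
    \<comment> \<open>Exchanging b and c is an involution carrying the rows with b and without c to
      those with c and without b; on such a row it moves exactly one child, from b to c.\<close>
    define \<sigma> where "\<sigma> R = restrict (Transposition.transpose b c \<circ> R) D" for R :: "'b \<Rightarrow> nat"
    let ?bc = "{R\<in>I. b \<in> R ` D \<and> c \<notin> R ` D}" and ?cb = "{R\<in>I. c \<in> R ` D \<and> b \<notin> R ` D}"
    have \<sigma>I: "\<sigma> R \<in> I" if "R \<in> I" for R
    proof -
      have "inj_on (Transposition.transpose b c \<circ> R) D" using that unfolding I_def injs_def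
        by (auto intro!: comp_inj_on inj_on_subset[OF inj_transpose])
      then have "inj_on (\<sigma> R) D" unfolding \<sigma>_def by (simp add: inj_on_def)
      moreover have "Transposition.transpose b c x \<in> N" if "x \<in> N" for x
        using \<open>x \<in> N\<close> bc by (auto simp: Transposition.transpose_def)
      then have "\<sigma> R \<in> D \<rightarrow>\<^sub>E N"
        using injs_image[OF that[unfolded I_def]] unfolding \<sigma>_def by auto
      ultimately show ?thesis unfolding I_def injs_def by blast
    qed
    have \<sigma>\<sigma>: "\<sigma> (\<sigma> R) = R" if "R \<in> I" for R
      using that unfolding I_def injs_def \<sigma>_def by (auto simp: fun_eq_iff PiE_def extensional_def)
    have im: "\<sigma> R ` D = Transposition.transpose b c ` R ` D" for R unfolding \<sigma>_def by auto
    have imb: "b \<in> \<sigma> R ` D \<longleftrightarrow> c \<in> R ` D" "c \<in> \<sigma> R ` D \<longleftrightarrow> b \<in> R ` D" for R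
    proof -
      have "x \<in> Transposition.transpose b c ` A \<longleftrightarrow> Transposition.transpose b c x \<in> A" for x A
        by (metis image_iff transpose_involutory)
      then show "b \<in> \<sigma> R ` D \<longleftrightarrow> c \<in> R ` D" "c \<in> \<sigma> R ` D \<longleftrightarrow> b \<in> R ` D"
        unfolding im by simp_all
    qed
    have "P b - P c = (\<Sum>R\<in>?bc. \<phi> R) - (\<Sum>R\<in>?cb. \<phi> R)"
    proof -
      have "P b = (\<Sum>R\<in>?bc. \<phi> R) + (\<Sum>R\<in>{R\<in>I. b \<in> R ` D \<and> c \<in> R ` D}. \<phi> R)"
        unfolding P_def using finI by (subst sum.union_disjoint[symmetric]) (auto intro!: sum.cong)
      moreover have "P c = (\<Sum>R\<in>?cb. \<phi> R) + (\<Sum>R\<in>{R\<in>I. b \<in> R ` D \<and> c \<in> R ` D}. \<phi> R)"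
        unfolding P_def using finI by (subst sum.union_disjoint[symmetric]) (auto intro!: sum.cong)
      ultimately show ?thesis by simp
    qed
    also have "(\<Sum>R\<in>?cb. \<phi> R) = (\<Sum>R\<in>?bc. \<phi> (\<sigma> R))"
      by (rule sum.reindex_bij_witness[where i=\<sigma> and j=\<sigma>]) (auto simp: \<sigma>\<sigma> \<sigma>I imb)
    finally have "P b - P c = (\<Sum>R\<in>?bc. \<phi> R - \<phi> (\<sigma> R))" by (simp add: sum_subtractf)
    then have "(P b - P c)\<^sup>2 \<le> (\<Sum>R\<in>?bc. (\<phi> R - \<phi> (\<sigma> R))\<^sup>2) * card ?bc"
      by (simp add: sum_squared_le_sum_of_squares)
    also have "\<dots> = cnt * (\<Sum>R\<in>?bc. (\<phi> R - \<phi> (\<sigma> R))\<^sup>2)" using cnt[OF bc False] by simp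
    also have "(\<Sum>R\<in>?bc. (\<phi> R - \<phi> (\<sigma> R))\<^sup>2)
        = (\<Sum>R\<in>?bc. \<Sum>u\<in>D. if R u = b \<and> c \<notin> R ` D then t R u c else 0)"
    proof (intro sum.cong refl)
      fix R assume R: "R \<in> ?bc"
      then obtain u where u: "u \<in> D" "R u = b" by auto
      have inj: "inj_on R D" and ext: "R \<in> extensional D"
        using R unfolding I_def injs_def by (auto simp: PiE_def)
      have \<sigma>R: "\<sigma> R = R(u := c)"
      proof
        fix w show "\<sigma> R w = (R(u := c)) w"
          using R u inj ext False by (cases "w \<in> D") (auto simp: \<sigma>_def Transposition.transpose_def extensional_def dest: inj_onD)
      qed
      have "(\<Sum>w\<in>D. if R w = b \<and> c \<notin> R ` D then t R w c else 0) = (\<Sum>w\<in>D. if w = u then t R u c else 0)"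
        using R u inj by (intro sum.cong) (auto dest: inj_onD)
      also have "\<dots> = t R u c" using D u by simp
      finally show "(\<phi> R - \<phi> (\<sigma> R))\<^sup>2 = (\<Sum>u\<in>D. if R u = b \<and> c \<notin> R ` D then t R u c else 0)"
        unfolding \<sigma>R t_def by simp
    qed
    also have "\<dots> = (\<Sum>R\<in>I. \<Sum>u\<in>D. if R u = b \<and> c \<notin> R ` D then t R u c else 0)"
      by (rule sum.mono_neutral_left) (use finI in \<open>auto intro!: sum.neutral split: if_splits\<close>)
    finally show ?thesis .
  qed
  have "(\<Sum>b\<in>N. \<Sum>c\<in>N. (P b - P c)\<^sup>2)
      \<le> (\<Sum>b\<in>N. \<Sum>c\<in>N. cnt * (\<Sum>R\<in>I. \<Sum>u\<in>D. if R u = b \<and> c \<notin> R ` D then t R u c else 0))"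
    by (intro sum_mono Pdiff)
  also have "\<dots> = cnt * (\<Sum>b\<in>N. \<Sum>c\<in>N. \<Sum>R\<in>I. \<Sum>u\<in>D. if R u = b \<and> c \<notin> R ` D then t R u c else 0)"
    by (simp add: sum_distrib_left)
  also have "(\<Sum>b\<in>N. \<Sum>c\<in>N. \<Sum>R\<in>I. \<Sum>u\<in>D. if R u = b \<and> c \<notin> R ` D then t R u c else 0)
      = (\<Sum>c\<in>N. \<Sum>R\<in>I. \<Sum>u\<in>D. \<Sum>b\<in>N. if R u = b \<and> c \<notin> R ` D then t R u c else 0)"
    by (rule trans[OF sum.swap], rule sum.cong[OF refl], rule trans[OF sum.swap], rule sum.cong[OF refl],
        rule sum.swap)
  \<comment> \<open>When child u is moved to c, the color b is determined as \<open>R u\<close>, so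
    the sum over b has a single term and no move is counted twice.\<close>
  also have "\<dots> = (\<Sum>c\<in>N. \<Sum>R\<in>I. \<Sum>u\<in>D. if c \<notin> R ` D then t R u c else 0)"
  proof (intro sum.cong refl)
    fix c R u assume "c \<in> N" "R \<in> I" "u \<in> D"
    then have "R u \<in> N" using injs_image unfolding I_def by blast
    then show "(\<Sum>b\<in>N. if R u = b \<and> c \<notin> R ` D then t R u c else 0) = (if c \<notin> R ` D then t R u c else 0)"
      using N by auto
  qed
  also have "\<dots> = (\<Sum>R\<in>I. \<Sum>u\<in>D. \<Sum>c\<in>N. if c \<notin> R ` D then t R u c else 0)"
    by (rule trans[OF sum.swap], rule sum.cong[OF refl], rule sum.swap)
  also have "\<dots> = row_energy D N \<phi>"
    unfolding row_energy_def I_def t_def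
    by (rule sum.cong[OF refl], rule sum.cong[OF refl])
      (use N in \<open>simp add: sum.inter_filter[symmetric] set_diff_eq\<close>)
  finally have PP: "(\<Sum>b\<in>N. \<Sum>c\<in>N. (P b - P c)\<^sup>2) \<le> cnt * row_energy D N \<phi>" .
  have N0: "N \<noteq> {}" using n2 by auto
  have "(\<Sum>b\<in>N. \<Sum>c\<in>N. (P b - P c)\<^sup>2) = 2 * n * (\<Sum>b\<in>N. (P b - M)\<^sup>2)"
  proof -
    have "(\<Sum>b\<in>N. P b) = n * M" unfolding M_def n_d_W_def using N N0 by simp
    then show ?thesis
      unfolding sum_sum_square_diff sum_square_dev[OF N N0 M_def] n_d_W_def
      by (simp add: algebra_simps power2_eq_square)
  qed
  also have "(\<Sum>b\<in>N. (P b - M)\<^sup>2) = W'\<^sup>2 * (\<Sum>b\<in>N. (g - m b)\<^sup>2)"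
    by (simp add: sum_distrib_left dev[symmetric] power_mult_distrib cong: sum.cong)
  finally have "2 * n * W'\<^sup>2 * (\<Sum>b\<in>N. (g - m b)\<^sup>2) \<le> cnt * row_energy D N \<phi>" using PP by simp
  then have "W' * (2 * n * W' * (\<Sum>b\<in>N. (g - m b)\<^sup>2)) \<le> W' * (d / (n - 1) * row_energy D N \<phi>)"
    unfolding cnt_def by (simp add: power2_eq_square mult_ac)
  then have "2 * n * W' * (\<Sum>b\<in>N. (g - m b)\<^sup>2) \<le> d / (n - 1) * row_energy D N \<phi>"
    using W'0 by (simp only: mult_le_cancel_left_pos)
  moreover have "2 * n * W' = (2 * (n - d)) * W" unfolding W'_def using n0 by simp
  ultimately have "(2 * (n - d)) * (W * (\<Sum>b\<in>N. (g - m b)\<^sup>2)) \<le> d / (n - 1) * row_energy D N \<phi>"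
    by (simp only: mult.assoc[symmetric])
  then have "W * (\<Sum>b\<in>N. (g - m b)\<^sup>2) \<le> (d / (n - 1) * row_energy D N \<phi>) / (2 * (n - d))"
    using n0 by (subst pos_le_divide_eq) (simp_all only: mult.commute[of _ "2 * (n - d)"], simp)
  also have "\<dots> = d / (2 * (n - 1) * (n - d)) * row_energy D N \<phi>" using n0 by (simp add: field_simps)
  finally show ?thesis unfolding n_d_W_def I_def .
qed

section \<open>Increments of row means when the parent color changes\<close>

lemma sum_remove_eq_if:
  fixes f :: "'b \<Rightarrow> real"
  assumes "finite S" "a \<in> S"
  shows "(\<Sum>b\<in>S - {a}. f b) = (\<Sum>b\<in>S. if b = a then 0 else f b)"
  using assms by (simp add: sum.remove)

lemma sum_swap_distinct:
  fixes f :: "'b \<Rightarrow> 'b \<Rightarrow> real"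
  assumes "finite S"
  shows "(\<Sum>a\<in>S. \<Sum>b\<in>S - {a}. f b a) = (\<Sum>a\<in>S. \<Sum>b\<in>S - {a}. f a b)"
proof -
  have "(\<Sum>a\<in>S. \<Sum>b\<in>S - {a}. f b a) = (\<Sum>a\<in>S. \<Sum>b\<in>S. if b = a then 0 else f b a)"
    using assms by (intro sum.cong refl sum_remove_eq_if)
  also have "\<dots> = (\<Sum>b\<in>S. \<Sum>a\<in>S. if b = a then 0 else f b a)" by (rule sum.swap)
  also have "\<dots> = (\<Sum>b\<in>S. \<Sum>a\<in>S. if a = b then 0 else f b a)" by (intro sum.cong) auto
  also have "\<dots> = (\<Sum>a\<in>S. \<Sum>b\<in>S - {a}. f a b)"
    using assms by (intro sum.cong refl sum_remove_eq_if[symmetric])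
  finally show ?thesis .
qed

text \<open>The increments of \<open>g\<close> are split through the averages of \<open>\<phi> a\<close> over the rows avoiding \<open>b\<close>.\<close>

lemma mean_increments_le:
  fixes \<phi> :: "nat \<Rightarrow> ('b \<Rightarrow> nat) \<Rightarrow> real" and g :: "nat \<Rightarrow> real"
  assumes D: "finite D" and Q: "finite Q" and S: "S \<subseteq> Q" and dQ: "card D + 3 \<le> card Q"
    and \<eta>: "\<eta> > 0" and W: "\<And>a. a \<in> Q \<Longrightarrow> card (injs D (Q - {a})) = W"
    and g: "\<And>a. g a = (\<Sum>R\<in>injs D (Q - {a}). \<phi> a R) / W"
  shows "W * (\<Sum>a\<in>S. \<Sum>b\<in>S. (g a - g b)\<^sup>2)
     \<le> (1 + \<eta>) * (2 * card D / ((real (card Q) - 2) * (real (card Q) - 1 - card D)))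
          * (\<Sum>a\<in>S. row_energy D (Q - {a}) (\<phi> a))
       + (1 + 1 / \<eta>) * real (card Q)
          * (\<Sum>a\<in>S. \<Sum>b\<in>S - {a}. \<Sum>R\<in>injs D (Q - {a} - {b}). (\<phi> a R - \<phi> b R)\<^sup>2)"
proof (cases "W = 0")
  case True
  have "0 \<le> (1 + \<eta>) * (2 * card D / ((real (card Q) - 2) * (real (card Q) - 1 - card D)))
          * (\<Sum>a\<in>S. row_energy D (Q - {a}) (\<phi> a))"
    using \<eta> dQ by (intro mult_nonneg_nonneg divide_nonneg_nonneg sum_nonneg row_energy_nonneg) auto
  moreover have "0 \<le> (1 + 1 / \<eta>) * real (card Q)
          * (\<Sum>a\<in>S. \<Sum>b\<in>S - {a}. \<Sum>R\<in>injs D (Q - {a} - {b}). (\<phi> a R - \<phi> b R)\<^sup>2)"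
    using \<eta> by (intro mult_nonneg_nonneg sum_nonneg) auto
  ultimately show ?thesis using True by simp
next
  case False
  define n d where "n = real (card Q) - 1" "d = real (card D)"
  have n0: "n \<ge> 2" "n - d \<ge> 1" "d \<ge> 0" using dQ unfolding n_d_def by auto
  have finS: "finite S" using S Q finite_subset by blast
  \<comment> \<open>The rows averaged in \<open>m a b\<close> avoid both colors, so they remain
    admissible when the parent is recolored from a to b.\<close>
  define m where "m a b = (\<Sum>R\<in>injs D (Q - {a} - {b}). \<phi> a R) / card (injs D (Q - {a} - {b}))" for a b
  have cQ: "real (card (Q - {a})) = n" if "a \<in> Q" for a
    using that Q dQ unfolding n_d_def by (simp add: of_nat_diff)
  define W' where "W' = W * (n - d) / n"
  have W'0: "W' > 0" unfolding W'_def using False n0 by simp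
  have cardW': "real (card (injs D (Q - {a} - {b}))) = W'" if "a \<in> Q" "b \<in> Q" "a \<noteq> b" for a b
  proof -
    have "n * real (card (injs D (Q - {a} - {b}))) = (n - d) * W"
      using card_injs_remove[OF D, of "Q - {a}" b] that Q cQ[OF that(1)] W[OF that(1)] unfolding n_d_def by simp
    then show ?thesis unfolding W'_def using n0 by (simp add: field_simps)
  qed
  have X: "W * (\<Sum>b\<in>S - {a}. (g a - m a b)\<^sup>2)
      \<le> d / (2 * (n - 1) * (n - d)) * row_energy D (Q - {a}) (\<phi> a)" if a: "a \<in> S" for a
  proof -
    have aQ: "a \<in> Q" using a S by auto
    have "W * (\<Sum>b\<in>S - {a}. (g a - m a b)\<^sup>2) \<le> W * (\<Sum>b\<in>Q - {a}. (g a - m a b)\<^sup>2)"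
      using S Q by (intro mult_left_mono sum_mono2) auto
    also have "\<dots> \<le> d / (2 * (n - 1) * (n - d)) * row_energy D (Q - {a}) (\<phi> a)"
    proof -
      have ne: "injs D (Q - {a}) \<noteq> {}" using False W[OF aQ] by auto
      have c: "card (Q - {a}) \<ge> 2" "card D < card (Q - {a})" using aQ Q dQ by auto
      have ga: "g a = (\<Sum>R\<in>injs D (Q - {a}). \<phi> a R) / card (injs D (Q - {a}))"
        unfolding g W[OF aQ] ..
      show ?thesis
        using injs_mean_avoiding[OF D _ c ga m_def ne] Q W[OF aQ] cQ[OF aQ] unfolding n_d_def by simp
    qed
    finally show ?thesis .
  qed
  \<comment> \<open>\<open>m a b\<close> and \<open>m b a\<close> are means over the same rows. They
    can be compared row by row, and each comparison is a recoloring of the parent alone.\<close>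
  have Z: "W' * (m a b - m b a)\<^sup>2 \<le> (\<Sum>R\<in>injs D (Q - {a} - {b}). (\<phi> a R - \<phi> b R)\<^sup>2)"
    if ab: "a \<in> S" "b \<in> S - {a}" for a b
  proof -
    let ?I = "injs D (Q - {a} - {b})"
    have I: "card ?I = W'" using cardW'[of a b] ab S by auto
    have "Q - {b} - {a} = Q - {a} - {b}" by auto
    then have "m a b - m b a = (\<Sum>R\<in>?I. \<phi> a R - \<phi> b R) / W'"
      unfolding m_def using I by (simp add: sum_subtractf diff_divide_distrib)
    then have "W' * (m a b - m b a)\<^sup>2 = (\<Sum>R\<in>?I. \<phi> a R - \<phi> b R)\<^sup>2 / W'"
      using W'0 by (simp add: power_divide power2_eq_square)
    also have "\<dots> \<le> (\<Sum>R\<in>?I. (\<phi> a R - \<phi> b R)\<^sup>2)"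
      using sum_squared_le_sum_of_squares[of "\<lambda>R. \<phi> a R - \<phi> b R" ?I] I W'0
      by (simp add: pos_divide_le_eq)
    finally show ?thesis .
  qed
  have pt: "(g a - g b)\<^sup>2 \<le> 2 * (1 + \<eta>) * ((g a - m a b)\<^sup>2 + (g b - m b a)\<^sup>2) + (1 + 1 / \<eta>) * (m a b - m b a)\<^sup>2" for a b
  proof -
    have "(g a - g b)\<^sup>2 = (((g a - m a b) - (g b - m b a)) + (m a b - m b a))\<^sup>2" by simp
    also note square_sum_split3(2)[OF \<eta>]
    finally show ?thesis .
  qed
  let ?X = "\<Sum>a\<in>S. \<Sum>b\<in>S - {a}. (g a - m a b)\<^sup>2"
  let ?Z = "\<Sum>a\<in>S. \<Sum>b\<in>S - {a}. (m a b - m b a)\<^sup>2"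
  have "(\<Sum>a\<in>S. \<Sum>b\<in>S. (g a - g b)\<^sup>2) = (\<Sum>a\<in>S. \<Sum>b\<in>S - {a}. (g a - g b)\<^sup>2)"
    by (rule sum.cong[OF refl], subst sum.remove[OF finS]) auto
  also have "\<dots> \<le> (\<Sum>a\<in>S. \<Sum>b\<in>S - {a}.
      2 * (1 + \<eta>) * ((g a - m a b)\<^sup>2 + (g b - m b a)\<^sup>2) + (1 + 1 / \<eta>) * (m a b - m b a)\<^sup>2)"
    by (intro sum_mono pt)
  also have "\<dots> = 2 * (1 + \<eta>) * (?X + (\<Sum>a\<in>S. \<Sum>b\<in>S - {a}. (g b - m b a)\<^sup>2)) + (1 + 1 / \<eta>) * ?Z"
    by (simp only: sum.distrib sum_distrib_left[symmetric])
  also have "(\<Sum>a\<in>S. \<Sum>b\<in>S - {a}. (g b - m b a)\<^sup>2) = ?X"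
    by (rule sum_swap_distinct[OF finS])
  finally have "W * (\<Sum>a\<in>S. \<Sum>b\<in>S. (g a - g b)\<^sup>2) \<le> W * (2 * (1 + \<eta>) * (?X + ?X) + (1 + 1 / \<eta>) * ?Z)"
    by (intro mult_left_mono) auto
  \<comment> \<open>The deviations at a and at b have equal sums by symmetry. The contraction factor
    thus becomes \<open>4 * (1 + \<eta>)\<close> times the coefficient of
    \<open>injs_mean_avoiding\<close> with \<open>n = card Q - 1\<close> colors.\<close>
  also have "\<dots> = 4 * (1 + \<eta>) * (W * ?X) + (1 + 1 / \<eta>) * (W * ?Z)" by (simp add: algebra_simps)
  also have "W * ?X \<le> (\<Sum>a\<in>S. d / (2 * (n - 1) * (n - d)) * row_energy D (Q - {a}) (\<phi> a))"
    unfolding sum_distrib_left using X by (intro sum_mono) (simp add: sum_distrib_left)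
  \<comment> \<open>Only boundedness matters for this term: \<open>n - d \<ge> 1\<close> gives
    \<open>W \<le> n * W'\<close>.\<close>
  also have "W * ?Z \<le> real (card Q) * (\<Sum>a\<in>S. \<Sum>b\<in>S - {a}. \<Sum>R\<in>injs D (Q - {a} - {b}). (\<phi> a R - \<phi> b R)\<^sup>2)"
  proof -
    have "W * ?Z \<le> n * (W' * ?Z)"
    proof -
      have "n * W' = W * (n - d)" unfolding W'_def using n0 by simp
      moreover have "real W * 1 \<le> W * (n - d)" using n0 by (intro mult_left_mono) auto
      ultimately have "real W \<le> n * W'" by simp
      then have "W * ?Z \<le> n * W' * ?Z" by (intro mult_right_mono sum_nonneg) auto
      then show ?thesis by simp
    qed
    also have "\<dots> \<le> n * (\<Sum>a\<in>S. \<Sum>b\<in>S - {a}. \<Sum>R\<in>injs D (Q - {a} - {b}). (\<phi> a R - \<phi> b R)\<^sup>2)"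
      unfolding sum_distrib_left[of W'] using Z n0 by (intro mult_left_mono sum_mono) auto
    also have "\<dots> \<le> real (card Q) * (\<Sum>a\<in>S. \<Sum>b\<in>S - {a}. \<Sum>R\<in>injs D (Q - {a} - {b}). (\<phi> a R - \<phi> b R)\<^sup>2)"
      unfolding n_d_def by (intro mult_right_mono sum_nonneg) auto
    finally show ?thesis .
  qed
  finally have "W * (\<Sum>a\<in>S. \<Sum>b\<in>S. (g a - g b)\<^sup>2)
      \<le> 4 * (1 + \<eta>) * (\<Sum>a\<in>S. d / (2 * (n - 1) * (n - d)) * row_energy D (Q - {a}) (\<phi> a))
       + (1 + 1 / \<eta>) * (real (card Q) * (\<Sum>a\<in>S. \<Sum>b\<in>S - {a}. \<Sum>R\<in>injs D (Q - {a} - {b}). (\<phi> a R - \<phi> b R)\<^sup>2))"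
    using \<eta> by (simp add: mult_left_mono)
  moreover have "4 * (1 + \<eta>) * (\<Sum>a\<in>S. d / (2 * (n - 1) * (n - d)) * row_energy D (Q - {a}) (\<phi> a))
      = (1 + \<eta>) * (2 * d / ((n - 1) * (n - d))) * (\<Sum>a\<in>S. row_energy D (Q - {a}) (\<phi> a))"
  proof -
    have "2 * d / ((n - 1) * (n - d)) = 4 * (d / (2 * (n - 1) * (n - d)))"
    proof -
      have "2 * d / x = 4 * (d / (2 * x))" for x :: real by simp
      then show ?thesis by (simp only: mult.assoc)
    qed
    then show ?thesis unfolding sum_distrib_left[symmetric] by simp
  qed
  ultimately show ?thesis unfolding n_d_def by (simp add: mult.assoc)
qed

section \<open>Exchanging the colors of an edge and its only child\<close>

definition distinct_triples :: "'b set \<Rightarrow> ('b \<times> 'b \<times> 'b) set" where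
  "distinct_triples S = {(a, b, c). a \<in> S \<and> b \<in> S \<and> c \<in> S \<and> a \<noteq> b \<and> a \<noteq> c \<and> b \<noteq> c}"

lemma sum_distinct_triples:
  fixes f :: "'b \<Rightarrow> 'b \<Rightarrow> 'b \<Rightarrow> real"
  assumes "finite S"
  shows "(\<Sum>(a, b, c)\<in>distinct_triples S. f a b c) = (\<Sum>a\<in>S. \<Sum>b\<in>S - {a}. \<Sum>c\<in>S - {a, b}. f a b c)"
proof -
  have "distinct_triples S = (SIGMA a:S. SIGMA b:S - {a}. S - {a, b})"
    unfolding distinct_triples_def by auto
  then show ?thesis using assms by (simp add: sum.Sigma)
qed

lemma finite_distinct_triples: "finite S \<Longrightarrow> finite (distinct_triples S)"
  unfolding distinct_triples_def by (rule finite_subset[of _ "S \<times> S \<times> S"]) auto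

text \<open>Exchanging the parent color a and the child color b is not a single recoloring. It is
  routed through a third parent color c: one change of the child from a to b under parent c, and two
  changes of the parent above a fixed child. Summing over c gives the factor
  \<open>card S - 2\<close> on the left.\<close>

lemma swap_increments_direct:
  fixes \<psi> :: "'b \<Rightarrow> 'b \<Rightarrow> real"
  assumes S: "finite S" and s: "card S \<ge> 2" and \<eta>: "\<eta> > 0"
  shows "(real (card S) - 2) * (\<Sum>a\<in>S. \<Sum>b\<in>S - {a}. (\<psi> a b - \<psi> b a)\<^sup>2)
    \<le> (1 + \<eta>) * (\<Sum>c\<in>S. \<Sum>x\<in>S - {c}. \<Sum>y\<in>S - {c, x}. (\<psi> c x - \<psi> c y)\<^sup>2)
      + 4 * (1 + 1 / \<eta>) * (\<Sum>a\<in>S. \<Sum>b\<in>S - {a}. \<Sum>x\<in>S - {a, b}. (\<psi> a x - \<psi> b x)\<^sup>2)"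
proof -
  let ?T = "distinct_triples S"
  have T: "finite ?T" using S by (rule finite_distinct_triples)
  have "(real (card S) - 2) * (\<Sum>a\<in>S. \<Sum>b\<in>S - {a}. (\<psi> a b - \<psi> b a)\<^sup>2)
      = (\<Sum>(a, b, c)\<in>?T. (\<psi> a b - \<psi> b a)\<^sup>2)"
  proof -
    have "card (S - {a, b}) = card S - 2" if "a \<in> S" "b \<in> S - {a}" for a b
    proof -
      have "card {a, b} = 2" using that by (auto simp: card_insert_if)
      moreover have "card (S - {a, b}) = card S - card {a, b}" using that by (intro card_Diff_subset) auto
      ultimately show ?thesis by simp
    qed
    then show ?thesis
      unfolding sum_distinct_triples[OF S] sum_distrib_left using s
      by (intro sum.cong refl) (simp add: of_nat_diff)
  qed
  also have "\<dots> \<le> (\<Sum>(a, b, c)\<in>?T. (1 + \<eta>) * (\<psi> c b - \<psi> c a)\<^sup>2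
        + 2 * (1 + 1 / \<eta>) * ((\<psi> a b - \<psi> c b)\<^sup>2 + (\<psi> b a - \<psi> c a)\<^sup>2))"
  proof (intro sum_mono, clarify)
    fix a b c
    have "(\<psi> a b - \<psi> b a)\<^sup>2 = ((\<psi> c b - \<psi> c a) + ((\<psi> a b - \<psi> c b) - (\<psi> b a - \<psi> c a)))\<^sup>2" by simp
    also note square_sum_split3(1)[OF \<eta>]
    finally show "(\<psi> a b - \<psi> b a)\<^sup>2 \<le> (1 + \<eta>) * (\<psi> c b - \<psi> c a)\<^sup>2
        + 2 * (1 + 1 / \<eta>) * ((\<psi> a b - \<psi> c b)\<^sup>2 + (\<psi> b a - \<psi> c a)\<^sup>2)" .
  qed
  also have "\<dots> = (1 + \<eta>) * (\<Sum>(a, b, c)\<in>?T. (\<psi> c b - \<psi> c a)\<^sup>2)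
        + 2 * (1 + 1 / \<eta>) * ((\<Sum>(a, b, c)\<in>?T. (\<psi> a b - \<psi> c b)\<^sup>2) + (\<Sum>(a, b, c)\<in>?T. (\<psi> b a - \<psi> c a)\<^sup>2))"
    by (simp add: case_prod_beta sum.distrib sum_distrib_left distrib_left)
  also have "(\<Sum>(a, b, c)\<in>?T. (\<psi> c b - \<psi> c a)\<^sup>2) = (\<Sum>(c, x, y)\<in>?T. (\<psi> c x - \<psi> c y)\<^sup>2)"
    by (rule sum.reindex_bij_witness[where i="\<lambda>(c, x, y). (y, x, c)" and j="\<lambda>(a, b, c). (c, b, a)"])
      (auto simp: distinct_triples_def)
  also have "(\<Sum>(a, b, c)\<in>?T. (\<psi> a b - \<psi> c b)\<^sup>2) = (\<Sum>(a, b, x)\<in>?T. (\<psi> a x - \<psi> b x)\<^sup>2)"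
    by (rule sum.reindex_bij_witness[where i="\<lambda>(a, b, x). (a, x, b)" and j="\<lambda>(a, b, c). (a, c, b)"])
      (auto simp: distinct_triples_def)
  also have "(\<Sum>(a, b, c)\<in>?T. (\<psi> b a - \<psi> c a)\<^sup>2) = (\<Sum>(a, b, x)\<in>?T. (\<psi> a x - \<psi> b x)\<^sup>2)"
    by (rule sum.reindex_bij_witness[where i="\<lambda>(a, b, x). (x, a, b)" and j="\<lambda>(a, b, c). (b, c, a)"])
      (auto simp: distinct_triples_def)
  finally show ?thesis unfolding sum_distinct_triples[OF S] by (simp add: algebra_simps)
qed

text \<open>If S has at least four colors, the direct route already has coefficient 1/2. Otherwise S
  consists of three out of four colors and that coefficient is 1, which is not contractive. A second
  route parks the child at the color p outside S. The two routes draw on disjoint parts of the child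
  energy and can be balanced.\<close>

lemma swap_increments_le:
  fixes \<psi> :: "nat \<Rightarrow> nat \<Rightarrow> real"
  assumes Q: "finite Q" and q: "card Q \<ge> 4" and S: "S \<subseteq> Q" and s: "card S + 1 \<ge> card Q" and \<eta>: "\<eta> > 0"
  shows "(\<Sum>a\<in>S. \<Sum>b\<in>S - {a}. (\<psi> a b - \<psi> b a)\<^sup>2)
    \<le> 2 / 3 * (1 + \<eta>) * (\<Sum>a\<in>S. \<Sum>x\<in>Q - {a}. \<Sum>y\<in>Q - {a, x}. (\<psi> a x - \<psi> a y)\<^sup>2)
      + 3 * (1 + 1 / \<eta>) * (\<Sum>a\<in>S. \<Sum>b\<in>S - {a}. \<Sum>x\<in>Q - {a, b}. (\<psi> a x - \<psi> b x)\<^sup>2)"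
    (is "?Z \<le> 2 / 3 * (1 + \<eta>) * ?T + 3 * (1 + 1 / \<eta>) * ?L")
proof -
  have finS: "finite S" using S Q finite_subset by blast
  let ?TS = "\<Sum>c\<in>S. \<Sum>x\<in>S - {c}. \<Sum>y\<in>S - {c, x}. (\<psi> c x - \<psi> c y)\<^sup>2"
  let ?LS = "\<Sum>a\<in>S. \<Sum>b\<in>S - {a}. \<Sum>x\<in>S - {a, b}. (\<psi> a x - \<psi> b x)\<^sup>2"
  have L: "?LS \<le> ?L" using S Q by (intro sum_mono sum_mono2) auto
  have L0: "0 \<le> ?L" by (intro sum_nonneg) auto
  have T: "?TS \<le> ?T"
  proof (intro sum_mono)
    fix c assume "c \<in> S"
    have "(\<Sum>x\<in>S - {c}. \<Sum>y\<in>S - {c, x}. (\<psi> c x - \<psi> c y)\<^sup>2) \<le> (\<Sum>x\<in>S - {c}. \<Sum>y\<in>Q - {c, x}. (\<psi> c x - \<psi> c y)\<^sup>2)"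
      using S Q by (intro sum_mono sum_mono2) auto
    also have "\<dots> \<le> (\<Sum>x\<in>Q - {c}. \<Sum>y\<in>Q - {c, x}. (\<psi> c x - \<psi> c y)\<^sup>2)"
      using S Q by (intro sum_mono2) (auto intro: sum_nonneg)
    finally show "(\<Sum>x\<in>S - {c}. \<Sum>y\<in>S - {c, x}. (\<psi> c x - \<psi> c y)\<^sup>2)
        \<le> (\<Sum>x\<in>Q - {c}. \<Sum>y\<in>Q - {c, x}. (\<psi> c x - \<psi> c y)\<^sup>2)" .
  qed
  have T0: "0 \<le> ?T" by (intro sum_nonneg) auto
  have dir: "(real (card S) - 2) * ?Z \<le> (1 + \<eta>) * ?TS + 4 * (1 + 1 / \<eta>) * ?L"
  proof -
    have "4 * (1 + 1 / \<eta>) * ?LS \<le> 4 * (1 + 1 / \<eta>) * ?L" using L \<eta> by (intro mult_left_mono) auto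
    then show ?thesis using swap_increments_direct[OF finS _ \<eta>, of \<psi>] s q by linarith
  qed
  have Z0: "0 \<le> ?Z" by (intro sum_nonneg) auto
  show ?thesis
  proof (cases "card S \<ge> 4")
    case True
    have "2 * ?Z \<le> (real (card S) - 2) * ?Z" using True Z0 by (intro mult_right_mono) auto
    also note dir
    also have "(1 + \<eta>) * ?TS \<le> (1 + \<eta>) * ?T" using T \<eta> by (intro mult_left_mono) auto
    finally have "2 * ?Z \<le> (1 + \<eta>) * ?T + 4 * ((1 + 1 / \<eta>) * ?L)" by (simp only: mult.assoc)
    then have "?Z \<le> 1 / 2 * ((1 + \<eta>) * ?T) + 2 * ((1 + 1 / \<eta>) * ?L)" by linarith
    also have "\<dots> \<le> 2 / 3 * ((1 + \<eta>) * ?T) + 3 * ((1 + 1 / \<eta>) * ?L)"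
      using T0 L0 \<eta> by (intro add_mono mult_right_mono mult_nonneg_nonneg) auto
    finally show ?thesis by (simp only: mult.assoc)
  next
    case False
    then have c: "card S = 3" "card Q = 4" using s q by auto
    have "card (Q - S) = 1" using c S finS by (simp add: card_Diff_subset)
    then obtain p where p: "Q - S = {p}" by (rule card_1_singletonE)
    have pS: "p \<notin> S" "p \<in> Q" using p by auto
    let ?U = "\<Sum>a\<in>S. \<Sum>b\<in>S - {a}. (\<psi> a b - \<psi> a p)\<^sup>2"
    have "?Z \<le> (\<Sum>a\<in>S. \<Sum>b\<in>S - {a}. 2 * (1 + \<eta>) * ((\<psi> a b - \<psi> a p)\<^sup>2 + (\<psi> b a - \<psi> b p)\<^sup>2)
        + (1 + 1 / \<eta>) * (\<psi> a p - \<psi> b p)\<^sup>2)"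
    proof (intro sum_mono)
      fix a b
      have "(\<psi> a b - \<psi> b a)\<^sup>2 = (((\<psi> a b - \<psi> a p) - (\<psi> b a - \<psi> b p)) + (\<psi> a p - \<psi> b p))\<^sup>2" by simp
      also note square_sum_split3(2)[OF \<eta>]
    finally show "(\<psi> a b - \<psi> b a)\<^sup>2 \<le> 2 * (1 + \<eta>) * ((\<psi> a b - \<psi> a p)\<^sup>2 + (\<psi> b a - \<psi> b p)\<^sup>2)
          + (1 + 1 / \<eta>) * (\<psi> a p - \<psi> b p)\<^sup>2" .
    qed
    also have "\<dots> = 2 * (1 + \<eta>) * (?U + (\<Sum>a\<in>S. \<Sum>b\<in>S - {a}. (\<psi> b a - \<psi> b p)\<^sup>2))
        + (1 + 1 / \<eta>) * (\<Sum>a\<in>S. \<Sum>b\<in>S - {a}. (\<psi> a p - \<psi> b p)\<^sup>2)"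
      by (simp only: sum.distrib sum_distrib_left[symmetric])
    also have "(\<Sum>a\<in>S. \<Sum>b\<in>S - {a}. (\<psi> b a - \<psi> b p)\<^sup>2) = ?U" by (rule sum_swap_distinct[OF finS])
    also have "(\<Sum>a\<in>S. \<Sum>b\<in>S - {a}. (\<psi> a p - \<psi> b p)\<^sup>2) \<le> ?L"
    proof (intro sum_mono)
      fix a b assume "a \<in> S" "b \<in> S - {a}"
      then show "(\<psi> a p - \<psi> b p)\<^sup>2 \<le> (\<Sum>x\<in>Q - {a, b}. (\<psi> a x - \<psi> b x)\<^sup>2)"
        using pS Q by (intro member_le_sum) auto
    qed
    finally have "?Z \<le> 2 * (1 + \<eta>) * (?U + ?U) + (1 + 1 / \<eta>) * ?L"
      using \<eta> by (simp add: mult_left_mono)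
    also have "2 * (1 + \<eta>) * (?U + ?U) = 4 * ((1 + \<eta>) * ?U)" by (simp add: algebra_simps)
    finally have ind: "?Z \<le> 4 * ((1 + \<eta>) * ?U) + (1 + 1 / \<eta>) * ?L" .
    \<comment> \<open>Child moves stay inside S or involve p; the latter occur in both directions,
      hence the factor 2.\<close>
    have TU: "?TS + 2 * ?U \<le> ?T"
    proof -
      have "(\<Sum>x\<in>S - {a}. \<Sum>y\<in>S - {a, x}. (\<psi> a x - \<psi> a y)\<^sup>2) + 2 * (\<Sum>b\<in>S - {a}. (\<psi> a b - \<psi> a p)\<^sup>2)
          = (\<Sum>x\<in>Q - {a}. \<Sum>y\<in>Q - {a, x}. (\<psi> a x - \<psi> a y)\<^sup>2)" if a: "a \<in> S" for a
      proof -
        have Qa: "Q - {a} = insert p (S - {a})" using p a S by auto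
        have y: "(\<Sum>y\<in>Q - {a, x}. (\<psi> a x - \<psi> a y)\<^sup>2) = (\<psi> a x - \<psi> a p)\<^sup>2 + (\<Sum>y\<in>S - {a, x}. (\<psi> a x - \<psi> a y)\<^sup>2)"
          if "x \<in> S - {a}" for x
        proof -
          have "Q - {a, x} = insert p (S - {a, x})" using p a S that by auto
          then show ?thesis using finS pS by simp
        qed
        have "Q - {a, p} = S - {a}" using p a S by auto
        then have "(\<Sum>x\<in>Q - {a}. \<Sum>y\<in>Q - {a, x}. (\<psi> a x - \<psi> a y)\<^sup>2)
            = (\<Sum>y\<in>S - {a}. (\<psi> a p - \<psi> a y)\<^sup>2) + (\<Sum>x\<in>S - {a}. \<Sum>y\<in>Q - {a, x}. (\<psi> a x - \<psi> a y)\<^sup>2)"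
          unfolding Qa using finS pS by simp
        also have "(\<Sum>x\<in>S - {a}. \<Sum>y\<in>Q - {a, x}. (\<psi> a x - \<psi> a y)\<^sup>2)
            = (\<Sum>x\<in>S - {a}. (\<psi> a x - \<psi> a p)\<^sup>2) + (\<Sum>x\<in>S - {a}. \<Sum>y\<in>S - {a, x}. (\<psi> a x - \<psi> a y)\<^sup>2)"
          by (simp add: y sum.distrib)
        finally show ?thesis by (simp add: power2_commute[of "\<psi> a p"])
      qed
      then show ?thesis by (simp add: sum_distrib_left flip: sum.distrib)
    qed
    \<comment> \<open>The weights 2/3 and 1/3 give \<open>?TS\<close> and \<open>2 * ?U\<close> the
      common coefficient 2/3, and \<open>?L\<close> the coefficient 8/3 + 1/3 = 3.\<close>
    have "?Z \<le> 2 / 3 * ((1 + \<eta>) * ?TS + 4 * (1 + 1 / \<eta>) * ?L) + 1 / 3 * (4 * ((1 + \<eta>) * ?U) + (1 + 1 / \<eta>) * ?L)"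
    proof -
      have d: "?Z \<le> (1 + \<eta>) * ?TS + 4 * (1 + 1 / \<eta>) * ?L" using dir c by simp
      have "z \<le> 2 / 3 * x + 1 / 3 * y" if "z \<le> x" "z \<le> y" for x y z :: real using that by linarith
      from this[OF d ind] show ?thesis .
    qed
    also have "\<dots> = 2 / 3 * ((1 + \<eta>) * (?TS + 2 * ?U)) + 3 * ((1 + 1 / \<eta>) * ?L)" by (simp add: algebra_simps)
    also have "\<dots> \<le> 2 / 3 * ((1 + \<eta>) * ?T) + 3 * ((1 + 1 / \<eta>) * ?L)"
      using TU \<eta> by (intro add_mono mult_left_mono) auto
    finally show ?thesis by (simp only: mult.assoc)
  qed
qed

text \<open>The linear identities behind \<open>mean_increments_le\<close> do not pass through a
  square root. Instead the two averages are coupled: a child color other than a and b is matched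
  with itself, and b under parent a with a under parent b. Jensen for square roots leaves only the
  latter pair, which \<open>swap_increments_le\<close> handles. The constant is 4 + 3/\<eta> = 1 + 3
  (1 + 1/\<eta>).\<close>

lemma sqrt_mean_increments_le:
  fixes \<phi> :: "nat \<Rightarrow> ('b \<Rightarrow> nat) \<Rightarrow> real" and g :: "nat \<Rightarrow> real"
  assumes D: "finite D" "card D \<le> 1" and Q: "finite Q" and q: "card Q \<ge> 4"
    and S: "S \<subseteq> Q" and s: "card S + 1 \<ge> card Q" and \<eta>: "\<eta> > 0"
    and W: "\<And>a. a \<in> Q \<Longrightarrow> card (injs D (Q - {a})) = W"
    and nonneg: "\<And>a R. 0 \<le> \<phi> a R"
    and g: "\<And>a. g a = (\<Sum>R\<in>injs D (Q - {a}). \<phi> a R) / W"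
  shows "W * (\<Sum>a\<in>S. \<Sum>b\<in>S. (sqrt (g a) - sqrt (g b))\<^sup>2)
     \<le> 2 / 3 * (1 + \<eta>) * (\<Sum>a\<in>S. row_energy D (Q - {a}) (\<lambda>R. sqrt (\<phi> a R)))
       + (4 + 3 / \<eta>)
          * (\<Sum>a\<in>S. \<Sum>b\<in>S - {a}. \<Sum>R\<in>injs D (Q - {a} - {b}). (sqrt (\<phi> a R) - sqrt (\<phi> b R))\<^sup>2)"
proof -
  have finS: "finite S" using S Q finite_subset by blast
  have diag: "(\<Sum>a\<in>S. \<Sum>b\<in>S. (sqrt (g a) - sqrt (g b))\<^sup>2) = (\<Sum>a\<in>S. \<Sum>b\<in>S - {a}. (sqrt (g a) - sqrt (g b))\<^sup>2)"
    by (rule sum.cong[OF refl], subst sum.remove[OF finS]) auto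
  show ?thesis
  proof (cases "D = {}")
    \<comment> \<open>Without children there is exactly one row, the everywhere undefined function,
      and \<open>g\<close> coincides with \<open>\<phi>\<close>.\<close>
    case True
    let ?e = "\<lambda>_::'b. undefined :: nat"
    have I: "injs D N = {?e}" for N unfolding True injs_def by simp
    obtain a0 where "a0 \<in> Q" using q by fastforce
    then have W1: "W = 1" using W[of a0] I by simp
    have ga: "g a = \<phi> a ?e" for a unfolding g I W1 by simp
    let ?L = "\<Sum>a\<in>S. \<Sum>b\<in>S - {a}. (sqrt (\<phi> a ?e) - sqrt (\<phi> b ?e))\<^sup>2"
    have "0 \<le> ?L" by (intro sum_nonneg) auto
    then have "?L * 1 \<le> ?L * (4 + 3 / \<eta>)" using \<eta> by (intro mult_left_mono) auto
    then have "(\<Sum>a\<in>S. \<Sum>b\<in>S. (sqrt (g a) - sqrt (g b))\<^sup>2) \<le> ?L * (4 + 3 / \<eta>)"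
      unfolding diag[unfolded ga] ga by simp
    then show ?thesis unfolding W1 I ga row_energy_def by (simp add: True mult.commute)
  next
    case False
    then have "card D = 1" using D card_gt_0_iff[of D] by linarith
    then obtain u where u: "D = {u}" by (rule card_1_singletonE)
    define r where "r x = (\<lambda>i\<in>{u}. x)" for x :: nat
    have I: "injs D N = r ` N" for N
    proof -
      have "R \<in> r ` N" if "R \<in> {u} \<rightarrow>\<^sub>E N" for R
      proof (rule image_eqI)
        show "R = r (R u)" using that by (auto simp: r_def fun_eq_iff PiE_def extensional_def)
      qed (use that in auto)
      then show ?thesis unfolding u injs_def by (auto simp: r_def split: if_splits)
    qed
    have inj_r: "inj_on r N" for N
    proof (rule inj_onI)
      fix x y assume "r x = r y"
      then have "r x u = r y u" by simp
      then show "x = y" by (simp add: r_def)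
    qed
    have sumI: "(\<Sum>R\<in>injs D N. h R) = (\<Sum>x\<in>N. h (r x))" for N and h :: "_ \<Rightarrow> real"
      unfolding I by (simp add: sum.reindex[OF inj_r])
    have W': "real (card (Q - {a})) = W" if "a \<in> Q" for a
      using W[OF that] unfolding I by (simp add: card_image[OF inj_r])
    obtain a0 where a0: "a0 \<in> Q" using q by fastforce
    have W0: "real W > 0" using W'[OF a0] a0 Q q by auto
    define \<psi> where "\<psi> a x = sqrt (\<phi> a (r x))" for a x
    have E: "row_energy D (Q - {a}) (\<lambda>R. sqrt (\<phi> a R)) = (\<Sum>x\<in>Q - {a}. \<Sum>y\<in>Q - {a, x}. (\<psi> a x - \<psi> a y)\<^sup>2)" for a
    proof -
      have "(r x)(u := y) = r y" "r x ` {u} = {x}" for x y by (auto simp: r_def)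
      moreover have "Q - {a} - {x} = Q - {a, x}" for x by auto
      ultimately show ?thesis unfolding row_energy_def sumI by (simp add: u \<psi>_def)
    qed
    let ?Z = "\<Sum>a\<in>S. \<Sum>b\<in>S - {a}. (\<psi> a b - \<psi> b a)\<^sup>2"
    let ?T = "\<Sum>a\<in>S. \<Sum>x\<in>Q - {a}. \<Sum>y\<in>Q - {a, x}. (\<psi> a x - \<psi> a y)\<^sup>2"
    let ?L = "\<Sum>a\<in>S. \<Sum>b\<in>S - {a}. \<Sum>x\<in>Q - {a, b}. (\<psi> a x - \<psi> b x)\<^sup>2"
    have pair: "W * (sqrt (g a) - sqrt (g b))\<^sup>2 \<le> (\<Sum>x\<in>Q - {a, b}. (\<psi> a x - \<psi> b x)\<^sup>2) + (\<psi> a b - \<psi> b a)\<^sup>2"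
      if ab: "a \<in> S" "b \<in> S - {a}" for a b
    proof -
      have abQ: "a \<in> Q" "b \<in> Q" "a \<noteq> b" using ab S by auto
      \<comment> \<open>The mean for parent b is reindexed by the child colors available under
        parent a: the index b, impossible under parent b, stands for a.\<close>
      define y where "y x = \<phi> b (r (if x = b then a else x))" for x
      have gb: "g b = (\<Sum>x\<in>Q - {a}. y x) / card (Q - {a})"
      proof -
        have "(\<Sum>x\<in>Q - {b}. \<phi> b (r x)) = (\<Sum>x\<in>Q - {a}. y x)"
          by (rule sum.reindex_bij_witness[where i="\<lambda>x. if x = b then a else x" and j="\<lambda>x. if x = a then b else x"])
            (use abQ in \<open>auto simp: y_def\<close>)
        then show ?thesis unfolding g sumI W'[OF abQ(1)] by simp
      qed
      have ga: "g a = (\<Sum>x\<in>Q - {a}. \<phi> a (r x)) / card (Q - {a})"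
        unfolding g sumI W'[OF abQ(1)] by simp
      have "(sqrt (g a) - sqrt (g b))\<^sup>2 \<le> (\<Sum>x\<in>Q - {a}. (sqrt (\<phi> a (r x)) - sqrt (y x))\<^sup>2) / card (Q - {a})"
        unfolding ga gb by (rule jensen_square_diff) (use Q abQ nonneg in \<open>auto simp: y_def\<close>)
      then have "W * (sqrt (g a) - sqrt (g b))\<^sup>2 \<le> (\<Sum>x\<in>Q - {a}. (sqrt (\<phi> a (r x)) - sqrt (y x))\<^sup>2)"
        using W0 W'[OF abQ(1)] by (simp add: pos_le_divide_eq mult.commute)
      also have "\<dots> = (sqrt (\<phi> a (r b)) - sqrt (y b))\<^sup>2 + (\<Sum>x\<in>Q - {a} - {b}. (sqrt (\<phi> a (r x)) - sqrt (y x))\<^sup>2)"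
        using Q abQ by (intro sum.remove) auto
      also have "Q - {a} - {b} = Q - {a, b}" by auto
      also have "(\<Sum>x\<in>Q - {a, b}. (sqrt (\<phi> a (r x)) - sqrt (y x))\<^sup>2) = (\<Sum>x\<in>Q - {a, b}. (\<psi> a x - \<psi> b x)\<^sup>2)"
        by (intro sum.cong) (auto simp: y_def \<psi>_def)
      finally show ?thesis by (simp add: y_def \<psi>_def)
    qed
    have "W * (\<Sum>a\<in>S. \<Sum>b\<in>S. (sqrt (g a) - sqrt (g b))\<^sup>2) \<le> ?L + ?Z"
      unfolding diag sum_distrib_left sum.distrib[symmetric] by (intro sum_mono pair)
    also have "\<dots> \<le> ?L + (2 / 3 * (1 + \<eta>) * ?T + 3 * (1 + 1 / \<eta>) * ?L)"
      by (intro add_left_mono swap_increments_le Q q S s \<eta>)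
    also have "\<dots> = 2 / 3 * (1 + \<eta>) * ?T + (4 + 3 / \<eta>) * ?L" by (simp add: algebra_simps)
    also have "?L = (\<Sum>a\<in>S. \<Sum>b\<in>S - {a}. \<Sum>R\<in>injs D (Q - {a} - {b}). (sqrt (\<phi> a R) - sqrt (\<phi> b R))\<^sup>2)"
      unfolding sumI \<psi>_def by (intro sum.cong) auto
    finally show ?thesis unfolding E .
  qed
qed

section \<open>Conditional averages of colorings\<close>

lemma transpose_mem_iff: "a \<in> A \<Longrightarrow> b \<in> A \<Longrightarrow> Transposition.transpose a b x \<in> A \<longleftrightarrow> x \<in> A"
  by (auto simp: Transposition.transpose_def)

text \<open>The sites in \<open>W\<close> will be the edges of the tree with their adjacency, so
  site colorings here are edge colorings there.\<close>

locale col_graph =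
  fixes W :: "'i set" and adj :: "'i \<Rightarrow> 'i \<Rightarrow> bool" and q :: nat
  assumes finite_W: "finite W" and adj_sym: "adj u v \<Longrightarrow> adj v u" and adj_irrefl: "\<not> adj u u"
begin

definition Om :: "('i \<Rightarrow> nat) set" where
  "Om = {X \<in> W \<rightarrow>\<^sub>E {1..q}. \<forall>u\<in>W. \<forall>v\<in>W. adj u v \<longrightarrow> X u \<noteq> X v}"

text \<open>Only the values of \<open>X\<close> off \<open>A\<close> matter in \<open>fiber A X\<close> and \<open>cex A F X\<close>, so \<open>X\<close> need not be
  proper on \<open>A\<close>.\<close>

definition fiber :: "'i set \<Rightarrow> ('i \<Rightarrow> nat) \<Rightarrow> ('i \<Rightarrow> nat) set" where
  "fiber A X = {Y \<in> Om. \<forall>w\<in>W - A. Y w = X w}"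

definition cex :: "'i set \<Rightarrow> (('i \<Rightarrow> nat) \<Rightarrow> real) \<Rightarrow> ('i \<Rightarrow> nat) \<Rightarrow> real" where
  "cex A F X = (\<Sum>Y\<in>fiber A X. F Y) / card (fiber A X)"

text \<open>This is the right condition on assignments such as \<open>set_row\<close>, whose values
  on \<open>A\<close> are leftovers of another coloring.\<close>

definition proper_off :: "'i set \<Rightarrow> ('i \<Rightarrow> nat) \<Rightarrow> bool" where
  "proper_off A X \<longleftrightarrow> (\<forall>w\<in>W - A. X w \<in> {1..q}) \<and> (\<forall>u\<in>W - A. \<forall>w\<in>W - A. adj u w \<longrightarrow> X u \<noteq> X w)"

definition nonadj :: "'i set \<Rightarrow> 'i set \<Rightarrow> bool" where
  "nonadj A B \<longleftrightarrow> (\<forall>a\<in>A. \<forall>b\<in>B. \<not> adj a b)"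

text \<open>For \<open>U = {u}\<close> this is plain recoloring. If U consists of u and everything
  below it, the two colors are exchanged in the whole subtree, which therefore stays proper inside;
  only neighbors of u outside can forbid the move.\<close>

definition move :: "'i set \<Rightarrow> 'i \<Rightarrow> nat \<Rightarrow> ('i \<Rightarrow> nat) \<Rightarrow> 'i \<Rightarrow> nat" where
  "move U u c X = (\<lambda>w. if w \<in> U then Transposition.transpose (X u) c (X w) else X w)"

definition legal :: "'i set \<Rightarrow> 'i \<Rightarrow> ('i \<Rightarrow> nat) \<Rightarrow> nat set" where
  "legal U u X = {c \<in> {1..q}. move U u c X \<in> Om}"

text \<open>An unnormalized Dirichlet form. On a proper coloring the trivial move
  \<open>c = X u\<close> is included and contributes 0.\<close>

definition energy :: "'i set \<Rightarrow> 'i \<Rightarrow> (('i \<Rightarrow> nat) \<Rightarrow> real) \<Rightarrow> real" where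
  "energy U u F = (\<Sum>X\<in>Om. \<Sum>c\<in>legal U u X. (F X - F (move U u c X))\<^sup>2)"

lemma finite_Om: "finite Om"
  unfolding Om_def using finite_W by (simp add: finite_PiE)

lemma Om_mem: "X \<in> Om \<Longrightarrow> w \<in> W \<Longrightarrow> X w \<in> {1..q}"
  unfolding Om_def by auto

lemma Om_neq: "X \<in> Om \<Longrightarrow> u \<in> W \<Longrightarrow> w \<in> W \<Longrightarrow> adj u w \<Longrightarrow> X u \<noteq> X w"
  unfolding Om_def by auto

lemma Om_undef: "X \<in> Om \<Longrightarrow> w \<notin> W \<Longrightarrow> X w = undefined"
  unfolding Om_def by auto

lemma OmI:
  assumes "\<And>w. w \<in> W \<Longrightarrow> X w \<in> {1..q}" "\<And>w. w \<notin> W \<Longrightarrow> X w = undefined"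
    "\<And>u w. u \<in> W \<Longrightarrow> w \<in> W \<Longrightarrow> adj u w \<Longrightarrow> X u \<noteq> X w"
  shows "X \<in> Om"
  using assms unfolding Om_def by (auto simp: PiE_def extensional_def)

lemma Om_eqI:
  assumes "X \<in> Om" "Y \<in> Om" "\<And>w. w \<in> W \<Longrightarrow> X w = Y w"
  shows "X = Y"
  using assms Om_undef by (metis ext)

lemma proper_off_Om: "X \<in> Om \<Longrightarrow> proper_off A X"
  unfolding proper_off_def Om_def by auto

lemma fiber_subset: "fiber A X \<subseteq> Om"
  unfolding fiber_def by auto

lemma finite_fiber: "finite (fiber A X)"
  using fiber_subset finite_Om by (rule finite_subset)

lemma fiber_self: "X \<in> Om \<Longrightarrow> X \<in> fiber A X"
  unfolding fiber_def by auto

lemma fiber_nonempty: "X \<in> Om \<Longrightarrow> fiber A X \<noteq> {}"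
  using fiber_self by auto

lemma card_fiber_pos: "X \<in> Om \<Longrightarrow> 0 < card (fiber A X)"
  using fiber_nonempty finite_fiber by (simp add: card_gt_0_iff)

lemma fiber_cong: "(\<And>w. w \<in> W - A \<Longrightarrow> X w = Y w) \<Longrightarrow> fiber A X = fiber A Y"
  unfolding fiber_def by auto

lemma cex_cong: "(\<And>w. w \<in> W - A \<Longrightarrow> X w = Y w) \<Longrightarrow> cex A F X = cex A F Y"
  unfolding cex_def using fiber_cong[of A X Y] by simp

lemma fiber_agree: "Y \<in> fiber A X \<Longrightarrow> w \<in> W - A \<Longrightarrow> Y w = X w"
  unfolding fiber_def by auto

lemma fiber_eq: "Y \<in> fiber A X \<Longrightarrow> fiber A Y = fiber A X"
  by (rule fiber_cong) (rule fiber_agree)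

lemma fiber_sym: "X \<in> Om \<Longrightarrow> Y \<in> fiber A X \<Longrightarrow> X \<in> fiber A Y"
  unfolding fiber_def by auto

lemma cex_eq: "Y \<in> fiber A X \<Longrightarrow> cex A F Y = cex A F X"
  by (rule cex_cong) (rule fiber_agree)

lemma fiber_mono: "A \<subseteq> B \<Longrightarrow> Y \<in> fiber B X \<Longrightarrow> fiber A Y \<subseteq> fiber B X"
  unfolding fiber_def by (clarsimp simp: subset_eq) (metis DiffI)

lemma fiber_all: "fiber W X = Om"
  unfolding fiber_def by auto

text \<open>The fibers partition \<open>T\<close>, and averaging over the parts keeps the total. A
  general \<open>T\<close> is allowed because the tower property \<open>cex_cex\<close> takes a
  larger fiber for it.\<close>

lemma sum_cex:
  assumes T: "T \<subseteq> Om" "\<And>Y. Y \<in> T \<Longrightarrow> fiber A Y \<subseteq> T"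
  shows "(\<Sum>Y\<in>T. cex A F Y) = (\<Sum>Y\<in>T. F Y)"
proof -
  have finT: "finite T" using T(1) finite_Om finite_subset by blast
  have "(\<Sum>Y\<in>T. cex A F Y) = (\<Sum>Y\<in>T. \<Sum>Z\<in>{Z\<in>T. Z \<in> fiber A Y}. F Z / card (fiber A Y))"
  proof (intro sum.cong refl)
    fix Y assume "Y \<in> T"
    then have "{Z\<in>T. Z \<in> fiber A Y} = fiber A Y" using T by auto
    then show "cex A F Y = (\<Sum>Z\<in>{Z\<in>T. Z \<in> fiber A Y}. F Z / card (fiber A Y))"
      by (simp add: cex_def sum_divide_distrib)
  qed
  also have "\<dots> = (\<Sum>Z\<in>T. \<Sum>Y\<in>{Y\<in>T. Z \<in> fiber A Y}. F Z / card (fiber A Y))"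
    by (rule sum.swap_restrict[OF finT finT])
  also have "\<dots> = (\<Sum>Z\<in>T. F Z)"
  proof (intro sum.cong refl)
    fix Z assume Z: "Z \<in> T"
    have "{Y\<in>T. Z \<in> fiber A Y} = fiber A Z" using T Z fiber_sym by (auto dest: subsetD[OF T(1)] fiber_sym)
    moreover have "(\<Sum>Y\<in>fiber A Z. F Z / card (fiber A Y)) = (\<Sum>Y\<in>fiber A Z. F Z / card (fiber A Z))"
      by (intro sum.cong refl) (simp add: fiber_eq)
    ultimately show "(\<Sum>Y\<in>{Y\<in>T. Z \<in> fiber A Y}. F Z / card (fiber A Y)) = F Z"
      using card_fiber_pos[of Z A] Z T(1) by auto
  qed
  finally show ?thesis .
qed

lemma sum_cex_Om: "(\<Sum>X\<in>Om. cex A F X) = (\<Sum>X\<in>Om. F X)"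
  using fiber_subset by (intro sum_cex) auto

lemma cex_cex: "A \<subseteq> B \<Longrightarrow> cex B (cex A F) X = cex B F X"
  unfolding cex_def[of B] by (subst sum_cex[OF fiber_subset]) (auto dest: fiber_mono)

lemma cex_mono:
  assumes "\<And>Y. Y \<in> fiber A X \<Longrightarrow> F Y \<le> G Y"
  shows "cex A F X \<le> cex A G X"
  unfolding cex_def using assms by (intro divide_right_mono sum_mono) auto

lemma cex_cong_fun:
  assumes "\<And>Y. Y \<in> fiber A X \<Longrightarrow> F Y = G Y"
  shows "cex A F X = cex A G X"
  unfolding cex_def using assms by (simp cong: sum.cong)

lemma cex_nonneg:
  assumes "\<And>Y. Y \<in> fiber A X \<Longrightarrow> 0 \<le> F Y"
  shows "0 \<le> cex A F X"
  unfolding cex_def using assms by (intro divide_nonneg_nonneg sum_nonneg) auto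

lemma cex_pos:
  assumes "X \<in> Om" "\<And>Y. Y \<in> Om \<Longrightarrow> 0 < F Y"
  shows "0 < cex A F X"
  unfolding cex_def using assms card_fiber_pos[of X A] fiber_nonempty[of X A]
  by (intro divide_pos_pos sum_pos finite_fiber) (auto dest: subsetD[OF fiber_subset])

lemma cex_mult:
  assumes "\<And>Y. Y \<in> fiber A X \<Longrightarrow> G Y = G X"
  shows "cex A (\<lambda>Y. F Y * G Y) X = cex A F X * G X"
  unfolding cex_def using assms by (simp add: sum_distrib_right cong: sum.cong)

lemma sum_mult_cex:
  assumes "\<And>X Y. X \<in> Om \<Longrightarrow> Y \<in> fiber A X \<Longrightarrow> G Y = G X"
  shows "(\<Sum>X\<in>Om. cex A F X * G X) = (\<Sum>X\<in>Om. F X * G X)"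
proof -
  have "(\<Sum>X\<in>Om. cex A F X * G X) = (\<Sum>X\<in>Om. cex A (\<lambda>Y. F Y * G Y) X)"
    using assms by (intro sum.cong refl cex_mult[symmetric]) auto
  then show ?thesis by (simp add: sum_cex_Om)
qed

lemma sum_le_fiberwise:
  fixes F G :: "('i \<Rightarrow> nat) \<Rightarrow> real"
  assumes "\<And>X. X \<in> Om \<Longrightarrow> (\<Sum>Y\<in>fiber A X. F Y) \<le> (\<Sum>Y\<in>fiber A X. G Y)"
  shows "(\<Sum>X\<in>Om. F X) \<le> (\<Sum>X\<in>Om. G X)"
proof -
  have "(\<Sum>X\<in>Om. cex A F X) \<le> (\<Sum>X\<in>Om. cex A G X)"
    unfolding cex_def by (rule sum_mono, rule divide_right_mono) (simp_all add: assms)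
  then show ?thesis by (simp add: sum_cex_Om)
qed

text \<open>Pythagoras for the orthogonal projection \<open>cex A\<close>.\<close>

lemma sum_square_dev_cex:
  "(\<Sum>X\<in>Om. (F X - cex A F X)\<^sup>2) = (\<Sum>X\<in>Om. (F X)\<^sup>2) - (\<Sum>X\<in>Om. (cex A F X)\<^sup>2)"
proof -
  have "(\<Sum>X\<in>Om. cex A F X * cex A F X) = (\<Sum>X\<in>Om. F X * cex A F X)"
    by (rule sum_mult_cex) (rule cex_eq)
  moreover have "(F X - cex A F X)\<^sup>2 = F X * F X + cex A F X * cex A F X - 2 * (F X * cex A F X)" for X
    by (simp add: power2_eq_square algebra_simps)
  ultimately show ?thesis
    by (simp add: power2_eq_square sum.distrib sum_subtractf flip: sum_distrib_left)
qed

lemma cex_square_le: "X \<in> Om \<Longrightarrow> (cex A F X)\<^sup>2 \<le> cex A (\<lambda>Y. (F Y)\<^sup>2) X"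
  unfolding cex_def by (rule jensen_square_mean[OF finite_fiber fiber_nonempty])

lemma sum_square_cex_le: "(\<Sum>X\<in>Om. (cex A F X)\<^sup>2) \<le> (\<Sum>X\<in>Om. (F X)\<^sup>2)"
proof -
  have "(\<Sum>X\<in>Om. (cex A F X)\<^sup>2) \<le> (\<Sum>X\<in>Om. cex A (\<lambda>Y. (F Y)\<^sup>2) X)"
    by (intro sum_mono cex_square_le)
  then show ?thesis by (simp add: sum_cex_Om)
qed

lemma cex_diff: "cex A (\<lambda>Y. F Y - G Y) X = cex A F X - cex A G X"
  unfolding cex_def by (simp add: sum_subtractf diff_divide_distrib)

section \<open>Counting extensions; independence of nonadjacent parts\<close>

lemma sum_uniform_fibers:
  fixes h :: "'z \<Rightarrow> real"
  assumes "finite T" "finite Z" "p ` T \<subseteq> Z" "\<And>z. z \<in> Z \<Longrightarrow> card {Y\<in>T. p Y = z} = K"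
    and "\<And>Y. Y \<in> T \<Longrightarrow> H Y = h (p Y)"
  shows "(\<Sum>Y\<in>T. H Y) = K * (\<Sum>z\<in>Z. h z)"
proof -
  have "(\<Sum>Y\<in>T. H Y) = (\<Sum>z\<in>Z. \<Sum>Y\<in>{Y\<in>T. p Y = z}. H Y)"
    by (rule sum.group[symmetric]) fact+
  also have "\<dots> = (\<Sum>z\<in>Z. \<Sum>Y\<in>{Y\<in>T. p Y = z}. h z)"
    using assms(5) by (intro sum.cong) auto
  finally show ?thesis using assms(4) by (simp add: sum_distrib_left)
qed

text \<open>Colorings of \<open>C\<close> extending \<open>X\<close> are mapped to those extending \<open>X'\<close> by permuting colors.\<close>

lemma card_fiber_le:
  assumes C: "C \<subseteq> W" and X': "proper_off C X'"
    and \<pi>: "\<And>w. w \<in> C \<Longrightarrow> inj (\<pi> w)" "\<And>w x. w \<in> C \<Longrightarrow> x \<in> {1..q} \<Longrightarrow> \<pi> w x \<in> {1..q}"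
    and \<pi>_adj: "\<And>u w. u \<in> C \<Longrightarrow> w \<in> C \<Longrightarrow> adj u w \<Longrightarrow> \<pi> u = \<pi> w"
    and \<pi>_bd: "\<And>w x. w \<in> C \<Longrightarrow> x \<in> W - C \<Longrightarrow> adj w x \<Longrightarrow> \<pi> w (X x) = X' x"
  shows "card (fiber C X) \<le> card (fiber C X')"
proof (rule card_inj_on_le)
  let ?f = "\<lambda>Y w. if w \<in> C then \<pi> w (Y w) else if w \<in> W then X' w else undefined"
  show "inj_on ?f (fiber C X)"
  proof (rule inj_onI)
    fix Y Z assume Y: "Y \<in> fiber C X" and Z: "Z \<in> fiber C X" and eq: "?f Y = ?f Z"
    show "Y = Z"
    proof (rule Om_eqI)
      fix w assume w: "w \<in> W"
      show "Y w = Z w"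
      proof (cases "w \<in> C")
        case True
        then have "\<pi> w (Y w) = \<pi> w (Z w)" using fun_cong[OF eq, of w] by simp
        then show ?thesis using \<pi>(1)[OF True] by (simp add: inj_eq)
      next
        case False
        then show ?thesis using w fiber_agree[OF Y] fiber_agree[OF Z] by simp
      qed
    qed (use Y Z fiber_subset in auto)
  qed
  show "?f ` fiber C X \<subseteq> fiber C X'"
  proof clarify
    fix Y assume Y: "Y \<in> fiber C X"
    then have YO: "Y \<in> Om" using fiber_subset by auto
    have bd: "?f Y u \<noteq> ?f Y w" if "u \<in> C" "w \<in> W - C" "adj u w" for u w
    proof -
      have "Y u \<noteq> X w" using Om_neq[OF YO, of u w] fiber_agree[OF Y, of w] that C by auto
      then have "\<pi> u (Y u) \<noteq> \<pi> u (X w)" using \<pi>(1)[of u] that by (auto dest: injD)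
      then show ?thesis using that \<pi>_bd[of u w] by auto
    qed
    have "?f Y \<in> Om"
    proof (rule OmI)
      fix w assume "w \<in> W"
      then show "?f Y w \<in> {1..q}"
        using \<pi>(2)[of w "Y w"] Om_mem[OF YO] X' unfolding proper_off_def by auto
    next
      fix w assume "w \<notin> W"
      then show "?f Y w = undefined" using C by auto
    next
      fix u w assume uw: "u \<in> W" "w \<in> W" "adj u w"
      consider "u \<in> C" "w \<in> C" | "u \<in> C" "w \<notin> C" | "u \<notin> C" "w \<in> C" | "u \<notin> C" "w \<notin> C" by blast
      then show "?f Y u \<noteq> ?f Y w"
      proof cases
        case 1
        then show ?thesis using \<pi>_adj[of u w] \<pi>(1)[of w] Om_neq[OF YO uw] uw by (auto dest: injD)
      next
        case 2 then show ?thesis using bd[of u w] uw by auto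
      next
        case 3 then show ?thesis using bd[of w u] uw adj_sym by auto
      next
        case 4 then show ?thesis using X' uw unfolding proper_off_def by auto
      qed
    qed
    then show "?f Y \<in> fiber C X'" unfolding fiber_def by auto
  qed
qed (rule finite_fiber)

lemma card_fiber_nonadj:
  assumes "B \<subseteq> W" "A \<inter> B = {}" "nonadj A B" "X \<in> Om" "Z \<in> fiber A X"
  shows "card (fiber B Z) = card (fiber B X)"
proof -
  have Z: "Z \<in> Om" using subsetD[OF fiber_subset assms(5)] .
  have eq: "X x = Z x" if "w \<in> B" "x \<in> W - B" "adj w x" for w x
  proof -
    have "x \<notin> A" using that assms(3) adj_sym unfolding nonadj_def by blast
    then show ?thesis using that fiber_agree[OF assms(5), of x] by simp
  qed
  have "card (fiber B X) \<le> card (fiber B Z)"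
    by (rule card_fiber_le[where \<pi>="\<lambda>_ x. x"]) (use assms Z eq in \<open>auto simp: proper_off_Om\<close>)
  moreover have "card (fiber B Z) \<le> card (fiber B X)"
    by (rule card_fiber_le[where \<pi>="\<lambda>_ x. x"]) (use assms Z eq[symmetric] in \<open>auto simp: proper_off_Om\<close>)
  ultimately show ?thesis by simp
qed

text \<open>Nonadjacent parts are conditionally independent: resetting \<open>B\<close> to its
  colors in \<open>X\<close> projects the fiber over \<open>A \<union> B\<close> onto the fiber over
  \<open>A\<close>, and all preimages have the same size. Used with \<open>A\<close> and
  \<open>B\<close> exchanged as well, it makes the two averages commute.\<close>

lemma cex_union:
  assumes A: "A \<subseteq> W" and B: "B \<subseteq> W" and AB: "A \<inter> B = {}" "nonadj A B" and X: "X \<in> Om"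
  shows "cex A (cex B F) X = cex (A \<union> B) F X"
proof -
  let ?H = "cex B F"
  define p where "p Y = (\<lambda>w. if w \<in> B then X w else Y w)" for Y
  let ?K = "card (fiber B X)"
  have pY: "p Y \<in> fiber A X" if Y: "Y \<in> fiber (A \<union> B) X" for Y
  proof -
    have YO: "Y \<in> Om" using Y fiber_subset by auto
    have ag: "Y w = X w" if "w \<in> W - (A \<union> B)" for w using fiber_agree[OF Y that] .
    have bd: "X u \<noteq> Y w" if "u \<in> B" "w \<in> W - B" "adj u w" for u w
    proof -
      have "w \<notin> A" using that AB adj_sym unfolding nonadj_def by blast
      then show ?thesis using ag[of w] that Om_neq[OF X, of u w] B by auto
    qed
    have "p Y \<in> Om"
    proof (rule OmI)
      fix u w assume uw: "u \<in> W" "w \<in> W" "adj u w"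
      then show "p Y u \<noteq> p Y w"
        using Om_neq[OF X uw] Om_neq[OF YO uw] bd[of u w] bd[of w u] adj_sym[of u w] unfolding p_def by auto
    qed (use X YO B in \<open>auto simp: p_def Om_undef dest: Om_mem\<close>)
    then show ?thesis unfolding fiber_def using ag by (auto simp: p_def)
  qed
  have Hp: "?H Y = ?H (p Y)" for Y
    by (rule cex_cong) (auto simp: p_def)
  have fib: "{Y \<in> fiber (A \<union> B) X. p Y = Z} = fiber B Z" if Z: "Z \<in> fiber A X" for Z
  proof (intro equalityI subsetI)
    fix Y assume "Y \<in> {Y \<in> fiber (A \<union> B) X. p Y = Z}"
    then show "Y \<in> fiber B Z" unfolding fiber_def p_def by auto
  next
    fix Y assume Y: "Y \<in> fiber B Z"
    have ZO: "Z \<in> Om" using Z fiber_subset by auto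
    have "Y \<in> fiber (A \<union> B) X" using Y Z unfolding fiber_def by auto
    moreover have "p Y = Z"
    proof
      fix w show "p Y w = Z w"
      proof (cases "w \<in> B")
        case True
        then have "w \<in> W - A" using AB B by auto
        then show ?thesis using True fiber_agree[OF Z] by (simp add: p_def)
      next
        case False
        then show ?thesis
          using fiber_agree[OF Y, of w] ZO Y fiber_subset[of B Z] Om_undef[of Y w] Om_undef[of Z w]
          by (cases "w \<in> W") (auto simp: p_def)
      qed
    qed
    ultimately show "Y \<in> {Y \<in> fiber (A \<union> B) X. p Y = Z}" by simp
  qed
  have "(\<Sum>Y\<in>fiber (A \<union> B) X. ?H Y) = ?K * (\<Sum>Z\<in>fiber A X. ?H Z)"
    by (rule sum_uniform_fibers[where p=p])
      (use pY fib Hp card_fiber_nonadj[OF B AB X] in \<open>auto simp: finite_fiber\<close>)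
  moreover have "(\<Sum>Y\<in>fiber (A \<union> B) X. 1) = real ?K * (\<Sum>Z\<in>fiber A X. 1 :: real)"
    by (rule sum_uniform_fibers[where p=p])
      (use pY fib card_fiber_nonadj[OF B AB X] in \<open>auto simp: finite_fiber\<close>)
  ultimately have "cex (A \<union> B) ?H X = cex A ?H X"
    unfolding cex_def[of "A \<union> B"] cex_def[of A] using card_fiber_pos[OF X, of B] by simp
  then show ?thesis using cex_cex[of B "A \<union> B" F X] by simp
qed

section \<open>Recoloring moves and their interplay with averaging\<close>

lemma move_at: "u \<in> U \<Longrightarrow> move U u c X u = c"
  unfolding move_def by simp

lemma move_move: "u \<in> U \<Longrightarrow> move U u (X u) (move U u c X) = X"
  unfolding move_def by (auto simp: fun_eq_iff transpose_commute)

lemma move_single: "X \<in> Om \<Longrightarrow> move {u} u c X = X(u := c)"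
  unfolding move_def by (auto simp: fun_eq_iff)

text \<open>Colors on \<open>A\<close> are irrelevant to a move inside a set \<open>U\<close> that
  has no neighbor in \<open>A\<close>. Hence the move maps fibers over \<open>A\<close> to fibers
  over \<open>A\<close>, it commutes with the average (\<open>cex_move\<close>), and its legality is
  constant on a fiber (\<open>legal_fiber\<close>).\<close>

lemma move_fiber:
  assumes U: "U \<subseteq> W" "u \<in> U" "U \<inter> A = {}" "nonadj U A" and X: "X \<in> Om" and m: "move U u c X \<in> Om"
    and Y: "Y \<in> fiber A X"
  shows "move U u c Y \<in> fiber A (move U u c X)"
proof -
  have YO: "Y \<in> Om" using Y fiber_subset by auto
  have ag: "Y w = X w" if "w \<in> W" "w \<notin> A" for w using fiber_agree[OF Y, of w] that by auto
  have Yu: "Y u = X u" using U ag by auto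
  have U': "w \<in> W" "w \<notin> A" if "w \<in> U" for w using U that by auto
  have mem: "c \<in> {1..q}" using Om_mem[OF m, of u] U by (auto simp: move_at)
  have off: "move U u c Y w = move U u c X w" if "w \<in> W" "w \<notin> A" for w
    using that ag Yu unfolding move_def by auto
  have bd: "move U u c Y w \<noteq> Y x" if "w \<in> U" "x \<in> W" "x \<notin> U" "adj w x" for w x
  proof -
    have "x \<notin> A" using that U unfolding nonadj_def by auto
    then have "Y x = move U u c X x" using that ag unfolding move_def by auto
    then show ?thesis using off[of w] U'[of w] Om_neq[OF m, of w x] that by auto
  qed
  have "move U u c Y \<in> Om"
  proof (rule OmI)
    fix w assume w: "w \<in> W"
    have "Y u \<in> {1..q}" using Om_mem[OF YO, of u] U by auto
    then show "move U u c Y w \<in> {1..q}"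
      using Om_mem[OF YO w] mem transpose_mem_iff[of "Y u" "{1..q}" c "Y w"] unfolding move_def by auto
  next
    fix w assume "w \<notin> W"
    then show "move U u c Y w = undefined" using U Om_undef[OF YO] unfolding move_def by auto
  next
    fix w x assume wx: "w \<in> W" "x \<in> W" "adj w x"
    consider "w \<in> U" "x \<in> U" | "w \<in> U" "x \<notin> U" | "w \<notin> U" "x \<in> U" | "w \<notin> U" "x \<notin> U" by blast
    then show "move U u c Y w \<noteq> move U u c Y x"
    proof cases
      case 1 then show ?thesis using Om_neq[OF YO wx] unfolding move_def by (auto dest: transpose_eq_imp_eq)
    next
      case 2 then show ?thesis using bd[of w x] wx unfolding move_def by auto
    next
      case 3 then show ?thesis using bd[of x w] wx adj_sym unfolding move_def by fastforce
    next
      case 4 then show ?thesis using Om_neq[OF YO wx] unfolding move_def by auto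
    qed
  qed
  then show ?thesis unfolding fiber_def using off by auto
qed

lemma move_fiber_eq:
  assumes U: "U \<subseteq> W" "u \<in> U" "U \<inter> A = {}" "nonadj U A" and X: "X \<in> Om" and m: "move U u c X \<in> Om"
  shows "fiber A (move U u c X) = move U u c ` fiber A X" "inj_on (move U u c) (fiber A X)"
proof -
  let ?X = "move U u c X"
  have uA: "u \<in> W - A" using U by auto
  have inv: "move U u (X u) (move U u c Y) = Y" if "Y \<in> fiber A X" for Y
    using move_move[OF U(2), of Y c] fiber_agree[OF that uA] by simp
  then show "inj_on (move U u c) (fiber A X)" by (metis inj_onI)
  show "fiber A ?X = move U u c ` fiber A X"
  proof (intro equalityI subsetI)
    fix Y assume Y: "Y \<in> fiber A ?X"
    have "move U u (X u) Y \<in> fiber A (move U u (X u) ?X)"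
      by (rule move_fiber[OF U m _ Y]) (simp add: move_move[OF U(2)] X)
    then have 1: "move U u (X u) Y \<in> fiber A X" by (simp add: move_move[OF U(2)])
    have "Y u = c" using fiber_agree[OF Y uA] U by (simp add: move_at)
    then have "move U u c (move U u (X u) Y) = Y" using move_move[OF U(2), of Y "X u"] by simp
    then show "Y \<in> move U u c ` fiber A X" using 1 by (metis image_eqI)
  qed (use move_fiber[OF assms] in auto)
qed

lemma cex_move:
  assumes U: "U \<subseteq> W" "u \<in> U" "U \<inter> A = {}" "nonadj U A" and X: "X \<in> Om" and m: "move U u c X \<in> Om"
  shows "cex A F (move U u c X) = cex A (\<lambda>Y. F (move U u c Y)) X"
  unfolding cex_def move_fiber_eq(1)[OF assms]
  by (simp add: sum.reindex[OF move_fiber_eq(2)[OF assms]] card_image[OF move_fiber_eq(2)[OF assms]])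

lemma legal_fiber:
  assumes U: "U \<subseteq> W" "u \<in> U" "U \<inter> A = {}" "nonadj U A" and X: "X \<in> Om" and Y: "Y \<in> fiber A X"
  shows "legal U u Y = legal U u X"
proof -
  have YO: "Y \<in> Om" using Y fiber_subset by auto
  show ?thesis
    using move_fiber[OF U X _ Y] move_fiber[OF U YO _ fiber_sym[OF X Y]] fiber_subset
    unfolding legal_def by blast
qed

text \<open>Since the move commutes with averaging over \<open>A\<close>, the claim holds pointwise
  by \<open>jensen_square_diff\<close>. It is the tool for replacing partial averages by simpler
  functions inside an energy.\<close>

lemma energy_cex_le:
  assumes U: "U \<subseteq> W" "u \<in> U" "U \<inter> A = {}" "nonadj U A"
    and G: "G = (\<lambda>t. t) \<or> G = sqrt" and nonneg: "\<And>X. 0 \<le> F X"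
  shows "energy U u (\<lambda>X. G (cex A F X)) \<le> energy U u (\<lambda>X. G (F X))"
proof -
  let ?d = "\<lambda>X. \<Sum>c\<in>legal U u X. (G (F X) - G (F (move U u c X)))\<^sup>2"
  have "energy U u (\<lambda>X. G (cex A F X)) \<le> (\<Sum>X\<in>Om. cex A ?d X)"
    unfolding energy_def
  proof (rule sum_mono)
    fix X assume X: "X \<in> Om"
    have "(\<Sum>c\<in>legal U u X. (G (cex A F X) - G (cex A F (move U u c X)))\<^sup>2)
        \<le> (\<Sum>c\<in>legal U u X. cex A (\<lambda>Y. (G (F Y) - G (F (move U u c Y)))\<^sup>2) X)"
    proof (rule sum_mono)
      fix c assume "c \<in> legal U u X"
      then have m: "move U u c X \<in> Om" unfolding legal_def by auto
      show "(G (cex A F X) - G (cex A F (move U u c X)))\<^sup>2 \<le> cex A (\<lambda>Y. (G (F Y) - G (F (move U u c Y)))\<^sup>2) X"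
        unfolding cex_move[OF U X m] unfolding cex_def
        by (rule jensen_square_diff[OF G finite_fiber fiber_nonempty[OF X]]) (auto intro: nonneg)
    qed
    also have "\<dots> = (\<Sum>Y\<in>fiber A X. \<Sum>c\<in>legal U u X. (G (F Y) - G (F (move U u c Y)))\<^sup>2) / card (fiber A X)"
      unfolding cex_def sum_divide_distrib[symmetric] by (subst sum.swap) (rule refl)
    also have "\<dots> = cex A ?d X"
      unfolding cex_def using legal_fiber[OF U X] by (intro arg_cong2[of _ _ _ _ "(/)"] sum.cong refl) auto
    finally show "(\<Sum>c\<in>legal U u X. (G (cex A F X) - G (cex A F (move U u c X)))\<^sup>2) \<le> cex A ?d X" .
  qed
  then show ?thesis unfolding energy_def by (simp add: sum_cex_Om)
qed

lemma energy_nonneg: "0 \<le> energy U u F"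
  unfolding energy_def by (intro sum_nonneg) auto

lemma energy_cong:
  assumes "\<And>X. X \<in> Om \<Longrightarrow> F X = G X"
  shows "energy U u F = energy U u G"
  unfolding energy_def legal_def using assms by (intro sum.cong) auto

lemma legal_single:
  assumes v: "v \<in> W" and Y: "Y \<in> Om"
  shows "legal {v} v Y = {c\<in>{1..q}. \<forall>w\<in>W. adj v w \<longrightarrow> Y w \<noteq> c}"
proof -
  have "Y(v := c) \<in> Om \<longleftrightarrow> (\<forall>w\<in>W. adj v w \<longrightarrow> Y w \<noteq> c)" if c: "c \<in> {1..q}" for c
  proof
    assume *: "Y(v := c) \<in> Om"
    show "\<forall>w\<in>W. adj v w \<longrightarrow> Y w \<noteq> c"
    proof (intro ballI impI)
      fix w assume "w \<in> W" "adj v w"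
      then show "Y w \<noteq> c" using Om_neq[OF * v, of w] adj_irrefl[of v] by (auto split: if_splits)
    qed
  next
    assume *: "\<forall>w\<in>W. adj v w \<longrightarrow> Y w \<noteq> c"
    show "Y(v := c) \<in> Om"
    proof (rule OmI)
      fix u w assume uw: "u \<in> W" "w \<in> W" "adj u w"
      then show "(Y(v := c)) u \<noteq> (Y(v := c)) w"
        using * Om_neq[OF Y uw] adj_sym[OF uw(3)] adj_irrefl by (auto simp: fun_upd_def)
    qed (use v c Om_mem[OF Y] Om_undef[OF Y] in auto)
  qed
  then show ?thesis unfolding legal_def move_single[OF Y] by auto
qed

end

section \<open>Energies on a rooted tree of edges\<close>

text \<open>\<open>r\<close> is a virtual parent of the edges at the root vertex, so that their row
  is treated like any other, except that no color is excluded from above. A real edge has at most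
  \<Delta> - 1 children since it occupies one place at its own lower endpoint.\<close>

locale edge_tree = col_graph W adj q
  for W :: "'i set" and adj :: "'i \<Rightarrow> 'i \<Rightarrow> bool" and q :: nat +
  fixes r :: 'i and par :: "'i \<Rightarrow> 'i" and dep :: "'i \<Rightarrow> nat" and \<Delta> :: nat
  assumes r: "r \<notin> W"
    and par: "v \<in> W \<Longrightarrow> par v \<in> insert r W"
    and dep: "v \<in> W \<Longrightarrow> dep (par v) < dep v"
    and adj_iff: "u \<in> W \<Longrightarrow> v \<in> W \<Longrightarrow> adj u v \<longleftrightarrow> u \<noteq> v \<and> (par u = v \<or> par v = u \<or> par u = par v)"
    and card_children: "v \<in> W \<Longrightarrow> Suc (card {u\<in>W. par u = v}) \<le> \<Delta>"
    and card_root: "card {u\<in>W. par u = r} \<le> \<Delta>"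
    and \<Delta>: "2 \<le> \<Delta>" and q: "\<Delta> + 2 \<le> q"
begin

definition ch :: "'i \<Rightarrow> 'i set" where
  "ch v = {u\<in>W. par u = v}"

inductive_set below :: "'i \<Rightarrow> 'i set" for v where
  child: "u \<in> ch v \<Longrightarrow> u \<in> below v"
| step: "u \<in> below v \<Longrightarrow> w \<in> ch u \<Longrightarrow> w \<in> below v"

text \<open>All edges at least two levels below \<open>v\<close>: what is still random once the row
  of children is fixed.\<close>

definition deep :: "'i \<Rightarrow> 'i set" where
  "deep v = below v - ch v"

section \<open>Subtrees and their boundaries\<close>

lemma ch_subset: "ch v \<subseteq> W"
  unfolding ch_def by auto

lemma finite_ch: "finite (ch v)"
  using ch_subset finite_W by (rule finite_subset)

lemma card_ch: "v \<in> insert r W \<Longrightarrow> card (ch v) \<le> \<Delta>" "v \<in> W \<Longrightarrow> Suc (card (ch v)) \<le> \<Delta>"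
  unfolding ch_def using card_children[of v] card_root by auto

lemma below_subset: "below v \<subseteq> W"
proof
  fix u assume "u \<in> below v" then show "u \<in> W" by cases (use ch_subset in auto)
qed

lemma finite_below: "finite (below v)"
  using below_subset finite_W by (rule finite_subset)

lemma below_par: "u \<in> below v \<Longrightarrow> par u = v \<or> par u \<in> below v"
  by (erule below.cases) (auto simp: ch_def)

lemma below_parI: "u \<in> W \<Longrightarrow> par u = v \<or> par u \<in> below v \<Longrightarrow> u \<in> below v"
  by (auto simp: ch_def intro: below.intros)

lemma below_iff: "u \<in> W \<Longrightarrow> u \<in> below v \<longleftrightarrow> par u = v \<or> par u \<in> below v"
  using below_par below_parI by blast

lemma below_dep: "u \<in> below v \<Longrightarrow> dep v < dep u"
proof (induction rule: below.induct)
  case (child u) then show ?case using dep[of u] by (auto simp: ch_def)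
next
  case (step u w) then show ?case using dep[of w] by (auto simp: ch_def)
qed

lemma not_below_self: "v \<notin> below v"
  using below_dep by blast

lemma below_trans: "w \<in> below u \<Longrightarrow> u \<in> below v \<Longrightarrow> w \<in> below v"
  by (induction rule: below.induct) (auto intro: below.intros)

lemma ch_below: "ch v \<subseteq> below v"
  by (auto intro: below.child)

lemma below_subset_below: "u \<in> below v \<Longrightarrow> below u \<subseteq> below v"
  using below_trans by blast

lemma below_unfold: "below v = ch v \<union> (\<Union>u\<in>ch v. below u)"
proof (intro equalityI subsetI)
  fix w assume "w \<in> below v"
  then show "w \<in> ch v \<union> (\<Union>u\<in>ch v. below u)"
    by (induction rule: below.induct) (auto intro: below.intros)
next
  fix w assume "w \<in> ch v \<union> (\<Union>u\<in>ch v. below u)"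
  then show "w \<in> below v" using below_trans ch_below by blast
qed

lemma ch_not_below: "u \<in> ch v \<Longrightarrow> u' \<in> ch v \<Longrightarrow> u' \<notin> below u"
proof
  assume *: "u \<in> ch v" "u' \<in> ch v" "u' \<in> below u"
  have "par u' = v" "dep v < dep u" using * dep[of u] by (auto simp: ch_def)
  with below_par[OF *(3)] show False using below_dep by fastforce
qed

lemma deep_eq: "deep v = (\<Union>u\<in>ch v. below u)"
  unfolding deep_def using below_unfold[of v] ch_not_below by blast

lemma deep_subset: "deep v \<subseteq> W"
  unfolding deep_def using below_subset by auto

lemma below_disjoint:
  assumes "u \<in> ch v" "u' \<in> ch v" "u \<noteq> u'"
  shows "below u \<inter> below u' = {}"
proof -
  have "w \<notin> below u'" if "w \<in> below u" for w
    using that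
  proof (induction rule: below.induct)
    case (child w)
    show ?case
    proof
      assume "w \<in> below u'"
      then have "u = u' \<or> u \<in> below u'" using below_par[of w u'] child by (auto simp: ch_def)
      then show False using assms ch_not_below by blast
    qed
  next
    case (step x w)
    show ?case
    proof
      assume "w \<in> below u'"
      then have "x = u' \<or> x \<in> below u'" using below_par[of w u'] step by (auto simp: ch_def)
      then show False using step assms ch_not_below[of u v u'] by blast
    qed
  qed
  then show ?thesis by blast
qed

lemma below_root: "below r = W"
proof (intro equalityI subsetI)
  fix u assume "u \<in> W"
  then show "u \<in> below r"
  proof (induction "dep u" arbitrary: u rule: less_induct)
    case less
    then show ?case using par[of u] dep[of u] below_parI[of u r] by auto
  qed
qed (use below_subset in auto)

text \<open>The only adjacency leaving a subtree runs from a child of \<open>v\<close> to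
  \<open>v\<close>, because siblings of an edge below \<open>v\<close> are below \<open>v\<close>
  too.\<close>

lemma adj_below:
  assumes "x \<in> below v" "y \<in> W" "adj x y" "y \<notin> below v"
  shows "y = v" "x \<in> ch v"
proof -
  have x: "x \<in> W" using assms below_subset by auto
  from adj_iff[OF x assms(2)] assms(3)
  have c: "par x = y \<or> par y = x \<or> par x = par y" by auto
  have "y \<noteq> x" using assms by auto
  show y: "y = v"
    using c below_par[OF assms(1)] below_iff[OF assms(2), of v] assms by auto
  show "x \<in> ch v"
    using c below_par[OF assms(1)] below_iff[OF assms(2), of v] assms x y not_below_self[of v]
      below_dep[OF assms(1)] dep[OF x] dep[of v] by (auto simp: ch_def)
qed

lemma nonadj_sibling:
  assumes "u \<in> ch v" "u' \<in> ch v" "u \<noteq> u'"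
  shows "nonadj (insert u (below u)) (below u')" "insert u (below u) \<inter> below u' = {}"
proof -
  show dis: "insert u (below u) \<inter> below u' = {}"
    using below_disjoint[OF assms] ch_not_below[OF assms(2,1)] by auto
  show "nonadj (insert u (below u)) (below u')"
    unfolding nonadj_def
  proof (intro ballI notI)
    fix a b assume a: "a \<in> insert u (below u)" and b: "b \<in> below u'" and "adj a b"
    have "a \<in> W" using a assms below_subset ch_subset by auto
    moreover have "a \<notin> below u'" using a dis by auto
    ultimately have "a = u'" using adj_below(1)[OF b] adj_sym[OF \<open>adj a b\<close>] by simp
    then show False using a assms ch_not_below by blast
  qed
qed

lemma nonadj_siblings:
  assumes "u \<in> ch v" "A \<subseteq> ch v" "u \<notin> A"
  shows "nonadj (insert u (below u)) (\<Union>w\<in>A. below w)" "insert u (below u) \<inter> (\<Union>w\<in>A. below w) = {}"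
proof -
  have A: "w \<in> ch v" "u \<noteq> w" if "w \<in> A" for w using assms that by auto
  show "nonadj (insert u (below u)) (\<Union>w\<in>A. below w)"
    unfolding nonadj_def using nonadj_sibling(1)[OF assms(1) A] unfolding nonadj_def by blast
  show "insert u (below u) \<inter> (\<Union>w\<in>A. below w) = {}"
    using nonadj_sibling(2)[OF assms(1) A] by blast
qed

lemma nonadj_deep: "nonadj {v} (deep v)" if "v \<in> W"
  unfolding nonadj_def
proof (intro ballI notI)
  fix a b assume a: "a \<in> {v}" and b: "b \<in> deep v" and ab: "adj a b"
  then obtain u where u: "u \<in> ch v" "b \<in> below u" unfolding deep_eq by auto
  have "v \<notin> below u" using u ch_below below_dep[of v u] below_dep[of u v] by fastforce
  then have "v = u" using adj_below(1)[OF u(2) that] adj_sym[OF ab] a by auto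
  then show False using u ch_below not_below_self by blast
qed

lemma nbrs_outside_below:
  assumes "u \<in> ch v"
  shows "{w\<in>W. adj u w \<and> w \<notin> below u} = ch v - {u} \<union> ({v} \<inter> W)"
proof -
  have u: "u \<in> W" "par u = v" using assms by (auto simp: ch_def)
  show ?thesis
  proof (intro equalityI subsetI)
    fix w assume w: "w \<in> {w\<in>W. adj u w \<and> w \<notin> below u}"
    then have "par u = w \<or> par w = u \<or> par u = par w" "u \<noteq> w" using adj_iff[OF u(1), of w] by auto
    moreover have "par w \<noteq> u" using w by (auto simp: below_iff)
    ultimately show "w \<in> ch v - {u} \<union> ({v} \<inter> W)" using w u by (auto simp: ch_def)
  next
    fix w assume w: "w \<in> ch v - {u} \<union> ({v} \<inter> W)"
    then show "w \<in> {w\<in>W. adj u w \<and> w \<notin> below u}"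
    proof
      assume "w \<in> ch v - {u}"
      then show ?thesis using u adj_iff[OF u(1), of w] ch_not_below[OF assms, of w] by (auto simp: ch_def)
    next
      assume "w \<in> {v} \<inter> W"
      then show ?thesis using u adj_iff[OF u(1), of v] dep[OF u(1)] below_dep[of v u] by auto
    qed
  qed
qed

text \<open>The colors to which \<open>u\<close> can be moved together with its subtree; conflicts
  with edges below \<open>u\<close> are disregarded because their colors are exchanged along with
  it.\<close>

definition free :: "'i \<Rightarrow> ('i \<Rightarrow> nat) \<Rightarrow> nat set" where
  "free u X = {c\<in>{1..q}. \<forall>w\<in>W. adj u w \<and> w \<notin> below u \<longrightarrow> X w \<noteq> c}"

lemma legal_block:
  assumes u: "u \<in> W" and X: "X \<in> Om"
  shows "legal (insert u (below u)) u X = free u X"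
proof (intro equalityI subsetI)
  fix c assume c: "c \<in> legal (insert u (below u)) u X"
  then have m: "move (insert u (below u)) u c X \<in> Om" "c \<in> {1..q}" unfolding legal_def by auto
  have "X w \<noteq> c" if "w \<in> W" "adj u w" "w \<notin> below u" for w
    using Om_neq[OF m(1) u that(1,2)] that adj_irrefl[of u] unfolding move_def by (auto split: if_splits)
  then show "c \<in> free u X" using m unfolding free_def by auto
next
  fix c assume "c \<in> free u X"
  then have c: "c \<in> {1..q}" "\<And>w. w \<in> W \<Longrightarrow> adj u w \<Longrightarrow> w \<notin> below u \<Longrightarrow> X w \<noteq> c"
    unfolding free_def by auto
  let ?U = "insert u (below u)"
  have bd: "move ?U u c X w \<noteq> X x" if "w \<in> ?U" "x \<in> W" "x \<notin> ?U" "adj w x" for w x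
  proof -
    have "w = u" using adj_below(1)[of w u x] that by auto
    then show ?thesis using c(2)[of x] that by (auto simp: move_at)
  qed
  have "move ?U u c X \<in> Om"
  proof (rule OmI)
    fix w assume w: "w \<in> W"
    show "move ?U u c X w \<in> {1..q}"
      using Om_mem[OF X w] Om_mem[OF X u] c transpose_mem_iff[of "X u" "{1..q}" c "X w"] unfolding move_def by auto
  next
    fix w assume "w \<notin> W"
    then show "move ?U u c X w = undefined" using Om_undef[OF X] u below_subset[of u] unfolding move_def by auto
  next
    fix w x assume wx: "w \<in> W" "x \<in> W" "adj w x"
    consider "w \<in> ?U" "x \<in> ?U" | "w \<in> ?U" "x \<notin> ?U" | "w \<notin> ?U" "x \<in> ?U" | "w \<notin> ?U" "x \<notin> ?U" by blast
    then show "move ?U u c X w \<noteq> move ?U u c X x"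
    proof cases
      case 1 then show ?thesis using Om_neq[OF X wx] unfolding move_def by (auto dest: transpose_eq_imp_eq)
    next
      case 2
      have "move ?U u c X x = X x" using 2 unfolding move_def by auto
      then show ?thesis using bd[OF 2(1) wx(2) 2(2) wx(3)] by simp
    next
      case 3
      have "move ?U u c X w = X w" using 3 unfolding move_def by auto
      then show ?thesis using bd[OF 3(2) wx(1) 3(1) adj_sym[OF wx(3)]] by simp
    next
      case 4 then show ?thesis using Om_neq[OF X wx] unfolding move_def by auto
    qed
  qed
  then show "c \<in> legal ?U u X" using c unfolding legal_def by auto
qed

lemma ch_deep_disjoint: "ch v \<inter> deep v = {}"
  unfolding deep_def by auto

text \<open>By color symmetry the number of colorings of the deep part does not depend on the rest.\<close>

lemma card_fiber_deep:
  assumes "proper_off (deep v) X" "proper_off (deep v) X'"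
  shows "card (fiber (deep v) X) = card (fiber (deep v) X')"
proof -
  \<comment> \<open>The child of v above w. Its branch is recolored by the transposition of the two
    colors of that child in X and X'. The child is the whole boundary of the branch, so the boundary
    condition is carried over.\<close>
  define anc where "anc w = (SOME u. u \<in> ch v \<and> w \<in> below u)" for w
  have anc: "anc w \<in> ch v" "w \<in> below (anc w)" if "w \<in> deep v" for w
    using someI_ex[of "\<lambda>u. u \<in> ch v \<and> w \<in> below u"] that unfolding deep_eq anc_def by auto
  have anc_eq: "anc w = u" if "u \<in> ch v" "w \<in> below u" for u w
    using anc[of w] below_disjoint[of u v "anc w"] that unfolding deep_eq by blast
  have le: "card (fiber (deep v) X) \<le> card (fiber (deep v) X')"
    if X: "proper_off (deep v) X" and X': "proper_off (deep v) X'" for X X'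
  proof (rule card_fiber_le[where \<pi>="\<lambda>w. Transposition.transpose (X (anc w)) (X' (anc w))", OF deep_subset X'])
    have mem: "X u \<in> {1..q}" "X' u \<in> {1..q}" if "u \<in> ch v" for u
    proof -
      have "u \<in> W - deep v" using that ch_deep_disjoint ch_subset by blast
      then show "X u \<in> {1..q}" "X' u \<in> {1..q}" using X X' unfolding proper_off_def by blast+
    qed
    fix w assume w: "w \<in> deep v"
    show "inj (Transposition.transpose (X (anc w)) (X' (anc w)))" by simp
    fix x
    { assume "x \<in> {1..q}"
      then show "Transposition.transpose (X (anc w)) (X' (anc w)) x \<in> {1..q}"
        by (simp only: transpose_mem_iff[OF mem[OF anc(1)[OF w]]]) }
    { assume x: "x \<in> W - deep v" "adj w x"
      have "x \<notin> below (anc w)" using x anc(1)[OF w] unfolding deep_eq by blast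
      then have "x = anc w" using adj_below(1)[OF anc(2)[OF w], of x] x by simp
      then show "Transposition.transpose (X (anc w)) (X' (anc w)) (X x) = X' x" by simp }
  next
    fix u w assume u: "u \<in> deep v" and w: "w \<in> deep v" and uw: "adj u w"
    have "w \<in> below (anc u)"
    proof (rule ccontr)
      assume "w \<notin> below (anc u)"
      then have "w = anc u" using adj_below(1)[OF anc(2)[OF u] _ uw] w deep_subset by auto
      then show False using anc(1)[OF u] w ch_deep_disjoint by blast
    qed
    then have "anc w = anc u" using anc_eq anc(1)[OF u] by blast
    then show "Transposition.transpose (X (anc u)) (X' (anc u)) = Transposition.transpose (X (anc w)) (X' (anc w))"
      by simp
  qed
  show ?thesis using le[OF assms(1,2)] le[OF assms(2,1)] by simp
qed

section \<open>The row of children as a uniform choice\<close>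

definition palette :: "'i \<Rightarrow> ('i \<Rightarrow> nat) \<Rightarrow> nat set" where
  "palette v X = {1..q} - (if v \<in> W then {X v} else {})"

text \<open>The colors in \<open>deep v\<close> stay as they were and need not fit the new
  row.\<close>

definition set_row :: "'i \<Rightarrow> ('i \<Rightarrow> nat) \<Rightarrow> ('i \<Rightarrow> nat) \<Rightarrow> 'i \<Rightarrow> nat" where
  "set_row v X R = (\<lambda>w. if w \<in> ch v then R w else X w)"

lemma proper_off_set_row:
  assumes X: "proper_off (below v) X" and R: "R \<in> injs (ch v) (palette v X)"
  shows "proper_off (deep v) (set_row v X R)"
proof -
  have R': "inj_on R (ch v)" "\<And>u. u \<in> ch v \<Longrightarrow> R u \<in> palette v X"
    using R unfolding injs_def by auto
  have cases: "w \<in> ch v \<or> w \<in> W - below v" if "w \<in> W - deep v" for w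
    using that unfolding deep_def by auto
  have not: "w \<notin> ch v" if "w \<in> W - below v" for w using that ch_below by auto
  have bd: "R u \<noteq> X w" if "u \<in> ch v" "w \<in> W - below v" "adj u w" for u w
  proof -
    have "w = v" using adj_below(1)[of u v w] that ch_below by auto
    then show ?thesis using R'(2)[OF that(1)] that unfolding palette_def by auto
  qed
  show ?thesis
    unfolding proper_off_def
  proof (intro conjI ballI impI)
    fix w assume "w \<in> W - deep v"
    from cases[OF this] show "set_row v X R w \<in> {1..q}"
    proof
      assume "w \<in> ch v" then show ?thesis using R'(2) unfolding set_row_def palette_def by auto
    next
      assume "w \<in> W - below v" then show ?thesis using not[of w] X unfolding set_row_def proper_off_def by auto
    qed
  next
    fix u w assume u: "u \<in> W - deep v" and w: "w \<in> W - deep v" and uw: "adj u w"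
    have "u \<noteq> w" using uw adj_irrefl by auto
    from cases[OF u] cases[OF w] show "set_row v X R u \<noteq> set_row v X R w"
    proof (elim disjE)
      assume "u \<in> ch v" "w \<in> ch v"
      then show ?thesis using R'(1) \<open>u \<noteq> w\<close> unfolding set_row_def by (auto dest: inj_onD)
    next
      assume "u \<in> ch v" "w \<in> W - below v"
      then show ?thesis using bd[OF _ _ uw] not[of w] unfolding set_row_def by auto
    next
      assume "u \<in> W - below v" "w \<in> ch v"
      then show ?thesis using bd[OF _ _ adj_sym[OF uw]] not[of u] unfolding set_row_def by fastforce
    next
      assume "u \<in> W - below v" "w \<in> W - below v"
      then show ?thesis using X uw not[of u] not[of w] unfolding set_row_def proper_off_def by auto
    qed
  qed
qed

lemma fiber_below_row:
  assumes v: "v \<in> insert r W" and Y: "Y \<in> fiber (below v) X"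
  shows "restrict Y (ch v) \<in> injs (ch v) (palette v X)"
    and "Y \<in> fiber (deep v) (set_row v X (restrict Y (ch v)))"
proof -
  have YO: "Y \<in> Om" using Y fiber_subset by auto
  have inj: "inj_on Y (ch v)"
  proof (rule inj_onI, rule ccontr)
    fix u w assume "u \<in> ch v" "w \<in> ch v" "Y u = Y w" "u \<noteq> w"
    then show False using Om_neq[OF YO, of u w] adj_iff[of u w] by (auto simp: ch_def)
  qed
  have "Y u \<in> palette v X" if u: "u \<in> ch v" for u
  proof -
    have "Y u \<noteq> X v" if "v \<in> W"
    proof -
      have "adj u v" using u that adj_iff[of u v] dep[of u] by (auto simp: ch_def)
      then show ?thesis using Om_neq[OF YO, of u v] u that fiber_agree[OF Y, of v] not_below_self[of v] by (auto simp: ch_def)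
    qed
    moreover have "Y u \<in> {1..q}" using Om_mem[OF YO] u ch_subset by blast
    ultimately show ?thesis unfolding palette_def by auto
  qed
  with inj show "restrict Y (ch v) \<in> injs (ch v) (palette v X)"
    unfolding injs_def by (auto simp: inj_on_def)
  show "Y \<in> fiber (deep v) (set_row v X (restrict Y (ch v)))"
    unfolding fiber_def using YO fiber_agree[OF Y] by (auto simp: set_row_def deep_def)
qed

text \<open>By \<open>card_fiber_deep\<close> every row has equally many extensions, so functions of
  the row are summed with one multiplicity. Measuring it at a separate \<open>X0\<close> allows the
  same factor for several boundary colorings X, as \<open>sum_block\<close> requires.\<close>

lemma sum_rows:
  fixes h :: "('i \<Rightarrow> nat) \<Rightarrow> real"
  assumes v: "v \<in> insert r W" and X: "proper_off (below v) X" and X0: "proper_off (deep v) X0"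
    and h: "\<And>Y. Y \<in> fiber (below v) X \<Longrightarrow> H Y = h (restrict Y (ch v))"
  shows "(\<Sum>Y\<in>fiber (below v) X. H Y)
      = card (fiber (deep v) X0) * (\<Sum>R\<in>injs (ch v) (palette v X). h R)"
proof (rule sum_uniform_fibers[where p="\<lambda>Y. restrict Y (ch v)"])
  fix R assume R: "R \<in> injs (ch v) (palette v X)"
  have "{Y \<in> fiber (below v) X. restrict Y (ch v) = R} = fiber (deep v) (set_row v X R)"
  proof (intro equalityI subsetI)
    fix Y assume "Y \<in> {Y \<in> fiber (below v) X. restrict Y (ch v) = R}"
    then show "Y \<in> fiber (deep v) (set_row v X R)" using fiber_below_row(2)[OF v, of Y X] by auto
  next
    fix Y assume Y: "Y \<in> fiber (deep v) (set_row v X R)"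
    have "w \<notin> ch v" if "w \<notin> below v" for w using that ch_below by auto
    then have "Y \<in> fiber (below v) X"
      using Y unfolding fiber_def set_row_def deep_def by auto
    moreover have "restrict Y (ch v) = R"
    proof
      fix w show "restrict Y (ch v) w = R w"
        using fiber_agree[OF Y, of w] R ch_deep_disjoint[of v] ch_subset[of v] unfolding injs_def
        by (cases "w \<in> ch v") (auto simp: set_row_def PiE_def extensional_def)
    qed
    ultimately show "Y \<in> {Y \<in> fiber (below v) X. restrict Y (ch v) = R}" by simp
  qed
  then show "card {Y \<in> fiber (below v) X. restrict Y (ch v) = R} = card (fiber (deep v) X0)"
    using card_fiber_deep[OF proper_off_set_row[OF X R] X0] by simp
qed (use h fiber_below_row(1)[OF v] in \<open>auto simp: finite_fiber finite_injs finite_ch palette_def\<close>)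

end

section \<open>Block energies, Glauber energies, and the recursion between them\<close>

context edge_tree
begin

text \<open>The energy \<open>J\<close>, for \<open>G\<close> the identity or \<open>sqrt\<close>.
  \<open>G\<close> is applied after averaging below \<open>v\<close>, because the entropy of a row
  involves the square root of an averaged function and not the average of a square root.\<close>

definition block_energy :: "(real \<Rightarrow> real) \<Rightarrow> (('i \<Rightarrow> nat) \<Rightarrow> real) \<Rightarrow> 'i \<Rightarrow> real" where
  "block_energy G F v = energy (insert v (below v)) v (\<lambda>X. G (cex (below v) F X))"

definition site_energy :: "(real \<Rightarrow> real) \<Rightarrow> (('i \<Rightarrow> nat) \<Rightarrow> real) \<Rightarrow> 'i \<Rightarrow> real" where
  "site_energy G F v = energy {v} v (\<lambda>X. G (F X))"

lemma block_energy_nonneg: "0 \<le> block_energy G F v"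
  unfolding block_energy_def by (rule energy_nonneg)

lemma site_energy_nonneg: "0 \<le> site_energy G F v"
  unfolding site_energy_def by (rule energy_nonneg)

lemma free_child:
  assumes u: "u \<in> ch v" and Y: "Y \<in> Om"
  shows "free u Y = insert (Y u) (palette v Y - Y ` ch v)"
proof -
  have uW: "u \<in> W" using u ch_subset by auto
  have "Y w \<noteq> Y u" if "w \<in> W" "adj u w" for w using Om_neq[OF Y uW that] by simp
  then have "free u Y = {c\<in>{1..q}. c = Y u \<or> (\<forall>w\<in>{w\<in>W. adj u w \<and> w \<notin> below u}. Y w \<noteq> c)}"
    unfolding free_def using Om_mem[OF Y uW] by auto
  also have "\<dots> = {c\<in>{1..q}. c = Y u \<or> (\<forall>w\<in>ch v. Y w \<noteq> c) \<and> (v \<in> W \<longrightarrow> Y v \<noteq> c)}"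
    unfolding nbrs_outside_below[OF u] by auto
  finally show ?thesis using Om_mem[OF Y uW] unfolding palette_def by auto
qed

lemma set_row_update:
  assumes "Y \<in> fiber (below v) X" "u \<in> ch v" "w \<in> W - deep v"
  shows "move (insert u (below u)) u c Y w = set_row v X ((restrict Y (ch v))(u := c)) w"
proof -
  have *: "w \<notin> below u" using assms unfolding deep_eq by auto
  have "w \<in> below v \<Longrightarrow> w \<in> ch v" using assms unfolding deep_def by auto
  then show ?thesis
    using * fiber_agree[OF assms(1), of w] assms(2,3) unfolding move_def set_row_def by auto
qed

lemma set_row_self:
  assumes "Y \<in> fiber (below v) X" "w \<in> W - deep v"
  shows "Y w = set_row v X (restrict Y (ch v)) w"
  using fiber_agree[OF assms(1), of w] assms(2) unfolding set_row_def deep_def by auto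

lemma sum_legal_child:
  fixes H :: "('i \<Rightarrow> nat) \<Rightarrow> real"
  assumes u: "u \<in> ch v" and Y: "Y \<in> fiber (below v) X" and pal: "palette v Y = palette v X"
    and H: "\<And>Z Z'. (\<And>w. w \<in> W - deep v \<Longrightarrow> Z w = Z' w) \<Longrightarrow> H Z = H Z'"
  defines "R \<equiv> restrict Y (ch v)"
  shows "(\<Sum>c\<in>legal (insert u (below u)) u Y. (H Y - H (move (insert u (below u)) u c Y))\<^sup>2)
      = (\<Sum>c\<in>palette v X - R ` ch v. (H (set_row v X R) - H (set_row v X (R(u := c))))\<^sup>2)"
proof -
  have YO: "Y \<in> Om" using Y fiber_subset by auto
  have uW: "u \<in> W" using u ch_subset by auto
  have HY: "H Y = H (set_row v X R)" unfolding R_def by (rule H) (rule set_row_self[OF Y])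
  have Hm: "H (move (insert u (below u)) u c Y) = H (set_row v X (R(u := c)))" for c
    unfolding R_def by (rule H) (rule set_row_update[OF Y u])
  have "R ` ch v = Y ` ch v" unfolding R_def by auto
  then have L: "legal (insert u (below u)) u Y = insert (Y u) (palette v X - R ` ch v)"
    using legal_block[OF uW YO] free_child[OF u YO] pal by simp
  have fin: "finite (palette v X - R ` ch v)" unfolding palette_def by auto
  have "Y u \<notin> palette v X - R ` ch v" using u unfolding R_def by auto
  moreover have "R(u := Y u) = R" using u unfolding R_def by auto
  ultimately show ?thesis unfolding L HY Hm using fin by simp
qed

lemma card_palette: "v \<in> insert r W \<Longrightarrow> X \<in> Om \<Longrightarrow> card (ch v) < card (palette v X)"
  using card_ch[of v] q Om_mem[of X v] unfolding palette_def by auto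

lemma card_rows_le: "v \<in> insert r W \<Longrightarrow> card (injs (ch v) (palette v X)) \<le> q ^ \<Delta>"
proof -
  assume v: "v \<in> insert r W"
  have "card (injs (ch v) (palette v X)) \<le> card (ch v \<rightarrow>\<^sub>E {1..q})"
  proof (rule card_mono)
    show "finite (ch v \<rightarrow>\<^sub>E {1..q})" by (simp add: finite_PiE finite_ch)
    show "injs (ch v) (palette v X) \<subseteq> ch v \<rightarrow>\<^sub>E {1..q}" unfolding injs_def palette_def by (auto simp: PiE_def Pi_def)
  qed
  also have "\<dots> = q ^ card (ch v)" by (simp add: card_PiE finite_ch)
  also have "\<dots> \<le> q ^ \<Delta>" using q card_ch(1)[OF v] by (intro power_increasing) auto
  finally show ?thesis .
qed

lemma palette_fiber: "Y \<in> fiber (below v) X \<Longrightarrow> palette v Y = palette v X"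
  unfolding palette_def using fiber_agree[of Y "below v" X v] not_below_self[of v] by auto

text \<open>Once the colors off \<open>below v\<close> are fixed, \<open>H\<close> is a function of
  the row alone, so \<open>injs_poincare\<close> applies in each fiber; at most
  \<open>q ^ \<Delta>\<close> rows occur.\<close>

lemma row_poincare:
  fixes H :: "('i \<Rightarrow> nat) \<Rightarrow> real"
  assumes v: "v \<in> insert r W"
    and H: "\<And>Z Z'. (\<And>w. w \<in> W - deep v \<Longrightarrow> Z w = Z' w) \<Longrightarrow> H Z = H Z'"
  shows "(\<Sum>Y\<in>Om. (H Y - cex (below v) H Y)\<^sup>2)
      \<le> 4 * real \<Delta> ^ 2 * real q ^ \<Delta> * (\<Sum>u\<in>ch v. energy (insert u (below u)) u H)"
proof -
  let ?C = "4 * real \<Delta> ^ 2 * real q ^ \<Delta>"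
  let ?e = "\<lambda>u Y. \<Sum>c\<in>legal (insert u (below u)) u Y. (H Y - H (move (insert u (below u)) u c Y))\<^sup>2"
  have "(\<Sum>Y\<in>Om. (H Y - cex (below v) H Y)\<^sup>2) \<le> (\<Sum>Y\<in>Om. ?C * (\<Sum>u\<in>ch v. ?e u Y))"
  proof (rule sum_le_fiberwise[where A="below v"])
    fix X assume X: "X \<in> Om"
    let ?I = "injs (ch v) (palette v X)" and ?K = "card (fiber (deep v) X)"
    define h where "h R = H (set_row v X R)" for R
    have po: "proper_off (below v) X" "proper_off (deep v) X" using X by (auto intro: proper_off_Om)
    note rows = sum_rows[OF v po]
    have Hh: "H Y = h (restrict Y (ch v))" if "Y \<in> fiber (below v) X" for Y
      unfolding h_def by (rule H) (rule set_row_self[OF that])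
    have K0: "?K > 0" by (rule card_fiber_pos[OF X])
    define m where "m = (\<Sum>R\<in>?I. h R) / card ?I"
    have "cex (below v) H X = m"
    proof -
      have "(\<Sum>Y\<in>fiber (below v) X. H Y) = ?K * (\<Sum>R\<in>?I. h R)" by (rule rows) (rule Hh)
      moreover have "(\<Sum>Y\<in>fiber (below v) X. 1) = real ?K * (\<Sum>R\<in>?I. 1 :: real)" by (rule rows) simp
      ultimately show ?thesis unfolding cex_def m_def using K0 by simp
    qed
    then have m: "cex (below v) H Y = m" if "Y \<in> fiber (below v) X" for Y using cex_eq[OF that] by simp
    have "(\<Sum>Y\<in>fiber (below v) X. (H Y - cex (below v) H Y)\<^sup>2) = ?K * (\<Sum>R\<in>?I. (h R - m)\<^sup>2)"
      by (rule rows) (simp add: Hh m)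
    also have "(\<Sum>R\<in>?I. (h R - m)\<^sup>2) \<le> 4 * real (card (ch v))^2 * card ?I * row_energy (ch v) (palette v X) h"
      by (rule injs_poincare[OF finite_ch _ card_palette[OF v X] m_def]) (simp add: palette_def)
    also have "\<dots> \<le> ?C * row_energy (ch v) (palette v X) h"
    proof (intro mult_right_mono mult_mono row_energy_nonneg power_mono)
      show "real (card ?I) \<le> real q ^ \<Delta>" using card_rows_le[OF v] by (metis of_nat_le_iff of_nat_power)
    qed (use card_ch(1)[OF v] in auto)
    also have "row_energy (ch v) (palette v X) h
        = (\<Sum>R\<in>?I. \<Sum>u\<in>ch v. \<Sum>x\<in>palette v X - R ` ch v. (h R - h (R(u := x)))\<^sup>2)"
      unfolding row_energy_def ..
    also have "?K * (?C * \<dots>) = ?C * (?K * \<dots>)" by simp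
    also have "?K * (\<Sum>R\<in>?I. \<Sum>u\<in>ch v. \<Sum>x\<in>palette v X - R ` ch v. (h R - h (R(u := x)))\<^sup>2)
        = (\<Sum>Y\<in>fiber (below v) X. \<Sum>u\<in>ch v. ?e u Y)"
    proof (rule rows[symmetric])
      fix Y assume Y: "Y \<in> fiber (below v) X"
      show "(\<Sum>u\<in>ch v. ?e u Y) = (\<Sum>u\<in>ch v. \<Sum>x\<in>palette v X - restrict Y (ch v) ` ch v.
          (h (restrict Y (ch v)) - h ((restrict Y (ch v))(u := x)))\<^sup>2)"
        unfolding h_def by (intro sum.cong[OF refl] sum_legal_child[OF _ Y palette_fiber[OF Y] H])
    qed
    finally show "(\<Sum>Y\<in>fiber (below v) X. (H Y - cex (below v) H Y)\<^sup>2)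
        \<le> (\<Sum>Y\<in>fiber (below v) X. ?C * (\<Sum>u\<in>ch v. ?e u Y))"
      using K0 by (simp add: sum_distrib_left mult_left_mono)
  qed
  also have "\<dots> = ?C * (\<Sum>u\<in>ch v. energy (insert u (below u)) u H)"
    unfolding energy_def sum_distrib_left[symmetric] by (subst sum.swap) simp
  finally show ?thesis .
qed

lemma cex_deep_split:
  assumes u: "u \<in> ch v" and X: "X \<in> Om"
  shows "cex (deep v) F X = cex (\<Union>w\<in>ch v - {u}. below w) (cex (below u) F) X"
proof -
  let ?A = "\<Union>w\<in>ch v - {u}. below w"
  have "deep v = ?A \<union> below u" using u unfolding deep_eq by auto
  moreover have "cex ?A (cex (below u) F) X = cex (?A \<union> below u) F X"
  proof (rule cex_union)
    have "nonadj (insert u (below u)) ?A" "insert u (below u) \<inter> ?A = {}"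
      using nonadj_siblings[OF u, of "ch v - {u}"] by auto
    then show "nonadj ?A (below u)" "?A \<inter> below u = {}"
      unfolding nonadj_def using adj_sym by blast+
    show "?A \<subseteq> W" using below_subset by blast
  qed (use X below_subset in auto)
  ultimately show ?thesis by simp
qed

text \<open>The average over \<open>deep v\<close> is the average below \<open>u\<close> followed by
  that over the branches of its siblings. Those branches are not adjacent to the block of
  \<open>u\<close>, so the second averaging can only lower the energy.\<close>

lemma energy_deep_le_block:
  assumes u: "u \<in> ch v" and G: "G = (\<lambda>t. t) \<or> G = sqrt" and F: "\<And>X. 0 \<le> F X"
  shows "energy (insert u (below u)) u (\<lambda>X. G (cex (deep v) F X)) \<le> block_energy G F u"
proof -
  let ?A = "\<Union>w\<in>ch v - {u}. below w"
  have "energy (insert u (below u)) u (\<lambda>X. G (cex (deep v) F X))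
      = energy (insert u (below u)) u (\<lambda>X. G (cex ?A (cex (below u) F) X))"
    by (rule energy_cong) (simp add: cex_deep_split[OF u])
  also have "\<dots> \<le> block_energy G F u"
    unfolding block_energy_def
  proof (rule energy_cex_le[OF _ _ _ _ G])
    show "insert u (below u) \<subseteq> W" using u below_subset ch_subset by auto
    show "insert u (below u) \<inter> ?A = {}" "nonadj (insert u (below u)) ?A"
      using nonadj_siblings[OF u, of "ch v - {u}"] by auto
  qed (auto intro: cex_nonneg F)
  finally show ?thesis .
qed

lemma energy_deep_le_site:
  assumes v: "v \<in> W" and G: "G = (\<lambda>t. t) \<or> G = sqrt" and F: "\<And>X. 0 \<le> F X"
  shows "energy {v} v (\<lambda>X. G (cex (deep v) F X)) \<le> site_energy G F v"
  unfolding site_energy_def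
  by (rule energy_cex_le[OF _ _ _ _ G F])
    (use v nonadj_deep[OF v] not_below_self[of v] in \<open>auto simp: deep_def\<close>)

text \<open>Given the colors outside, a coloring consists of a color a of v, a row avoiding a, and a
  coloring of the deep part; the number of the latter depends neither on a nor on the row.\<close>

lemma sum_block:
  fixes h :: "nat \<Rightarrow> ('i \<Rightarrow> nat) \<Rightarrow> real"
  assumes v: "v \<in> W" and X: "X \<in> Om"
    and h: "\<And>Y. Y \<in> fiber (insert v (below v)) X \<Longrightarrow> H Y = h (Y v) (restrict Y (ch v))"
  shows "(\<Sum>Y\<in>fiber (insert v (below v)) X. H Y)
      = card (fiber (deep v) X) * (\<Sum>a\<in>free v X. \<Sum>R\<in>injs (ch v) ({1..q} - {a}). h a R)"
proof -
  let ?A = "insert v (below v)"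
  have mem: "Y v \<in> free v X" if Y: "Y \<in> fiber ?A X" for Y
  proof -
    have YO: "Y \<in> Om" using Y fiber_subset by auto
    have "X w \<noteq> Y v" if "w \<in> W" "adj v w" "w \<notin> below v" for w
    proof -
      have "w \<noteq> v" using that adj_irrefl by auto
      then show ?thesis using Om_neq[OF YO v that(1,2)] fiber_agree[OF Y, of w] that by auto
    qed
    then show ?thesis using Om_mem[OF YO v] unfolding free_def by auto
  qed
  have po: "proper_off (below v) (X(v := a))" if a: "a \<in> free v X" for a
  proof -
    have bd: "X w \<noteq> a" if "w \<in> W - below v" "adj v w" for w using a that unfolding free_def by auto
    show ?thesis
      unfolding proper_off_def
    proof (intro conjI ballI impI)
      fix w assume "w \<in> W - below v"
      then show "(X(v := a)) w \<in> {1..q}" using a Om_mem[OF X] unfolding free_def by auto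
    next
      fix u w assume "u \<in> W - below v" "w \<in> W - below v" "adj u w"
      then show "(X(v := a)) u \<noteq> (X(v := a)) w"
        using bd[of u] bd[of w] Om_neq[OF X, of u w] adj_sym[of u w] adj_irrefl by (auto simp: fun_upd_def)
    qed
  qed
  have fib: "{Y\<in>fiber ?A X. Y v = a} = fiber (below v) (X(v := a))" for a
    unfolding fiber_def using v not_below_self[of v] by auto
  have "(\<Sum>Y\<in>fiber ?A X. H Y) = (\<Sum>a\<in>free v X. \<Sum>Y\<in>{Y\<in>fiber ?A X. Y v = a}. H Y)"
    by (rule sum.group[symmetric]) (use mem in \<open>auto simp: finite_fiber free_def\<close>)
  also have "\<dots> = (\<Sum>a\<in>free v X. card (fiber (deep v) X) * (\<Sum>R\<in>injs (ch v) ({1..q} - {a}). h a R))"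
  proof (intro sum.cong refl)
    fix a assume a: "a \<in> free v X"
    have pal: "palette v (X(v := a)) = {1..q} - {a}" using v unfolding palette_def by simp
    show "(\<Sum>Y\<in>{Y\<in>fiber ?A X. Y v = a}. H Y)
        = card (fiber (deep v) X) * (\<Sum>R\<in>injs (ch v) ({1..q} - {a}). h a R)"
      unfolding fib
    proof (subst sum_rows[OF _ po[OF a] proper_off_Om[OF X], where h="h a"])
      fix Y assume "Y \<in> fiber (below v) (X(v := a))"
      then have "Y \<in> fiber ?A X" "Y v = a" unfolding fib[symmetric] by auto
      then show "H Y = h a (restrict Y (ch v))" using h by auto
    qed (use v in \<open>simp_all only: pal insert_iff simp_thms\<close>)
  qed
  finally show ?thesis by (simp add: sum_distrib_left)
qed

text \<open>Reduces the recursion to an inequality about one color and one row. For a fixed outside,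
  \<open>\<phi> a R\<close> is the average over the deep part given the color a of v and the row R,
  and \<open>g a\<close> is its mean over rows. Increments of \<open>g\<close> make up the block
  energy of v, row energies of \<open>\<phi> a\<close> those of the children, and increments of
  \<open>\<phi>\<close> in a at a fixed row are Glauber moves at v. The averages over the deep part
  are removed by \<open>energy_deep_le_block\<close> and \<open>energy_deep_le_site\<close>.\<close>

lemma block_energy_recursion:
  fixes \<theta> K :: real
  assumes v: "v \<in> W" and G: "G = (\<lambda>t. t) \<or> G = sqrt" and F: "\<And>X. 0 \<le> F X"
    and K: "0 \<le> K" and \<theta>: "0 \<le> \<theta>"
    and two_level: "\<And>X \<phi> g M. X \<in> Om \<Longrightarrow> (\<And>a R. 0 \<le> \<phi> a R)
      \<Longrightarrow> (\<And>a. a \<in> {1..q} \<Longrightarrow> card (injs (ch v) ({1..q} - {a})) = M)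
      \<Longrightarrow> (\<And>a. g a = (\<Sum>R\<in>injs (ch v) ({1..q} - {a}). \<phi> a R) / M)
      \<Longrightarrow> M * (\<Sum>a\<in>free v X. \<Sum>b\<in>free v X. (G (g a) - G (g b))\<^sup>2)
        \<le> \<theta> * (\<Sum>a\<in>free v X. row_energy (ch v) ({1..q} - {a}) (\<lambda>R. G (\<phi> a R)))
         + K * (\<Sum>a\<in>free v X. \<Sum>b\<in>free v X - {a}. \<Sum>R\<in>injs (ch v) ({1..q} - {a} - {b}).
             (G (\<phi> a R) - G (\<phi> b R))\<^sup>2)"
  shows "block_energy G F v \<le> \<theta> * (\<Sum>u\<in>ch v. block_energy G F u) + K * site_energy G F v"
proof -
  let ?A = "insert v (below v)" and ?f = "\<lambda>X. G (cex (deep v) F X)" and ?D = "ch v"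
  let ?e1 = "\<lambda>Y. \<Sum>c\<in>legal ?A v Y. (G (cex (below v) F Y) - G (cex (below v) F (move ?A v c Y)))\<^sup>2"
  let ?eu = "\<lambda>u Y. \<Sum>c\<in>legal (insert u (below u)) u Y. (?f Y - ?f (move (insert u (below u)) u c Y))\<^sup>2"
  let ?ev = "\<lambda>Y. \<Sum>c\<in>legal {v} v Y. (?f Y - ?f (move {v} v c Y))\<^sup>2"
  have "block_energy G F v \<le> (\<Sum>Y\<in>Om. \<theta> * (\<Sum>u\<in>?D. ?eu u Y) + K * ?ev Y)"
    unfolding block_energy_def energy_def
  proof (rule sum_le_fiberwise[where A="?A"])
    fix X assume X: "X \<in> Om"
    define S where "S = free v X"
    define \<phi> where "\<phi> a R = cex (deep v) F (set_row v (X(v := a)) R)" for a R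
    define M where "M = card (injs ?D ({1..q} - {X v}))"
    define g where "g a = (\<Sum>R\<in>injs ?D ({1..q} - {a}). \<phi> a R) / M" for a
    let ?K = "card (fiber (deep v) X)"
    note blk = sum_block[OF v X, folded S_def]
    have K0: "?K > 0" by (rule card_fiber_pos[OF X])
    have Xv: "X v \<in> {1..q}" by (rule Om_mem[OF X v])
    have M: "card (injs ?D ({1..q} - {a})) = M" if "a \<in> {1..q}" for a
      unfolding M_def using that Xv by (intro card_injs_cong) (auto simp: finite_ch)
    have Sq: "S \<subseteq> {1..q}" unfolding S_def free_def by auto
    have \<phi>0: "0 \<le> \<phi> a R" for a R unfolding \<phi>_def by (intro cex_nonneg F)
    have fibv: "Y \<in> fiber (below v) (X(v := Y v))" if "Y \<in> fiber ?A X" for Y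
      using that unfolding fiber_def by auto
    have YO: "Y \<in> Om" if "Y \<in> fiber ?A X" for Y using that fiber_subset by auto
    have c\<phi>: "cex (deep v) F Y = \<phi> (Y v) (restrict Y ?D)" if "Y \<in> fiber ?A X" for Y
      unfolding \<phi>_def by (rule cex_cong) (rule set_row_self[OF fibv[OF that]])
    have rowsum: "(\<Sum>Z\<in>fiber (below v) Y. cex (deep v) F Z) = ?K * (\<Sum>R\<in>injs ?D ({1..q} - {Y v}). \<phi> (Y v) R)"
      "(\<Sum>Z\<in>fiber (below v) Y. 1) = real ?K * M" if Y: "Y \<in> fiber ?A X" for Y
    proof -
      have pal: "palette v Y = {1..q} - {Y v}" using v unfolding palette_def by simp
      have *: "fiber (below v) Y \<subseteq> fiber ?A X" using Y by (intro fiber_mono) auto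
      have vv: "Z v = Y v" if "Z \<in> fiber (below v) Y" for Z
        using fiber_agree[OF that, of v] v not_below_self[of v] by auto
      note rows = sum_rows[where v=v, OF _ proper_off_Om[OF YO[OF Y]] proper_off_Om[OF X], unfolded pal]
      show "(\<Sum>Z\<in>fiber (below v) Y. cex (deep v) F Z) = ?K * (\<Sum>R\<in>injs ?D ({1..q} - {Y v}). \<phi> (Y v) R)"
        by (rule rows) (use v * vv c\<phi> in auto)
      have "(\<Sum>Z\<in>fiber (below v) Y. 1) = real ?K * (\<Sum>R\<in>injs ?D ({1..q} - {Y v}). 1 :: real)"
        by (rule rows) (use v in auto)
      then show "(\<Sum>Z\<in>fiber (below v) Y. 1) = real ?K * M"
        using M[of "Y v"] Om_mem[OF YO[OF Y] v] by simp
    qed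
    have cg: "cex (below v) F Y = g (Y v)" if Y: "Y \<in> fiber ?A X" for Y
    proof -
      have "cex (below v) F Y = cex (below v) (cex (deep v) F) Y"
        by (rule cex_cex[symmetric]) (auto simp: deep_def)
      also have "\<dots> = (\<Sum>Z\<in>fiber (below v) Y. cex (deep v) F Z) / card (fiber (below v) Y)" by (rule cex_def)
      also have "\<dots> = g (Y v)" unfolding g_def rowsum(1)[OF Y] using rowsum(2)[OF Y] K0 by simp
      finally show ?thesis .
    qed
    have legA: "legal ?A v Y = S" if Y: "Y \<in> fiber ?A X" for Y
      unfolding S_def legal_block[OF v YO[OF Y]] unfolding free_def
      using fiber_agree[OF Y] adj_irrefl[of v] by (intro Collect_cong) (metis DiffI insertE)
    have cgm: "cex (below v) F (move ?A v b Y) = g b" if Y: "Y \<in> fiber ?A X" and b: "b \<in> S" for Y b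
    proof -
      have "move ?A v b Y \<in> Om" using b legA[OF Y] unfolding legal_def by auto
      moreover have "move ?A v b Y w = X w" if "w \<in> W - ?A" for w
        using that fiber_agree[OF Y that] unfolding move_def by auto
      ultimately have "move ?A v b Y \<in> fiber ?A X" unfolding fiber_def by auto
      then show ?thesis using cg by (simp add: move_at)
    qed
    have cfm: "cex (deep v) F (move {v} v b Y) = \<phi> b (restrict Y ?D)" if Y: "Y \<in> fiber ?A X" for Y b
      unfolding \<phi>_def move_single[OF YO[OF Y]]
    proof (rule cex_cong)
      fix w assume w: "w \<in> W - deep v"
      show "(Y(v := b)) w = set_row v (X(v := b)) (restrict Y ?D) w"
      proof (cases "w = v")
        case True
        then have "w \<notin> ch v" using ch_below not_below_self by blast
        then show ?thesis using True by (simp add: set_row_def)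
      next
        case False
        show ?thesis
        proof (cases "w \<in> ch v")
          case True
          then show ?thesis using False by (simp add: set_row_def)
        next
          case notch: False
          then have "w \<in> W - ?A" using w False unfolding deep_def by auto
          then show ?thesis using False notch fiber_agree[OF Y, of w] by (simp add: set_row_def)
        qed
      qed
    qed
    have legv: "legal {v} v Y = S - restrict Y ?D ` ?D" if Y: "Y \<in> fiber ?A X" for Y
    proof -
      have "adj v w \<longleftrightarrow> w \<in> ?D" if "w \<in> below v" for w
      proof
        assume "adj v w" then show "w \<in> ?D" using adj_below(2)[OF that v] adj_sym not_below_self by blast
      next
        assume "w \<in> ?D" then show "adj v w" using adj_iff[OF v, of w] v dep[of w] by (auto simp: ch_def)
      qed
      then have "legal {v} v Y = {c\<in>free v Y. \<forall>w\<in>?D. Y w \<noteq> c}"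
        unfolding legal_single[OF v YO[OF Y]] free_def using below_subset ch_below by blast
      also have "free v Y = S" using legA[OF Y] legal_block[OF v YO[OF Y]] by simp
      finally show ?thesis by auto
    qed
    have "(\<Sum>Y\<in>fiber ?A X. ?e1 Y) = ?K * (\<Sum>a\<in>S. \<Sum>R\<in>injs ?D ({1..q} - {a}). \<Sum>b\<in>S. (G (g a) - G (g b))\<^sup>2)"
      by (rule blk) (simp add: legA cg cgm cong: sum.cong)
    also have "\<dots> = ?K * (M * (\<Sum>a\<in>S. \<Sum>b\<in>S. (G (g a) - G (g b))\<^sup>2))"
      using Sq M by (simp add: sum_distrib_left subset_eq)
    also have "\<dots> \<le> ?K * (\<theta> * (\<Sum>a\<in>S. row_energy ?D ({1..q} - {a}) (\<lambda>R. G (\<phi> a R)))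
         + K * (\<Sum>a\<in>S. \<Sum>b\<in>S - {a}. \<Sum>R\<in>injs ?D ({1..q} - {a} - {b}). (G (\<phi> a R) - G (\<phi> b R))\<^sup>2))"
      unfolding S_def by (intro mult_left_mono two_level[OF X \<phi>0 M g_def]) auto
    \<comment> \<open>A color b with a row avoiding it is the same as a row with a color b missing
      from it, and these b are exactly the colors to which v alone can be recolored.\<close>
    also have "(\<Sum>a\<in>S. \<Sum>b\<in>S - {a}. \<Sum>R\<in>injs ?D ({1..q} - {a} - {b}). (G (\<phi> a R) - G (\<phi> b R))\<^sup>2)
        = (\<Sum>a\<in>S. \<Sum>R\<in>injs ?D ({1..q} - {a}). \<Sum>b\<in>S - R ` ?D. (G (\<phi> a R) - G (\<phi> b R))\<^sup>2)"
    proof (rule sum.cong[OF refl])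
      fix a assume a: "a \<in> S"
      let ?I = "injs ?D ({1..q} - {a})"
      have finS: "finite S" using Sq finite_subset by blast
      have finI: "finite ?I" by (simp add: finite_injs finite_ch)
      have "(\<Sum>b\<in>S - {a}. \<Sum>R\<in>injs ?D ({1..q} - {a} - {b}). (G (\<phi> a R) - G (\<phi> b R))\<^sup>2)
          = (\<Sum>b\<in>S. \<Sum>R\<in>injs ?D ({1..q} - {a} - {b}). (G (\<phi> a R) - G (\<phi> b R))\<^sup>2)"
        using finS a by (simp add: sum.remove)
      also have "\<dots> = (\<Sum>b\<in>S. \<Sum>R\<in>{R\<in>?I. b \<notin> R ` ?D}. (G (\<phi> a R) - G (\<phi> b R))\<^sup>2)"
        unfolding injs_avoid[of ?D "{1..q} - {a}"] by simp
      also have "\<dots> = (\<Sum>R\<in>?I. \<Sum>b\<in>{b\<in>S. b \<notin> R ` ?D}. (G (\<phi> a R) - G (\<phi> b R))\<^sup>2)"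
        by (rule sum.swap_restrict[OF finS finI])
      finally show "(\<Sum>b\<in>S - {a}. \<Sum>R\<in>injs ?D ({1..q} - {a} - {b}). (G (\<phi> a R) - G (\<phi> b R))\<^sup>2)
          = (\<Sum>R\<in>?I. \<Sum>b\<in>S - R ` ?D. (G (\<phi> a R) - G (\<phi> b R))\<^sup>2)"
        by (simp add: set_diff_eq)
    qed
    also have "?K * (\<theta> * (\<Sum>a\<in>S. row_energy ?D ({1..q} - {a}) (\<lambda>R. G (\<phi> a R)))
         + K * (\<Sum>a\<in>S. \<Sum>R\<in>injs ?D ({1..q} - {a}). \<Sum>b\<in>S - R ` ?D. (G (\<phi> a R) - G (\<phi> b R))\<^sup>2))
       = ?K * (\<Sum>a\<in>S. \<Sum>R\<in>injs ?D ({1..q} - {a}).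
           \<theta> * (\<Sum>u\<in>?D. \<Sum>x\<in>{1..q} - {a} - R ` ?D. (G (\<phi> a R) - G (\<phi> a (R(u := x))))\<^sup>2)
           + K * (\<Sum>b\<in>S - R ` ?D. (G (\<phi> a R) - G (\<phi> b R))\<^sup>2))"
      unfolding row_energy_def by (simp add: sum.distrib sum_distrib_left)
    also have "\<dots> = (\<Sum>Y\<in>fiber ?A X. \<theta> * (\<Sum>u\<in>?D. ?eu u Y) + K * ?ev Y)"
    proof (rule blk[symmetric])
      fix Y assume Y: "Y \<in> fiber ?A X"
      let ?R = "restrict Y ?D"
      have "?ev Y = (\<Sum>b\<in>S - ?R ` ?D. (G (\<phi> (Y v) ?R) - G (\<phi> b ?R))\<^sup>2)"
        by (simp only: legv[OF Y] c\<phi>[OF Y] cfm[OF Y])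
      moreover have "(\<Sum>u\<in>?D. ?eu u Y) = (\<Sum>u\<in>?D. \<Sum>x\<in>{1..q} - {Y v} - ?R ` ?D.
          (G (\<phi> (Y v) ?R) - G (\<phi> (Y v) (?R(u := x))))\<^sup>2)"
      proof (rule sum.cong[OF refl])
        fix u assume u: "u \<in> ?D"
        have pal: "palette v Y = palette v (X(v := Y v))" using v unfolding palette_def by simp
        have pal': "palette v (X(v := Y v)) = {1..q} - {Y v}" using v unfolding palette_def by simp
        show "?eu u Y = (\<Sum>x\<in>{1..q} - {Y v} - ?R ` ?D. (G (\<phi> (Y v) ?R) - G (\<phi> (Y v) (?R(u := x))))\<^sup>2)"
          unfolding \<phi>_def pal'[symmetric]
          by (rule sum_legal_child[OF u fibv[OF Y] pal]) (intro arg_cong[of _ _ G] cex_cong)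
      qed
      ultimately show "\<theta> * (\<Sum>u\<in>?D. ?eu u Y) + K * ?ev Y
          = \<theta> * (\<Sum>u\<in>?D. \<Sum>x\<in>{1..q} - {Y v} - ?R ` ?D. (G (\<phi> (Y v) ?R) - G (\<phi> (Y v) (?R(u := x))))\<^sup>2)
           + K * (\<Sum>b\<in>S - ?R ` ?D. (G (\<phi> (Y v) ?R) - G (\<phi> b ?R))\<^sup>2)" by simp
    qed
    finally show "(\<Sum>Y\<in>fiber ?A X. ?e1 Y) \<le> (\<Sum>Y\<in>fiber ?A X. \<theta> * (\<Sum>u\<in>?D. ?eu u Y) + K * ?ev Y)" .
  qed
  also have "\<dots> = \<theta> * (\<Sum>u\<in>?D. energy (insert u (below u)) u ?f) + K * energy {v} v ?f"
    unfolding energy_def sum.distrib sum_distrib_left[symmetric] by (subst sum.swap[of _ Om]) simp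
  also have "\<dots> \<le> \<theta> * (\<Sum>u\<in>?D. block_energy G F u) + K * site_energy G F v"
    using energy_deep_le_block[OF _ G F] energy_deep_le_site[OF v G F] K \<theta>
    by (intro add_mono mult_left_mono sum_mono) auto
  finally show ?thesis .
qed

end

section \<open>Tensorization of entropy\<close>

context col_graph
begin

text \<open>The expected conditional entropy on \<open>A\<close> given the colors off
  \<open>A\<close>, scaled by \<open>card Om\<close>; no normalization of \<open>F\<close> is
  assumed.\<close>

definition ent :: "'i set \<Rightarrow> (('i \<Rightarrow> nat) \<Rightarrow> real) \<Rightarrow> real" where
  "ent A F = (\<Sum>X\<in>Om. F X * ln (F X) - cex A F X * ln (cex A F X))"

lemma cex_empty: "X \<in> Om \<Longrightarrow> cex {} F X = F X"
proof -
  assume X: "X \<in> Om"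
  have "fiber {} X = {X}" using X Om_eqI[of _ X] unfolding fiber_def by auto
  then show ?thesis unfolding cex_def by simp
qed

lemma ent_empty: "ent {} F = 0"
  unfolding ent_def by (simp add: cex_empty)

lemma sum_cex_ln:
  "(\<Sum>X\<in>Om. cex A F X * ln (cex A F X)) = (\<Sum>X\<in>Om. F X * ln (cex A F X))"
  by (rule sum_mult_cex) (simp add: cex_eq)

text \<open>With \<open>?P C\<close> the average over C, the excess of the right side is the sum of
  F times the logarithm of F \<open>?P ?U\<close> / (\<open>?P A\<close> \<open>?P B\<close>). By ln
  y \<ge> 1 - 1/y it is nonnegative as soon as \<open>?P A\<close> \<open>?P B\<close> /
  \<open>?P ?U\<close> has the same sum as F. Independence enters there: \<open>?P ?U\<close> is the
  average over A of \<open>?P B\<close>, and \<open>?P A\<close> / \<open>?P ?U\<close> is constant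
  on fibers over A.\<close>

lemma ent_union_le:
  assumes A: "A \<subseteq> W" and B: "B \<subseteq> W" and AB: "A \<inter> B = {}" "nonadj A B"
    and F: "\<And>X. X \<in> Om \<Longrightarrow> 0 < F X"
  shows "ent (A \<union> B) F \<le> ent A F + ent B F"
proof -
  let ?P = "\<lambda>A. cex A F" and ?U = "A \<union> B"
  have pos: "0 < ?P C X" if "X \<in> Om" for C X using that F by (rule cex_pos)
  have "(\<Sum>X\<in>Om. F X) = (\<Sum>X\<in>Om. ?P A X)" by (rule sum_cex_Om[symmetric])
  also have "\<dots> = (\<Sum>X\<in>Om. cex A (?P B) X * (?P A X / ?P ?U X))"
    using cex_union[OF A B AB] pos by (intro sum.cong) (auto simp: less_imp_neq[THEN not_sym])
  also have "\<dots> = (\<Sum>X\<in>Om. ?P B X * (?P A X / ?P ?U X))"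
  proof (rule sum_mult_cex)
    fix X Y assume Y: "Y \<in> fiber A X"
    then have "Y \<in> fiber ?U X" unfolding fiber_def by auto
    then show "?P A Y / ?P ?U Y = ?P A X / ?P ?U X" using Y by (simp add: cex_eq)
  qed
  finally have eq: "(\<Sum>X\<in>Om. F X - ?P B X * (?P A X / ?P ?U X)) = 0" by (simp add: sum_subtractf)
  have "0 \<le> (\<Sum>X\<in>Om. F X * (ln (F X) + ln (?P ?U X) - ln (?P A X) - ln (?P B X)))"
    unfolding eq[symmetric]
  proof (rule sum_mono)
    fix X assume X: "X \<in> Om"
    note p = F[OF X] pos[OF X, of A] pos[OF X, of B] pos[OF X, of ?U]
    let ?x = "F X * ?P ?U X / (?P A X * ?P B X)"
    have "F X - ?P B X * (?P A X / ?P ?U X) = F X * (1 - 1 / ?x)"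
      using p by (simp add: field_simps)
    also have "\<dots> \<le> F X * ln ?x"
      using p by (intro mult_left_mono ln_ge_one_minus_inverse) auto
    also have "ln ?x = ln (F X) + ln (?P ?U X) - ln (?P A X) - ln (?P B X)"
      using p by (simp add: ln_div ln_mult)
    finally show "F X - ?P B X * (?P A X / ?P ?U X) \<le> F X * (ln (F X) + ln (?P ?U X) - ln (?P A X) - ln (?P B X))" .
  qed
  also have "\<dots> = ent A F + ent B F - ent ?U F"
    unfolding ent_def by (simp add: sum_subtractf sum.distrib sum_cex_ln algebra_simps)
  finally show ?thesis by simp
qed

lemma legal_single_fiber:
  assumes "v \<in> W" "Y \<in> fiber {v} X"
  shows "inj_on (\<lambda>c. move {v} v c Y) (legal {v} v Y)" "(\<lambda>c. move {v} v c Y) ` legal {v} v Y = fiber {v} X"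
proof -
  have YO: "Y \<in> Om" using assms fiber_subset by auto
  show "inj_on (\<lambda>c. move {v} v c Y) (legal {v} v Y)"
    unfolding move_single[OF YO] by (auto intro!: inj_onI dest: fun_cong[of _ _ v])
  show "(\<lambda>c. move {v} v c Y) ` legal {v} v Y = fiber {v} X"
  proof (intro equalityI subsetI)
    fix Z assume "Z \<in> (\<lambda>c. move {v} v c Y) ` legal {v} v Y"
    then show "Z \<in> fiber {v} X" using assms(2) unfolding legal_def move_single[OF YO] fiber_def by (auto split: if_splits)
  next
    fix Z assume Z: "Z \<in> fiber {v} X"
    then have ZO: "Z \<in> Om" using fiber_subset by auto
    have "Z = Y(v := Z v)"
    proof
      fix w show "Z w = (Y(v := Z v)) w"
        using fiber_agree[OF Z, of w] fiber_agree[OF assms(2), of w] Om_undef[OF ZO, of w] Om_undef[OF YO, of w]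
        by (cases "w \<in> W") auto
    qed
    then have "Z = move {v} v (Z v) Y" unfolding move_single[OF YO] .
    moreover have "Z v \<in> legal {v} v Y" using calculation ZO Om_mem[OF ZO assms(1)] unfolding legal_def by auto
    ultimately show "Z \<in> (\<lambda>c. move {v} v c Y) ` legal {v} v Y" by blast
  qed
qed

lemma card_legal_single:
  assumes "v \<in> W" "Y \<in> fiber {v} X"
  shows "card (fiber {v} X) = card (legal {v} v Y)"
  using card_image[OF legal_single_fiber(1)[OF assms]] legal_single_fiber(2)[OF assms] by simp

lemma card_fiber_single_le: "v \<in> W \<Longrightarrow> X \<in> Om \<Longrightarrow> card (fiber {v} X) \<le> q"
proof -
  assume v: "v \<in> W" "X \<in> Om"
  have "legal {v} v X \<subseteq> {1..q}" unfolding legal_def by auto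
  then have "card (legal {v} v X) \<le> card {1..q}" by (intro card_mono) auto
  then show ?thesis using card_legal_single[OF v(1) fiber_self[OF v(2)]] by simp
qed

text \<open>Any two members of a one-site fiber are joined by a single move, so the energy is a full
  double sum, that is, twice the fiber size times the square deviation of the roots; a fiber has at
  most q members.\<close>

lemma site_energy_le_ent:
  assumes v: "v \<in> W" and F: "\<And>X. X \<in> Om \<Longrightarrow> 0 < F X"
  shows "energy {v} v (\<lambda>X. sqrt (F X)) \<le> 2 * q * ent {v} F"
proof -
  let ?e = "\<lambda>Y. \<Sum>c\<in>legal {v} v Y. (sqrt (F Y) - sqrt (F (move {v} v c Y)))\<^sup>2"
  have "energy {v} v (\<lambda>X. sqrt (F X)) \<le> (\<Sum>X\<in>Om. 2 * q * (F X * ln (F X) - cex {v} F X * ln (cex {v} F X)))"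
    unfolding energy_def
  proof (rule sum_le_fiberwise[where A="{v}"])
    fix X assume X: "X \<in> Om"
    let ?I = "fiber {v} X"
    have ne: "?I \<noteq> {}" "finite ?I" using fiber_nonempty[OF X] finite_fiber by auto
    have pos: "0 < F Y" if "Y \<in> ?I" for Y using that F fiber_subset by blast
    define s where "s = (\<Sum>Y\<in>?I. sqrt (F Y)) / card ?I"
    have "(\<Sum>Y\<in>?I. ?e Y) = (\<Sum>Y\<in>?I. \<Sum>Z\<in>?I. (sqrt (F Y) - sqrt (F Z))\<^sup>2)"
    proof (rule sum.cong[OF refl])
      fix Y assume Y: "Y \<in> ?I"
      show "?e Y = (\<Sum>Z\<in>?I. (sqrt (F Y) - sqrt (F Z))\<^sup>2)"
        unfolding legal_single_fiber(2)[OF v Y, symmetric]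
        by (simp add: sum.reindex[OF legal_single_fiber(1)[OF v Y]])
    qed
    also have "\<dots> = 2 * card ?I * (\<Sum>Y\<in>?I. (sqrt (F Y) - s)\<^sup>2)"
    proof -
      have "(\<Sum>Y\<in>?I. sqrt (F Y)) = card ?I * s" unfolding s_def using ne by simp
      then show ?thesis
        unfolding sum_sum_square_diff sum_square_dev[OF ne(2,1) s_def] by (simp add: power2_eq_square algebra_simps)
    qed
    also have "\<dots> \<le> 2 * q * (\<Sum>Y\<in>?I. (sqrt (F Y) - s)\<^sup>2)"
      using card_fiber_single_le[OF v X] by (intro mult_right_mono sum_nonneg) auto
    also have "(\<Sum>Y\<in>?I. (sqrt (F Y) - s)\<^sup>2)
        \<le> (\<Sum>Y\<in>?I. F Y * ln (F Y)) - card ?I * (cex {v} F X * ln (cex {v} F X))"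
      by (rule sqrt_dev_le_sum_xlnx[OF ne(2,1) pos cex_def s_def])
    also have "\<dots> = (\<Sum>Y\<in>?I. F Y * ln (F Y) - cex {v} F Y * ln (cex {v} F Y))"
      by (simp add: sum_subtractf cex_eq cong: sum.cong)
    finally show "(\<Sum>Y\<in>?I. ?e Y) \<le> (\<Sum>Y\<in>?I. 2 * q * (F Y * ln (F Y) - cex {v} F Y * ln (cex {v} F Y)))"
      by (simp add: sum_distrib_left mult_left_mono)
  qed
  then show ?thesis unfolding ent_def by (simp add: sum_distrib_left)
qed

end

section \<open>Summation over the tree\<close>

context edge_tree
begin

lemma sum_below:
  fixes g :: "'i \<Rightarrow> real"
  shows "(\<Sum>f\<in>below v. g f) = (\<Sum>u\<in>ch v. g u + (\<Sum>f\<in>below u. g f))"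
proof -
  have "(\<Sum>f\<in>below v. g f) = (\<Sum>f\<in>ch v. g f) + (\<Sum>f\<in>deep v. g f)"
    using ch_below[of v] finite_below[of v] unfolding deep_def
    by (metis add.commute sum.subset_diff)
  also have "(\<Sum>f\<in>deep v. g f) = (\<Sum>u\<in>ch v. \<Sum>f\<in>below u. g f)"
    unfolding deep_eq using below_disjoint by (intro sum.UNION_disjoint) (auto simp: finite_ch finite_below)
  finally show ?thesis by (simp add: sum.distrib)
qed

lemma nonadj_children:
  assumes "insert u A \<subseteq> ch v" "u \<notin> A"
  shows "nonadj (\<Union>w\<in>A. below w) (below u)" "(\<Union>w\<in>A. below w) \<inter> below u = {}"
  using nonadj_siblings[of u v A] assms adj_sym unfolding nonadj_def by blast+

text \<open>The Efron-Stein inequality for independent branches: averages over different branches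
  commute, so averaging over the earlier ones does not increase the variance over the next.\<close>

lemma sum_dev_children:
  assumes "finite D" "D \<subseteq> ch v"
  shows "(\<Sum>X\<in>Om. (F X - cex (\<Union>u\<in>D. below u) F X)\<^sup>2) \<le> (\<Sum>u\<in>D. \<Sum>X\<in>Om. (F X - cex (below u) F X)\<^sup>2)"
  using assms
proof (induction D rule: finite_induct)
  case empty
  then show ?case by (simp add: cex_empty)
next
  case (insert u D)
  let ?A = "\<Union>w\<in>D. below w" and ?B = "below u"
  have sub: "?A \<subseteq> W" "?B \<subseteq> W" using below_subset by blast+
  have U: "(\<Union>w\<in>insert u D. below w) = ?A \<union> ?B" by auto
  have comm: "cex (?A \<union> ?B) F X = cex ?A (cex ?B F) X" if "X \<in> Om" for X
    using cex_union[OF sub nonadj_children(2,1)[OF insert.prems insert.hyps(2)] that] by simp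
  have "(\<Sum>X\<in>Om. (F X - cex (?A \<union> ?B) F X)\<^sup>2)
      = (\<Sum>X\<in>Om. (F X - cex ?A F X)\<^sup>2) + (\<Sum>X\<in>Om. (cex ?A F X - cex (?A \<union> ?B) (cex ?A F) X)\<^sup>2)"
    unfolding sum_square_dev_cex by (simp add: cex_cex)
  also have "(\<Sum>X\<in>Om. (cex ?A F X - cex (?A \<union> ?B) (cex ?A F) X)\<^sup>2)
      = (\<Sum>X\<in>Om. (cex ?A (\<lambda>Y. F Y - cex ?B F Y) X)\<^sup>2)"
    by (intro sum.cong refl) (simp add: cex_cex cex_diff comm)
  also have "\<dots> \<le> (\<Sum>X\<in>Om. (F X - cex ?B F X)\<^sup>2)" by (rule sum_square_cex_le)
  finally show ?case unfolding U using insert by simp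
qed

lemma ent_children:
  assumes "finite D" "D \<subseteq> ch v" and F: "\<And>X. X \<in> Om \<Longrightarrow> 0 < F X"
  shows "ent (\<Union>u\<in>D. below u) F \<le> (\<Sum>u\<in>D. ent (below u) F)"
  using assms(1,2)
proof (induction D rule: finite_induct)
  case empty
  then show ?case by (simp add: ent_empty)
next
  case (insert u D)
  let ?A = "\<Union>w\<in>D. below w" and ?B = "below u"
  have sub: "?A \<subseteq> W" "?B \<subseteq> W" using below_subset by blast+
  have U: "(\<Union>w\<in>insert u D. below w) = ?A \<union> ?B" by auto
  have "ent (?A \<union> ?B) F \<le> ent ?A F + ent ?B F"
    by (rule ent_union_le[OF sub nonadj_children(2,1)[OF insert.prems insert.hyps(2)] F])
  then show ?case unfolding U using insert by simp
qed

lemma cex_deep_inv: "(\<And>w. w \<in> W - deep v \<Longrightarrow> Z w = Z' w) \<Longrightarrow> cex (deep v) F Z = cex (deep v) F Z'"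
  by (rule cex_cong)

text \<open>Pythagoras splits the variance into that of the deep part, which is subadditive over the
  children, and that of the row, to which \<open>row_poincare\<close> applies. Every edge belongs to
  one row only, so the constant does not grow with the depth.\<close>

lemma variance_le_block_energy:
  assumes "v \<in> insert r W" and F: "\<And>X. 0 \<le> F X"
  shows "(\<Sum>X\<in>Om. (F X - cex (below v) F X)\<^sup>2)
    \<le> 4 * real \<Delta> ^ 2 * real q ^ \<Delta> * (\<Sum>f\<in>below v. block_energy (\<lambda>t. t) F f)"
  using assms(1)
proof (induction "card (below v)" arbitrary: v rule: less_induct)
  case less
  let ?C = "4 * real \<Delta> ^ 2 * real q ^ \<Delta>" and ?b = "block_energy (\<lambda>t. t) F"
  have C0: "0 \<le> ?C" by simp
  have db: "cex (below v) (cex (deep v) F) X = cex (below v) F X" for X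
    by (rule cex_cex) (auto simp: deep_def)
  have "(\<Sum>X\<in>Om. (F X - cex (below v) F X)\<^sup>2)
     = (\<Sum>X\<in>Om. (F X - cex (deep v) F X)\<^sup>2) + (\<Sum>X\<in>Om. (cex (deep v) F X - cex (below v) (cex (deep v) F) X)\<^sup>2)"
    unfolding sum_square_dev_cex by (simp add: db)
  also have "(\<Sum>X\<in>Om. (F X - cex (deep v) F X)\<^sup>2) \<le> (\<Sum>u\<in>ch v. \<Sum>X\<in>Om. (F X - cex (below u) F X)\<^sup>2)"
    unfolding deep_eq by (rule sum_dev_children[OF finite_ch order.refl])
  also have "\<dots> \<le> (\<Sum>u\<in>ch v. ?C * (\<Sum>f\<in>below u. ?b f))"
  proof (rule sum_mono)
    fix u assume u: "u \<in> ch v"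
    have "below u \<subset> below v" using below_subset_below[of u v] ch_below u not_below_self by blast
    then show "(\<Sum>X\<in>Om. (F X - cex (below u) F X)\<^sup>2) \<le> ?C * (\<Sum>f\<in>below u. ?b f)"
      using less.hyps[of u] psubset_card_mono[OF finite_below] u ch_subset by blast
  qed
  also have "(\<Sum>X\<in>Om. (cex (deep v) F X - cex (below v) (cex (deep v) F) X)\<^sup>2)
      \<le> ?C * (\<Sum>u\<in>ch v. energy (insert u (below u)) u (cex (deep v) F))"
    by (rule row_poincare[OF less.prems cex_deep_inv])
  also have "\<dots> \<le> ?C * (\<Sum>u\<in>ch v. ?b u)"
    using energy_deep_le_block[where G="\<lambda>t. t" and F=F] F by (intro mult_left_mono[OF _ C0] sum_mono) auto
  finally show ?case unfolding sum_below[of _ v] by (simp add: sum.distrib sum_distrib_left distrib_left)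
qed

text \<open>In the sum over the subtree every edge is a child at most once, so the recursive terms
  are at most \<theta> times the total and are absorbed on the left.\<close>

lemma block_energy_le_site_energy:
  fixes \<theta> K :: real
  assumes rec: "\<And>v. v \<in> W \<Longrightarrow> block_energy G F v \<le> \<theta> * (\<Sum>u\<in>ch v. block_energy G F u) + K * site_energy G F v"
    and \<theta>: "0 \<le> \<theta>" "\<theta> < 1"
  shows "(\<Sum>f\<in>below v. block_energy G F f) \<le> K / (1 - \<theta>) * (\<Sum>f\<in>below v. site_energy G F f)"
proof -
  let ?b = "block_energy G F" and ?B = "below v"
  have "(\<Sum>f\<in>?B. \<Sum>u\<in>ch f. ?b u) = (\<Sum>u\<in>(\<Union>f\<in>?B. ch f). ?b u)"
  proof (rule sum.UNION_disjoint[symmetric])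
    show "\<forall>f\<in>?B. finite (ch f)" using finite_ch by blast
  qed (auto simp: finite_below ch_def)
  also have "\<dots> \<le> (\<Sum>u\<in>?B. ?b u)"
    by (rule sum_mono2) (auto simp: finite_below block_energy_nonneg intro: below.step)
  finally have c: "\<theta> * (\<Sum>f\<in>?B. \<Sum>u\<in>ch f. ?b u) \<le> \<theta> * (\<Sum>u\<in>?B. ?b u)" using \<theta> by (intro mult_left_mono)
  have "(\<Sum>f\<in>?B. ?b f) \<le> (\<Sum>f\<in>?B. \<theta> * (\<Sum>u\<in>ch f. ?b u) + K * site_energy G F f)"
    using rec below_subset by (intro sum_mono) auto
  also have "\<dots> = \<theta> * (\<Sum>f\<in>?B. \<Sum>u\<in>ch f. ?b u) + K * (\<Sum>f\<in>?B. site_energy G F f)"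
    by (simp add: sum.distrib sum_distrib_left)
  finally have "(1 - \<theta>) * (\<Sum>f\<in>?B. ?b f) \<le> K * (\<Sum>f\<in>?B. site_energy G F f)"
    using c by (simp add: left_diff_distrib)
  then show ?thesis using \<theta> by (simp add: pos_le_divide_eq mult.commute)
qed

text \<open>The chain rule leaves the entropy of a function of the row. Rows are equally likely and
  at most \<open>q ^ \<Delta>\<close> in number, so \<open>sum_xlnx_le_sqrt_dev\<close> applies with
  a bounded loss.\<close>

lemma ent_row_le:
  assumes v: "v \<in> insert r W" and F: "\<And>X. X \<in> Om \<Longrightarrow> 0 < F X"
  shows "ent (below v) F \<le> ent (deep v) F
    + 4 * real q ^ \<Delta> * (\<Sum>X\<in>Om. (sqrt (cex (deep v) F X) - cex (below v) (\<lambda>X. sqrt (cex (deep v) F X)) X)\<^sup>2)"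
proof -
  let ?f = "cex (deep v) F" and ?s = "\<lambda>X. sqrt (cex (deep v) F X)" and ?B = "below v"
  have db: "cex (below v) ?f X = cex (below v) F X" for X
    by (rule cex_cex) (auto simp: deep_def)
  have "(\<Sum>X\<in>Om. ?f X * ln (?f X) - cex ?B ?f X * ln (cex ?B ?f X))
      \<le> (\<Sum>X\<in>Om. 4 * real q ^ \<Delta> * (?s X - cex ?B ?s X)\<^sup>2)"
  proof (rule sum_le_fiberwise[where A="below v"])
    fix X assume X: "X \<in> Om"
    let ?I = "injs (ch v) (palette v X)" and ?K = "card (fiber (deep v) X)"
    define h where "h R = ?f (set_row v X R)" for R
    have po: "proper_off (below v) X" "proper_off (deep v) X" using X by (auto intro: proper_off_Om)
    note rows = sum_rows[OF v po]
    have fh: "?f Y = h (restrict Y (ch v))" if "Y \<in> fiber ?B X" for Y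
      unfolding h_def by (rule cex_cong) (rule set_row_self[OF that])
    have K0: "?K > 0" by (rule card_fiber_pos[OF X])
    have one: "(\<Sum>Y\<in>fiber ?B X. 1) = real ?K * (\<Sum>R\<in>?I. 1 :: real)" by (rule rows) simp
    then have cI: "real (card (fiber ?B X)) = real ?K * card ?I" by simp
    then have Ine: "?I \<noteq> {}" using card_fiber_pos[OF X, of ?B] by auto
    have Ifin: "finite ?I" by (simp add: finite_injs finite_ch palette_def)
    define m where "m = (\<Sum>R\<in>?I. h R) / card ?I"
    define s where "s = (\<Sum>R\<in>?I. sqrt (h R)) / card ?I"
    have "cex ?B ?f X = (\<Sum>Y\<in>fiber ?B X. ?f Y) / card (fiber ?B X)" by (rule cex_def)
    also have "(\<Sum>Y\<in>fiber ?B X. ?f Y) = ?K * (\<Sum>R\<in>?I. h R)" by (rule rows) (rule fh)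
    finally have m: "cex ?B ?f Y = m" if "Y \<in> fiber ?B X" for Y
      unfolding m_def cI using K0 cex_eq[OF that, of ?f] by simp
    have "cex ?B ?s X = (\<Sum>Y\<in>fiber ?B X. ?s Y) / card (fiber ?B X)" by (rule cex_def)
    also have "(\<Sum>Y\<in>fiber ?B X. ?s Y) = ?K * (\<Sum>R\<in>?I. sqrt (h R))" by (rule rows) (simp add: fh)
    finally have s: "cex ?B ?s Y = s" if "Y \<in> fiber ?B X" for Y
      unfolding s_def cI using K0 cex_eq[OF that, of ?s] by simp
    \<comment> \<open>\<open>set_row v X R\<close> need not be a proper coloring, but its fiber is
      as large as that of X and hence nonempty; any member is a proper coloring with the same
      average.\<close>
    have hpos: "0 < h R" if R: "R \<in> ?I" for R
    proof -
      have "card (fiber (deep v) (set_row v X R)) = ?K"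
        by (rule card_fiber_deep[OF proper_off_set_row[OF po(1) R] po(2)])
      then have "0 < card (fiber (deep v) (set_row v X R))" using K0 by simp
      then obtain Y where Y: "Y \<in> fiber (deep v) (set_row v X R)" by (auto simp: card_gt_0_iff)
      then have "h R = ?f Y" unfolding h_def by (rule cex_eq[symmetric])
      then show ?thesis using cex_pos[OF _ F] Y fiber_subset by fastforce
    qed
    have "(\<Sum>Y\<in>fiber ?B X. ?f Y * ln (?f Y) - cex ?B ?f Y * ln (cex ?B ?f Y))
        = ?K * (\<Sum>R\<in>?I. h R * ln (h R) - m * ln m)"
      by (rule rows) (simp add: fh m)
    also have "(\<Sum>R\<in>?I. h R * ln (h R) - m * ln m) = (\<Sum>R\<in>?I. h R * ln (h R)) - card ?I * (m * ln m)"
      by (simp add: sum_subtractf)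
    also have "\<dots> \<le> 4 * real (card ?I) * (\<Sum>R\<in>?I. (sqrt (h R) - s)\<^sup>2)"
      by (rule sum_xlnx_le_sqrt_dev[OF Ifin Ine hpos m_def s_def])
    also have "\<dots> \<le> 4 * real q ^ \<Delta> * (\<Sum>R\<in>?I. (sqrt (h R) - s)\<^sup>2)"
    proof (intro mult_right_mono sum_nonneg)
      have "real (card ?I) \<le> real q ^ \<Delta>" using card_rows_le[OF v] by (metis of_nat_le_iff of_nat_power)
      then show "4 * real (card ?I) \<le> 4 * real q ^ \<Delta>" by simp
    qed auto
    also have "real ?K * (4 * real q ^ \<Delta> * (\<Sum>R\<in>?I. (sqrt (h R) - s)\<^sup>2))
        = ?K * (\<Sum>R\<in>?I. 4 * real q ^ \<Delta> * (sqrt (h R) - s)\<^sup>2)"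
      by (simp add: sum_distrib_left)
    also have "\<dots> = (\<Sum>Y\<in>fiber ?B X. 4 * real q ^ \<Delta> * (?s Y - cex ?B ?s Y)\<^sup>2)"
      by (rule rows[symmetric]) (simp add: fh s)
    finally show "(\<Sum>Y\<in>fiber ?B X. ?f Y * ln (?f Y) - cex ?B ?f Y * ln (cex ?B ?f Y))
        \<le> (\<Sum>Y\<in>fiber ?B X. 4 * real q ^ \<Delta> * (?s Y - cex ?B ?s Y)\<^sup>2)"
      by (simp add: mult_left_mono)
  qed
  then show ?thesis unfolding ent_def by (simp add: db sum_subtractf sum_distrib_left)
qed

text \<open>Both functions have the same sum of squares, namely the sum of \<open>F\<close>, while
  by concavity the averages below \<open>v\<close> are larger on the left. A variance is the second
  moment minus that of the averages.\<close>

lemma row_deviation_le_variance: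
  assumes F: "\<And>X. X \<in> Om \<Longrightarrow> 0 < F X"
  shows "(\<Sum>X\<in>Om. (sqrt (cex (deep v) F X) - cex (below v) (\<lambda>X. sqrt (cex (deep v) F X)) X)\<^sup>2)
    \<le> (\<Sum>X\<in>Om. (sqrt (F X) - cex (below v) (\<lambda>X. sqrt (F X)) X)\<^sup>2)"
proof -
  let ?s = "\<lambda>X. sqrt (cex (deep v) F X)"
  have "(\<Sum>X\<in>Om. (?s X)\<^sup>2) = (\<Sum>X\<in>Om. cex (deep v) F X)"
    using F cex_pos by (intro sum.cong refl) (simp add: less_imp_le)
  also have "\<dots> = (\<Sum>X\<in>Om. F X)" by (rule sum_cex_Om)
  also have "\<dots> = (\<Sum>X\<in>Om. (sqrt (F X))\<^sup>2)" using F by (intro sum.cong refl) (simp add: less_imp_le)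
  finally have eq: "(\<Sum>X\<in>Om. (?s X)\<^sup>2) = (\<Sum>X\<in>Om. (sqrt (F X))\<^sup>2)" .
  have le: "cex (deep v) (\<lambda>X. sqrt (F X)) X \<le> ?s X" if X: "X \<in> Om" for X
  proof (rule real_le_rsqrt)
    have "(cex (deep v) (\<lambda>X. sqrt (F X)) X)\<^sup>2 \<le> cex (deep v) (\<lambda>X. (sqrt (F X))\<^sup>2) X"
      by (rule cex_square_le[OF X])
    also have "\<dots> = cex (deep v) F X"
      by (rule cex_cong_fun) (use F fiber_subset in \<open>auto simp: less_imp_le subset_eq\<close>)
    finally show "(cex (deep v) (\<lambda>X. sqrt (F X)) X)\<^sup>2 \<le> cex (deep v) F X" .
  qed
  have "(cex (below v) (\<lambda>X. sqrt (F X)) X)\<^sup>2 \<le> (cex (below v) ?s X)\<^sup>2" if X: "X \<in> Om" for X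
  proof (rule power_mono)
    have "cex (below v) (\<lambda>X. sqrt (F X)) X = cex (below v) (cex (deep v) (\<lambda>X. sqrt (F X))) X"
      by (rule cex_cex[symmetric]) (auto simp: deep_def)
    also have "\<dots> \<le> cex (below v) ?s X" by (rule cex_mono) (use le fiber_subset in blast)
    finally show "cex (below v) (\<lambda>X. sqrt (F X)) X \<le> cex (below v) ?s X" .
    show "0 \<le> cex (below v) (\<lambda>X. sqrt (F X)) X"
      by (rule cex_nonneg) (use F fiber_subset in \<open>auto simp: less_imp_le subset_eq\<close>)
  qed
  then have "(\<Sum>X\<in>Om. (cex (below v) (\<lambda>X. sqrt (F X)) X)\<^sup>2) \<le> (\<Sum>X\<in>Om. (cex (below v) ?s X)\<^sup>2)"
    by (rule sum_mono)
  then show ?thesis unfolding sum_square_dev_cex eq by simp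
qed

lemma ent_below_le:
  assumes v: "v \<in> insert r W" and F: "\<And>X. X \<in> Om \<Longrightarrow> 0 < F X"
  shows "ent (below v) F \<le> (\<Sum>u\<in>ch v. ent (below u) F)
    + 4 * real q ^ \<Delta> * (\<Sum>X\<in>Om. (sqrt (cex (deep v) F X) - cex (below v) (\<lambda>X. sqrt (cex (deep v) F X)) X)\<^sup>2)"
proof -
  have "ent (deep v) F \<le> (\<Sum>u\<in>ch v. ent (below u) F)"
    unfolding deep_eq by (rule ent_children[OF finite_ch order.refl]) (rule F)
  moreover have "ent (below v) F \<le> ent (deep v) F + 4 * real q ^ \<Delta> *
      (\<Sum>X\<in>Om. (sqrt (cex (deep v) F X) - cex (below v) (\<lambda>X. sqrt (cex (deep v) F X)) X)\<^sup>2)"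
    by (rule ent_row_le[OF v]) (rule F)
  ultimately show ?thesis by linarith
qed

end

text \<open>The constant of \<open>row_poincare\<close>: the squared path length 2\<Delta> between
  rows times the bound for their number.\<close>

definition star_const :: "nat \<Rightarrow> nat \<Rightarrow> real" where
  "star_const \<Delta> q = 4 * real \<Delta> ^ 2 * real q ^ \<Delta>"

text \<open>The row entropy factor \<open>4 * q ^ \<Delta>\<close>, the constant of
  \<open>row_poincare\<close>, and K / (1 - \<theta>) from the recursion with \<theta> = 1 -
  1/(2\<Delta>) and K = (1 + 2\<Delta>) q.\<close>

definition tree_const :: "nat \<Rightarrow> nat \<Rightarrow> real" where
  "tree_const \<Delta> q = 4 * real q ^ \<Delta> * (star_const \<Delta> q * ((1 + 2 * real \<Delta>) * q / (1 - (1 - 1 / (2 * real \<Delta>)))))"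

text \<open>The same three factors with \<theta> = 3/4 and K = 28.\<close>

definition path_const :: "nat \<Rightarrow> nat \<Rightarrow> real" where
  "path_const \<Delta> q = 4 * real q ^ \<Delta> * star_const \<Delta> q * (28 / (1 - 3 / 4))"

section \<open>The recursions with their constants, and the resulting entropy bounds\<close>

context edge_tree
begin

text \<open>The choice \<eta> = 1/(2\<Delta>) keeps (1 + \<eta>)(1 - 1/\<Delta>) below 1 -
  1/(2\<Delta>) and turns 1 + 1/\<eta> into 1 + 2\<Delta>.\<close>

lemma block_recursion_variance:
  assumes v: "v \<in> W" and F: "\<And>X. 0 \<le> F X"
  shows "block_energy (\<lambda>t. t) F v \<le> (1 - 1 / (2 * real \<Delta>)) * (\<Sum>u\<in>ch v. block_energy (\<lambda>t. t) F u)
      + ((1 + 2 * real \<Delta>) * q) * site_energy (\<lambda>t. t) F v"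
proof (rule block_energy_recursion[OF v _ F])
  fix X :: "'i \<Rightarrow> nat" and \<phi> :: "nat \<Rightarrow> ('i \<Rightarrow> nat) \<Rightarrow> real" and g :: "nat \<Rightarrow> real" and M :: nat
  assume M: "\<And>a. a \<in> {1..q} \<Longrightarrow> card (injs (ch v) ({1..q} - {a})) = M"
    and g: "\<And>a. g a = (\<Sum>R\<in>injs (ch v) ({1..q} - {a}). \<phi> a R) / M"
  let ?S = "free v X" and ?d = "real (card (ch v))"
  let ?\<eta> = "1 / (2 * real \<Delta>)"
  let ?E = "\<Sum>a\<in>?S. row_energy (ch v) ({1..q} - {a}) (\<phi> a)"
  let ?L = "\<Sum>a\<in>?S. \<Sum>b\<in>?S - {a}. \<Sum>R\<in>injs (ch v) ({1..q} - {a} - {b}). (\<phi> a R - \<phi> b R)\<^sup>2"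
  have d: "Suc (card (ch v)) \<le> \<Delta>" using card_ch(2)[OF v] .
  have "M * (\<Sum>a\<in>?S. \<Sum>b\<in>?S. (g a - g b)\<^sup>2)
     \<le> (1 + ?\<eta>) * (2 * card (ch v) / ((real (card {1..q}) - 2) * (real (card {1..q}) - 1 - card (ch v)))) * ?E
       + (1 + 1 / ?\<eta>) * real (card {1..q}) * ?L"
    by (rule mean_increments_le[OF finite_ch _ _ _ _ M g]) (use \<Delta> d q in \<open>auto simp: free_def\<close>)
  also have "(1 + ?\<eta>) * (2 * card (ch v) / ((real (card {1..q}) - 2) * (real (card {1..q}) - 1 - card (ch v)))) * ?E
      \<le> (1 - 1 / (2 * real \<Delta>)) * ?E"
  proof (intro mult_right_mono sum_nonneg row_energy_nonneg)
    \<comment> \<open>Here q \<ge> \<Delta> + 2 is decisive: q - 2 \<ge> \<Delta>, and q - 1 - d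
      \<ge> 2 because d \<le> \<Delta> - 1.\<close>
    have "2 * real \<Delta> \<le> (real q - 2) * (real q - 1 - ?d)"
    proof -
      have "real \<Delta> * 2 \<le> (real q - 2) * (real q - 1 - ?d)" using d q by (intro mult_mono) auto
      then show ?thesis by simp
    qed
    then have "2 * ?d / ((real q - 2) * (real q - 1 - ?d)) \<le> 2 * ?d / (2 * real \<Delta>)"
      using \<Delta> by (intro divide_left_mono mult_pos_pos) (use d q in auto)
    also have "\<dots> \<le> 1 - 1 / real \<Delta>" using d \<Delta> by (simp add: field_simps)
    finally have *: "2 * ?d / ((real q - 2) * (real q - 1 - ?d)) \<le> 1 - 1 / real \<Delta>" .
    have "(1 + ?\<eta>) * (2 * ?d / ((real q - 2) * (real q - 1 - ?d))) \<le> (1 + ?\<eta>) * (1 - 1 / real \<Delta>)"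
      by (rule mult_left_mono[OF *]) simp
    also have "\<dots> \<le> 1 - 1 / (2 * real \<Delta>)" using \<Delta> by (simp add: field_simps)
    finally show "(1 + ?\<eta>) * (2 * card (ch v) / ((real (card {1..q}) - 2) * (real (card {1..q}) - 1 - card (ch v))))
        \<le> 1 - 1 / (2 * real \<Delta>)" by simp
  qed
  finally show "M * (\<Sum>a\<in>?S. \<Sum>b\<in>?S. (g a - g b)\<^sup>2) \<le> (1 - 1 / (2 * real \<Delta>)) * ?E + ((1 + 2 * real \<Delta>) * q) * ?L"
    by simp
qed (use \<Delta> in \<open>auto simp: field_simps\<close>)

lemma variance_le_site_energy:
  assumes v: "v \<in> insert r W" and F: "\<And>X. 0 \<le> F X"
  shows "(\<Sum>X\<in>Om. (F X - cex (below v) F X)\<^sup>2)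
    \<le> star_const \<Delta> q * ((1 + 2 * real \<Delta>) * q / (1 - (1 - 1 / (2 * real \<Delta>)))) * (\<Sum>f\<in>below v. site_energy (\<lambda>t. t) F f)"
proof -
  have "(\<Sum>X\<in>Om. (F X - cex (below v) F X)\<^sup>2) \<le> star_const \<Delta> q * (\<Sum>f\<in>below v. block_energy (\<lambda>t. t) F f)"
    unfolding star_const_def by (rule variance_le_block_energy[OF v F])
  also have "\<dots> \<le> star_const \<Delta> q * ((1 + 2 * real \<Delta>) * q / (1 - (1 - 1 / (2 * real \<Delta>)))
      * (\<Sum>f\<in>below v. site_energy (\<lambda>t. t) F f))"
  proof (intro mult_left_mono block_energy_le_site_energy block_recursion_variance F)
    show "0 \<le> star_const \<Delta> q" unfolding star_const_def by simp
  qed (use \<Delta> in \<open>auto simp: field_simps\<close>)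
  finally show ?thesis by (simp only: mult.assoc)
qed

text \<open>The row under v is charged with all Glauber energies below v, so an edge pays once for
  every row above it within the subtree; \<open>M - dep v\<close> bounds the number of these
  rows.\<close>

lemma ent_below_le_depth:
  assumes F: "\<And>X. 0 < F X" and M: "\<And>u. u \<in> W \<Longrightarrow> dep u \<le> M" and "v \<in> insert r W"
  shows "ent (below v) F \<le> tree_const \<Delta> q * real (M - dep v) * (\<Sum>f\<in>below v. site_energy sqrt F f)"
  using assms(3)
proof (induction "M - dep v" arbitrary: v rule: less_induct)
  case less
  let ?T = "tree_const \<Delta> q" and ?s = "site_energy sqrt F"
  have T0: "0 \<le> ?T" unfolding tree_const_def star_const_def using \<Delta> by simp
  show ?case
  proof (cases "ch v = {}")
    case True
    then have "below v = {}" unfolding below_unfold[of v] by simp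
    then show ?thesis by (simp add: ent_empty)
  next
    case False
    then obtain u0 where u0: "u0 \<in> ch v" by auto
    have dM: "dep v < dep u" "dep u \<le> M" if "u \<in> ch v" for u using that dep[of u] M by (auto simp: ch_def)
    have "ent (below v) F \<le> (\<Sum>u\<in>ch v. ent (below u) F) + 4 * real q ^ \<Delta> *
        (\<Sum>X\<in>Om. (sqrt (cex (deep v) F X) - cex (below v) (\<lambda>X. sqrt (cex (deep v) F X)) X)\<^sup>2)"
      by (rule ent_below_le[OF less.prems F])
    also have "(\<Sum>X\<in>Om. (sqrt (cex (deep v) F X) - cex (below v) (\<lambda>X. sqrt (cex (deep v) F X)) X)\<^sup>2)
        \<le> (\<Sum>X\<in>Om. (sqrt (F X) - cex (below v) (\<lambda>X. sqrt (F X)) X)\<^sup>2)"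
      by (rule row_deviation_le_variance[OF F])
    also have "\<dots> \<le> star_const \<Delta> q * ((1 + 2 * real \<Delta>) * q / (1 - (1 - 1 / (2 * real \<Delta>)))) * (\<Sum>f\<in>below v. ?s f)"
      using variance_le_site_energy[OF less.prems, of "\<lambda>X. sqrt (F X)"] F
      by (simp add: site_energy_def less_imp_le)
    also have "4 * real q ^ \<Delta> * (star_const \<Delta> q * ((1 + 2 * real \<Delta>) * q / (1 - (1 - 1 / (2 * real \<Delta>)))) * (\<Sum>f\<in>below v. ?s f))
        = ?T * (\<Sum>f\<in>below v. ?s f)"
      unfolding tree_const_def by (simp only: mult.assoc)
    also have "(\<Sum>u\<in>ch v. ent (below u) F) \<le> (\<Sum>u\<in>ch v. ?T * real (M - dep v - 1) * (\<Sum>f\<in>below u. ?s f))"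
    proof (rule sum_mono)
      fix u assume u: "u \<in> ch v"
      have "M - dep u < M - dep v" using dM[OF u] by auto
      then have "ent (below u) F \<le> ?T * real (M - dep u) * (\<Sum>f\<in>below u. ?s f)"
        using less.hyps[of u] u ch_subset by auto
      also have "\<dots> \<le> ?T * real (M - dep v - 1) * (\<Sum>f\<in>below u. ?s f)"
        using dM[OF u] T0 by (intro mult_right_mono mult_left_mono sum_nonneg) (auto simp: site_energy_nonneg)
      finally show "ent (below u) F \<le> ?T * real (M - dep v - 1) * (\<Sum>f\<in>below u. ?s f)" .
    qed
    also have "\<dots> \<le> ?T * real (M - dep v - 1) * (\<Sum>f\<in>below v. ?s f)"
      unfolding sum_distrib_left[symmetric] sum_below[of _ v] using T0
      by (intro mult_left_mono sum_mono) (auto simp: site_energy_nonneg)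
    finally have "ent (below v) F \<le> ?T * (real (M - dep v - 1) + 1) * (\<Sum>f\<in>below v. ?s f)"
      by (simp add: mult_left_mono) (simp add: algebra_simps)
    \<comment> \<open>The truncated subtraction is exact because a child lies strictly below v and
      at depth at most M.\<close>
    moreover have "real (M - dep v - 1) + 1 = real (M - dep v)" using dM[OF u0] by simp
    ultimately show ?thesis by simp
  qed
qed

lemma ent_le_depth:
  assumes F: "\<And>X. 0 < F X" and M: "\<And>u. u \<in> W \<Longrightarrow> dep u \<le> M"
  shows "ent W F \<le> tree_const \<Delta> q * real M * (2 * q) * (\<Sum>v\<in>W. ent {v} F)"
proof -
  have T0: "0 \<le> tree_const \<Delta> q" unfolding tree_const_def star_const_def using \<Delta> by simp
  have "ent W F \<le> tree_const \<Delta> q * real (M - dep r) * (\<Sum>f\<in>W. site_energy sqrt F f)"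
    using ent_below_le_depth[OF F M, of r] by (simp add: below_root)
  also have "\<dots> \<le> tree_const \<Delta> q * real M * (\<Sum>f\<in>W. site_energy sqrt F f)"
    using T0 by (intro mult_right_mono mult_left_mono sum_nonneg) (auto simp: site_energy_nonneg)
  also have "\<dots> \<le> tree_const \<Delta> q * real M * (\<Sum>f\<in>W. 2 * q * ent {f} F)"
    using T0 F site_energy_le_ent unfolding site_energy_def by (intro mult_left_mono sum_mono) auto
  finally show ?thesis by (simp add: sum_distrib_left mult.assoc)
qed

text \<open>An edge of a path has at most one neighbor outside its subtree: its parent, which then
  has no other child, or, if the parent is virtual, its only sibling.\<close>

lemma card_free_path:
  assumes \<Delta>2: "\<Delta> = 2" and v: "v \<in> W"
  shows "q \<le> card (free v X) + 1"
proof -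
  define p where "p = par v"
  have vp: "v \<in> ch p" unfolding p_def ch_def using v by simp
  let ?B = "{w\<in>W. adj v w \<and> w \<notin> below v}"
  have "card ?B \<le> 1"
  proof (cases "p \<in> W")
    case True
    then have "card (ch p) \<le> 1" using card_ch(2)[of p] \<Delta>2 by simp
    then have e: "ch p - {v} = {}" using vp card_le_Suc0_iff_eq[OF finite_ch, of p] by auto
    show ?thesis unfolding nbrs_outside_below[OF vp] e using True by simp
  next
    case False
    then have "p = r" using par[OF v] unfolding p_def by auto
    then have "card (ch p) \<le> 2" using card_ch(1)[of p] \<Delta>2 by simp
    then show ?thesis unfolding nbrs_outside_below[OF vp] using False vp finite_ch[of p] by simp
  qed
  moreover have "free v X = {1..q} - X ` ?B" unfolding free_def by auto
  moreover have "card (X ` ?B) \<le> card ?B" by (rule card_image_le) (use finite_W in auto)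
  moreover have "card {1..q} - card (X ` ?B) \<le> card ({1..q} - X ` ?B)"
    by (rule diff_card_le_card_Diff) (use finite_W in auto)
  ultimately show ?thesis by simp
qed

text \<open>With \<eta> = 1/8 the constants are 2/3 * 9/8 = 3/4 and 4 + 3 * 8 = 28.\<close>

lemma block_recursion_path:
  assumes \<Delta>2: "\<Delta> = 2" and v: "v \<in> W" and F: "\<And>X. 0 \<le> F X"
  shows "block_energy sqrt F v \<le> 3 / 4 * (\<Sum>u\<in>ch v. block_energy sqrt F u) + 28 * site_energy sqrt F v"
proof (rule block_energy_recursion[OF v _ F])
  fix X :: "'i \<Rightarrow> nat" and \<phi> :: "nat \<Rightarrow> ('i \<Rightarrow> nat) \<Rightarrow> real" and g :: "nat \<Rightarrow> real" and M :: nat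
  assume M: "\<And>a. a \<in> {1..q} \<Longrightarrow> card (injs (ch v) ({1..q} - {a})) = M"
    and g: "\<And>a. g a = (\<Sum>R\<in>injs (ch v) ({1..q} - {a}). \<phi> a R) / M" and \<phi>: "\<And>a R. 0 \<le> \<phi> a R"
  let ?S = "free v X"
  have "M * (\<Sum>a\<in>?S. \<Sum>b\<in>?S. (sqrt (g a) - sqrt (g b))\<^sup>2)
     \<le> 2 / 3 * (1 + 1 / 8) * (\<Sum>a\<in>?S. row_energy (ch v) ({1..q} - {a}) (\<lambda>R. sqrt (\<phi> a R)))
       + (4 + 3 / (1 / 8)) * (\<Sum>a\<in>?S. \<Sum>b\<in>?S - {a}. \<Sum>R\<in>injs (ch v) ({1..q} - {a} - {b}). (sqrt (\<phi> a R) - sqrt (\<phi> b R))\<^sup>2)"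
    by (rule sqrt_mean_increments_le[OF finite_ch _ _ _ _ _ _ M \<phi> g])
      (use card_ch(2)[OF v] \<Delta>2 q card_free_path[OF \<Delta>2 v, of X] in \<open>auto simp: free_def\<close>)
  then show "M * (\<Sum>a\<in>?S. \<Sum>b\<in>?S. (sqrt (g a) - sqrt (g b))\<^sup>2)
     \<le> 3 / 4 * (\<Sum>a\<in>?S. row_energy (ch v) ({1..q} - {a}) (\<lambda>R. sqrt (\<phi> a R)))
       + 28 * (\<Sum>a\<in>?S. \<Sum>b\<in>?S - {a}. \<Sum>R\<in>injs (ch v) ({1..q} - {a} - {b}). (sqrt (\<phi> a R) - sqrt (\<phi> b R))\<^sup>2)"
    by simp
qed auto

text \<open>The deviation of the square root of the deep average is kept and fed into
  \<open>row_poincare\<close> directly. A row is then charged only with the block energies of its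
  own children, each edge is counted once, and no depth appears.\<close>

lemma ent_below_le_path:
  assumes F: "\<And>X. 0 < F X" and "v \<in> insert r W"
  shows "ent (below v) F \<le> 4 * real q ^ \<Delta> * star_const \<Delta> q * (\<Sum>f\<in>below v. block_energy sqrt F f)"
  using assms(2)
proof (induction "card (below v)" arbitrary: v rule: less_induct)
  case less
  let ?C = "4 * real q ^ \<Delta> * star_const \<Delta> q" and ?b = "block_energy sqrt F"
  have S0: "0 \<le> star_const \<Delta> q" unfolding star_const_def by simp
  have "ent (below v) F \<le> (\<Sum>u\<in>ch v. ent (below u) F) + 4 * real q ^ \<Delta> *
      (\<Sum>X\<in>Om. (sqrt (cex (deep v) F X) - cex (below v) (\<lambda>X. sqrt (cex (deep v) F X)) X)\<^sup>2)"
    by (rule ent_below_le[OF less.prems F])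
  also have "(\<Sum>X\<in>Om. (sqrt (cex (deep v) F X) - cex (below v) (\<lambda>X. sqrt (cex (deep v) F X)) X)\<^sup>2)
      \<le> star_const \<Delta> q * (\<Sum>u\<in>ch v. energy (insert u (below u)) u (\<lambda>X. sqrt (cex (deep v) F X)))"
    unfolding star_const_def
    by (rule row_poincare[OF less.prems]) (intro arg_cong[of _ _ sqrt] cex_deep_inv)
  also have "\<dots> \<le> star_const \<Delta> q * (\<Sum>u\<in>ch v. ?b u)"
    using energy_deep_le_block[where G=sqrt and F=F] F less_imp_le by (intro mult_left_mono[OF _ S0] sum_mono) blast
  also have "(\<Sum>u\<in>ch v. ent (below u) F) \<le> (\<Sum>u\<in>ch v. ?C * (\<Sum>f\<in>below u. ?b f))"
  proof (rule sum_mono)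
    fix u assume u: "u \<in> ch v"
    have "below u \<subset> below v" using below_subset_below[of u v] ch_below u not_below_self by blast
    then show "ent (below u) F \<le> ?C * (\<Sum>f\<in>below u. ?b f)"
      using less.hyps[of u] psubset_card_mono[OF finite_below] u ch_subset by blast
  qed
  finally have "ent (below v) F \<le> (\<Sum>u\<in>ch v. ?C * (\<Sum>f\<in>below u. ?b f)) + ?C * (\<Sum>u\<in>ch v. ?b u)"
    by (simp add: mult.assoc mult_left_mono)
  then show ?case unfolding sum_below[of _ v] by (simp add: sum.distrib sum_distrib_left distrib_left)
qed

lemma ent_le_path:
  assumes \<Delta>2: "\<Delta> = 2" and F: "\<And>X. 0 < F X"
  shows "ent W F \<le> path_const \<Delta> q * (2 * q) * (\<Sum>v\<in>W. ent {v} F)"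
proof -
  have S0: "0 \<le> star_const \<Delta> q" unfolding star_const_def by simp
  have "ent W F \<le> 4 * real q ^ \<Delta> * star_const \<Delta> q * (\<Sum>f\<in>W. block_energy sqrt F f)"
    using ent_below_le_path[OF F, of r] by (simp add: below_root)
  also have "(\<Sum>f\<in>W. block_energy sqrt F f) \<le> 28 / (1 - 3 / 4) * (\<Sum>f\<in>W. site_energy sqrt F f)"
    using block_energy_le_site_energy[of sqrt F "3 / 4" 28 r] block_recursion_path[OF \<Delta>2 _ F[THEN less_imp_le]]
    by (simp add: below_root)
  also have "(\<Sum>f\<in>W. site_energy sqrt F f) \<le> (\<Sum>f\<in>W. 2 * q * ent {f} F)"
    using F site_energy_le_ent unfolding site_energy_def by (intro sum_mono) auto
  finally have "ent W F \<le> 4 * real q ^ \<Delta> * star_const \<Delta> q * (28 / (1 - 3 / 4) * (\<Sum>f\<in>W. 2 * q * ent {f} F))"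
    using S0 by (simp add: mult_left_mono)
  then show ?thesis unfolding path_const_def sum_distrib_left[symmetric] by (simp only: mult.assoc)
qed

end

section \<open>From entropy to mixing\<close>

lemma sum_xlnx_ge_mean:
  fixes x w :: "'b \<Rightarrow> real"
  assumes "finite I" and w: "\<And>i. i \<in> I \<Longrightarrow> 0 \<le> w i" "(\<Sum>i\<in>I. w i) = 1" and x: "\<And>i. i \<in> I \<Longrightarrow> 0 < x i"
  shows "(\<Sum>i\<in>I. w i * x i) * ln (\<Sum>i\<in>I. w i * x i) \<le> (\<Sum>i\<in>I. w i * (x i * ln (x i)))"
proof -
  let ?m = "\<Sum>i\<in>I. w i * x i"
  obtain j where j: "j \<in> I" "w j > 0"
    using w assms(1) by (metis less_eq_real_def sum.neutral zero_neq_one)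
  have m: "0 < ?m"
    using j w x assms(1) by (intro sum_pos2[of I j]) (auto intro: mult_nonneg_nonneg less_imp_le)
  have "0 = (\<Sum>i\<in>I. w i * (x i - ?m))"
    using w by (simp add: right_diff_distrib sum_subtractf flip: sum_distrib_right)
  also have "\<dots> \<le> (\<Sum>i\<in>I. w i * (x i * ln (x i) - x i * ln ?m))"
  proof (intro sum_mono mult_left_mono w)
    fix i assume i: "i \<in> I"
    have "x i - ?m = x i * (1 - 1 / (x i / ?m))" using x[OF i] m by (simp add: field_simps)
    also have "\<dots> \<le> x i * ln (x i / ?m)"
      using x[OF i] m by (intro mult_left_mono ln_ge_one_minus_inverse) auto
    finally show "x i - ?m \<le> x i * ln (x i) - x i * ln ?m"
      using x[OF i] m by (simp add: ln_div right_diff_distrib)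
  qed
  also have "\<dots> = (\<Sum>i\<in>I. w i * (x i * ln (x i))) - ?m * ln ?m"
    by (simp add: right_diff_distrib sum_subtractf sum_distrib_right mult.assoc)
  finally show ?thesis by simp
qed

lemma mean_xlnx_le:
  fixes x :: "'b \<Rightarrow> real"
  assumes "finite I" "I \<noteq> {}" and x: "\<And>i. i \<in> I \<Longrightarrow> 0 < x i"
  shows "((\<Sum>i\<in>I. x i) / card I) * ln ((\<Sum>i\<in>I. x i) / card I) \<le> (\<Sum>i\<in>I. x i * ln (x i)) / card I"
  using sum_xlnx_ge_mean[of I "\<lambda>_. 1 / real (card I)" x] assms by (simp add: sum_divide_distrib)

lemma two_point_xlnx:
  fixes x y p :: real
  assumes "0 < x" "0 < y" "0 \<le> p" "p \<le> 1"
  shows "(p * x + (1 - p) * y) * ln (p * x + (1 - p) * y) \<le> p * (x * ln x) + (1 - p) * (y * ln y)"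
  using sum_xlnx_ge_mean[of UNIV "\<lambda>b. if b then p else 1 - p" "\<lambda>b. if b then x else y"] assms
  by (simp add: UNIV_bool add.commute)

section \<open>One Glauber step: entropy decay and reversibility\<close>

context col_graph
begin

definition upd :: "'i \<Rightarrow> nat \<Rightarrow> ('i \<Rightarrow> nat) \<Rightarrow> 'i \<Rightarrow> nat" where
  "upd e c X = (if \<exists>e'\<in>W. adj e e' \<and> X e' = c then X else X(e := c))"

definition gstep :: "('i \<Rightarrow> nat) \<Rightarrow> ('i \<Rightarrow> nat) pmf" where
  "gstep X = do { e \<leftarrow> pmf_of_set W; c \<leftarrow> pmf_of_set {1..q}; return_pmf (upd e c X) }"

text \<open>The transition operator on functions. Because the step is symmetric, it also propagates
  the law of the chain (\<open>pmf_chain_law_Suc\<close>).\<close>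

definition avg_upd :: "(('i \<Rightarrow> nat) \<Rightarrow> real) \<Rightarrow> ('i \<Rightarrow> nat) \<Rightarrow> real" where
  "avg_upd F X = (\<Sum>e\<in>W. (\<Sum>c\<in>{1..q}. F (upd e c X)) / q) / card W"

lemma upd_legal:
  assumes "e \<in> W" "Y \<in> Om" "c \<in> {1..q}"
  shows "upd e c Y = (if c \<in> legal {e} e Y then move {e} e c Y else Y)"
  using assms unfolding upd_def legal_single[OF assms(1,2)] move_single[OF assms(2)] by auto

lemma upd_Om: "e \<in> W \<Longrightarrow> Y \<in> Om \<Longrightarrow> c \<in> {1..q} \<Longrightarrow> upd e c Y \<in> Om"
  unfolding upd_legal by (auto simp: legal_def)

text \<open>A uniform color is legal with probability \<open>card (fiber {e} Y) / q\<close> and is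
  then uniform on the fiber; otherwise nothing happens. An update at e is thus a lazy heat-bath
  step.\<close>

lemma sum_upd:
  assumes e: "e \<in> W" and Y: "Y \<in> Om"
  shows "(\<Sum>c\<in>{1..q}. F (upd e c Y)) = real (card (fiber {e} Y)) * cex {e} F Y + (real q - card (fiber {e} Y)) * F Y"
proof -
  let ?L = "legal {e} e Y"
  have L: "?L \<subseteq> {1..q}" unfolding legal_def by auto
  note sf = fiber_self[OF Y, of "{e}"]
  have card: "card ?L = card (fiber {e} Y)" using card_legal_single[OF e sf] by simp
  have "(\<Sum>c\<in>{1..q}. F (upd e c Y)) = (\<Sum>c\<in>{1..q} - ?L. F (upd e c Y)) + (\<Sum>c\<in>?L. F (upd e c Y))"
    using L by (intro sum.subset_diff) auto
  also have "(\<Sum>c\<in>{1..q} - ?L. F (upd e c Y)) = (\<Sum>c\<in>{1..q} - ?L. F Y)"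
    by (intro sum.cong refl) (simp add: upd_legal[OF e Y])
  also have "\<dots> = (real q - card (fiber {e} Y)) * F Y"
    using L card card_mono[OF _ L] by (simp add: card_Diff_subset finite_subset[OF L] of_nat_diff)
  also have "(\<Sum>c\<in>?L. F (upd e c Y)) = (\<Sum>c\<in>?L. F (move {e} e c Y))"
    using L by (intro sum.cong refl) (auto simp: upd_legal[OF e Y])
  also have "\<dots> = (\<Sum>Z\<in>fiber {e} Y. F Z)"
    unfolding legal_single_fiber(2)[OF e sf, symmetric] by (simp add: sum.reindex[OF legal_single_fiber(1)[OF e sf]])
  also have "\<dots> = real (card (fiber {e} Y)) * cex {e} F Y" unfolding cex_def using card_fiber_pos[OF Y, of "{e}"] by simp
  finally show ?thesis by simp
qed

text \<open>Convexity of x ln x is used for the choice of the edge, for the lazy choice and inside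
  the fiber. A heat-bath step happens with probability at least 1/q, so an update at e removes at
  least the share 1/q of \<open>ent {e} F\<close>.\<close>

lemma ent_avg_upd_le:
  assumes W: "W \<noteq> {}" and q: "q \<ge> 1" and F: "\<And>X. X \<in> Om \<Longrightarrow> 0 < F X"
  shows "(\<Sum>X\<in>Om. avg_upd F X * ln (avg_upd F X))
    \<le> (\<Sum>X\<in>Om. F X * ln (F X)) - (\<Sum>e\<in>W. ent {e} F) / (card W * q)"
proof -
  let ?p = "\<lambda>x::real. x * ln x"
  have cW: "card W > 0" using W finite_W by (simp add: card_gt_0_iff)
  define P where "P e X = (\<Sum>c\<in>{1..q}. F (upd e c X)) / q" for e X
  have Ppos: "0 < P e X" if "e \<in> W" "X \<in> Om" for e X
    unfolding P_def using that q F upd_Om by (intro divide_pos_pos sum_pos) auto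
  have one: "(\<Sum>X\<in>Om. ?p (P e X)) \<le> (\<Sum>X\<in>Om. ?p (F X)) - ent {e} F / q" if e: "e \<in> W" for e
  proof -
    let ?k = "\<lambda>X. real (card (fiber {e} X))"
    have "?p (P e X) \<le> ?p (F X) - ?k X / q * (?p (F X) - ?p (cex {e} F X))" if X: "X \<in> Om" for X
    proof -
      have "P e X = ?k X / q * cex {e} F X + (1 - ?k X / q) * F X"
        unfolding P_def sum_upd[OF e X] using q by (simp add: field_simps)
      then have "?p (P e X) \<le> ?k X / q * ?p (cex {e} F X) + (1 - ?k X / q) * ?p (F X)"
        using two_point_xlnx[of "cex {e} F X" "F X" "?k X / q"] F[OF X] cex_pos[OF X F] card_fiber_single_le[OF e X] q
        by simp
      then show ?thesis by (simp add: algebra_simps)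
    qed
    then have "(\<Sum>X\<in>Om. ?p (P e X)) \<le> (\<Sum>X\<in>Om. ?p (F X) - ?k X / q * (?p (F X) - ?p (cex {e} F X)))"
      by (rule sum_mono)
    also have "\<dots> = (\<Sum>X\<in>Om. ?p (F X)) - (\<Sum>X\<in>Om. ?k X * (?p (F X) - ?p (cex {e} F X))) / q"
      by (simp add: sum_subtractf sum_divide_distrib)
    finally have le: "(\<Sum>X\<in>Om. ?p (P e X))
        \<le> (\<Sum>X\<in>Om. ?p (F X)) - (\<Sum>X\<in>Om. ?k X * (?p (F X) - ?p (cex {e} F X))) / q" .
    \<comment> \<open>The factor \<open>?k X\<close> is at least 1 but the summands may be negative.
      It is constant on fibers, however, and there the entropy terms add up to something
      nonnegative.\<close>
    have "ent {e} F \<le> (\<Sum>X\<in>Om. ?k X * (?p (F X) - ?p (cex {e} F X)))"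
      unfolding ent_def
    proof (rule sum_le_fiberwise[where A="{e}"])
      fix X assume X: "X \<in> Om"
      let ?I = "fiber {e} X"
      have k: "?k X \<ge> 1" using card_fiber_pos[OF X, of "{e}"] by linarith
      have "?p (cex {e} F X) \<le> (\<Sum>Y\<in>?I. ?p (F Y)) / card ?I"
        unfolding cex_def by (rule mean_xlnx_le[OF finite_fiber fiber_nonempty[OF X]]) (use F fiber_subset in blast)
      then have "?k X * ?p (cex {e} F X) \<le> (\<Sum>Y\<in>?I. ?p (F Y))"
        using k by (simp add: pos_le_divide_eq mult.commute)
      then have "0 \<le> (\<Sum>Y\<in>?I. ?p (F Y) - ?p (cex {e} F Y))"
        by (simp add: sum_subtractf cex_eq cong: sum.cong)
      then have "1 * (\<Sum>Y\<in>?I. ?p (F Y) - ?p (cex {e} F Y)) \<le> ?k X * (\<Sum>Y\<in>?I. ?p (F Y) - ?p (cex {e} F Y))"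
        using k by (intro mult_right_mono)
      also have "\<dots> = (\<Sum>Y\<in>?I. ?k Y * (?p (F Y) - ?p (cex {e} F Y)))"
        by (simp add: sum_distrib_left fiber_eq cong: sum.cong)
      finally show "(\<Sum>Y\<in>?I. ?p (F Y) - ?p (cex {e} F Y)) \<le> (\<Sum>Y\<in>?I. ?k Y * (?p (F Y) - ?p (cex {e} F Y)))" by simp
    qed
    then have "ent {e} F / q \<le> (\<Sum>X\<in>Om. ?k X * (?p (F X) - ?p (cex {e} F X))) / q"
      by (intro divide_right_mono) auto
    then show ?thesis using le by linarith
  qed
  have "(\<Sum>X\<in>Om. ?p (avg_upd F X)) \<le> (\<Sum>X\<in>Om. (\<Sum>e\<in>W. ?p (P e X)) / card W)"
    unfolding avg_upd_def P_def[symmetric] by (intro sum_mono mean_xlnx_le finite_W W Ppos)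
  also have "\<dots> = (\<Sum>e\<in>W. \<Sum>X\<in>Om. ?p (P e X)) / card W"
    unfolding sum_divide_distrib[symmetric] by (subst sum.swap) simp
  also have "\<dots> \<le> (\<Sum>e\<in>W. (\<Sum>X\<in>Om. ?p (F X)) - ent {e} F / q) / card W"
    using one by (intro divide_right_mono sum_mono) auto
  also have "\<dots> = (\<Sum>X\<in>Om. ?p (F X)) - (\<Sum>e\<in>W. ent {e} F) / (card W * q)"
    using cW by (simp add: sum_subtractf diff_divide_distrib sum_divide_distrib[symmetric] mult.commute)
  finally show ?thesis .
qed

lemma set_chain_law:
  assumes W: "W \<noteq> {}" and q: "q \<ge> 1" and x: "x \<in> Om"
  shows "set_pmf (chain_law gstep x t) \<subseteq> Om"
proof (induction t)
  case (Suc t)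
  have "set_pmf (gstep X) \<subseteq> Om" if "X \<in> Om" for X
    unfolding gstep_def using W q finite_W upd_Om that by (auto simp: set_pmf_of_set)
  then show ?case using Suc by auto
qed (use x in auto)

text \<open>A step at e from X to another coloring Y must use the color \<open>Y e\<close>. The
  reverse step uses \<open>X e\<close>, which is legal since X is proper and agrees with Y off
  e.\<close>

lemma sum_upd_symmetric:
  assumes e: "e \<in> W" and X: "X \<in> Om" and Y: "Y \<in> Om"
  shows "(\<Sum>c\<in>{1..q}. if upd e c X = Y then 1 else 0 :: real) = (\<Sum>c\<in>{1..q}. if upd e c Y = X then 1 else 0)"
proof (cases "X = Y")
  case False
  have imp: "upd e (X e) Y = X" if X: "X \<in> Om" and Y: "Y \<in> Om" and "upd e c X = Y" "X \<noteq> Y" for X Y c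
  proof -
    have XY: "Y = X(e := c)" using that(3,4) unfolding upd_def by (auto split: if_splits)
    have "Y e' \<noteq> X e" if "e' \<in> W" "adj e e'" for e'
    proof -
      have "e' \<noteq> e" using that adj_irrefl by auto
      then show ?thesis using Om_neq[OF X e that] unfolding XY by simp
    qed
    then have "\<not> (\<exists>e'\<in>W. adj e e' \<and> Y e' = X e)" by blast
    then have "upd e (X e) Y = Y(e := X e)" unfolding upd_def by (simp only: if_False)
    then show ?thesis unfolding XY by simp
  qed
  have c: "c = Y e" if "upd e c X = Y" "X \<noteq> Y" for X Y c
    using that unfolding upd_def by (auto split: if_splits)
  have one: "(\<Sum>c\<in>{1..q}. if upd e c X = Y then 1 else 0 :: real) = (if upd e (Y e) X = Y then 1 else 0)"
    if "X \<noteq> Y" "Y \<in> Om" for X Y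
  proof -
    have "(\<Sum>c\<in>{1..q}. if upd e c X = Y then 1 else 0 :: real)
        = (\<Sum>c\<in>{1..q}. if c = Y e then (if upd e (Y e) X = Y then 1 else 0) else 0)"
      using c[of _ X Y] that(1) by (intro sum.cong) auto
    then show ?thesis using Om_mem[OF that(2) e] by simp
  qed
  have "upd e (Y e) X = Y \<longleftrightarrow> upd e (X e) Y = X"
    using imp[OF X Y, of "Y e"] imp[OF Y X, of "X e"] False by auto
  then show ?thesis using one[OF False Y] one[OF False[symmetric] X] by simp
qed simp

lemma pmf_gstep:
  assumes "W \<noteq> {}" "q \<ge> 1"
  shows "pmf (gstep X) Y = (\<Sum>e\<in>W. (\<Sum>c\<in>{1..q}. if upd e c X = Y then 1 else 0) / q) / card W"
  unfolding gstep_def using assms finite_W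
  by (simp add: pmf_bind_pmf_of_set indicator_def of_bool_def)

lemma pmf_chain_law_Suc:
  assumes W: "W \<noteq> {}" and q: "q \<ge> 1" and x: "x \<in> Om" and Y: "Y \<in> Om"
  shows "pmf (chain_law gstep x (Suc t)) Y = avg_upd (pmf (chain_law gstep x t)) Y"
proof -
  let ?p = "pmf (chain_law gstep x t)"
  have "pmf (chain_law gstep x (Suc t)) Y = (\<integral>X. pmf (gstep X) Y \<partial>chain_law gstep x t)"
    by (simp add: pmf_bind)
  also have "\<dots> = (\<Sum>X\<in>Om. pmf (gstep X) Y * ?p X)"
    using set_chain_law[OF W q x, of t] by (intro integral_measure_pmf_real finite_Om) auto
  also have "\<dots> = (\<Sum>X\<in>Om. ((\<Sum>e\<in>W. (\<Sum>c\<in>{1..q}. if upd e c Y = X then 1 else 0) / q) / card W) * ?p X)"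
    unfolding pmf_gstep[OF W q] using sum_upd_symmetric[OF _ _ Y] by (intro sum.cong refl) simp
  also have "\<dots> = (\<Sum>X\<in>Om. \<Sum>e\<in>W. \<Sum>c\<in>{1..q}. (if upd e c Y = X then ?p X else 0) / q / card W)"
    unfolding sum_distrib_right sum_divide_distrib by (intro sum.cong refl) simp
  also have "\<dots> = (\<Sum>e\<in>W. \<Sum>c\<in>{1..q}. \<Sum>X\<in>Om. (if upd e c Y = X then ?p X else 0) / q / card W)"
    by (rule trans[OF sum.swap], rule sum.cong[OF refl], rule sum.swap)
  also have "\<dots> = (\<Sum>e\<in>W. \<Sum>c\<in>{1..q}. ?p (upd e c Y) / q / card W)"
    using upd_Om[OF _ Y] finite_Om by (intro sum.cong refl) (simp add: sum_divide_distrib[symmetric])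
  also have "\<dots> = avg_upd ?p Y" unfolding avg_upd_def by (simp add: sum_divide_distrib)
  finally show ?thesis .
qed

section \<open>Entropy and total variation distance\<close>

lemma tv_dist_le_sum:
  assumes "finite S" "set_pmf p \<subseteq> S" "set_pmf p' \<subseteq> S"
  shows "tv_dist p p' \<le> (\<Sum>X\<in>S. \<bar>pmf p X - pmf p' X\<bar>)"
  unfolding tv_dist_def
proof (rule cSUP_least)
  fix A
  have prob: "measure_pmf.prob r A = (\<Sum>X\<in>A \<inter> S. pmf r X)" if "set_pmf r \<subseteq> S" for r
  proof -
    have "measure_pmf.prob r A = measure_pmf.prob r (A \<inter> S)"
      using that by (intro measure_prob_cong_0) (auto simp: set_pmf_eq)
    then show ?thesis using assms(1) by (simp add: measure_measure_pmf_finite)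
  qed
  have "\<bar>measure_pmf.prob p A - measure_pmf.prob p' A\<bar> = \<bar>\<Sum>X\<in>A \<inter> S. pmf p X - pmf p' X\<bar>"
    using prob[OF assms(2)] prob[OF assms(3)] by (simp add: sum_subtractf)
  also have "\<dots> \<le> (\<Sum>X\<in>A \<inter> S. \<bar>pmf p X - pmf p' X\<bar>)" by (rule sum_abs)
  also have "\<dots> \<le> (\<Sum>X\<in>S. \<bar>pmf p X - pmf p' X\<bar>)" using assms(1) by (intro sum_mono2) auto
  finally show "\<bar>measure_pmf.prob p A - measure_pmf.prob p' A\<bar> \<le> (\<Sum>X\<in>S. \<bar>pmf p X - pmf p' X\<bar>)" .
qed simp

text \<open>The comparison passes through the Hellinger distance.\<close>

lemma sum_abs_le_entropy:
  fixes H :: "'b \<Rightarrow> real"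
  assumes I: "finite I" "I \<noteq> {}" and pos: "\<And>i. i \<in> I \<Longrightarrow> 0 < H i" and mean: "(\<Sum>i\<in>I. H i) = card I"
  shows "(\<Sum>i\<in>I. \<bar>H i - 1\<bar>)\<^sup>2 \<le> 8 * real (card I) * (\<Sum>i\<in>I. H i * ln (H i))"
proof -
  let ?n = "real (card I)"
  have n: "?n > 0" using I by (simp add: card_gt_0_iff)
  define s where "s = (\<Sum>i\<in>I. sqrt (H i)) / card I"
  have S: "(\<Sum>i\<in>I. sqrt (H i)) = ?n * s" unfolding s_def using n by simp
  have sq: "(\<Sum>i\<in>I. (sqrt (H i))\<^sup>2) = ?n"
    unfolding mean[symmetric] using pos by (intro sum.cong refl) (simp add: less_imp_le)
  have "s\<^sup>2 \<le> (\<Sum>i\<in>I. (sqrt (H i))\<^sup>2) / card I" unfolding s_def by (rule jensen_square_mean[OF I])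
  then have "s\<^sup>2 \<le> 1" unfolding sq using n by simp
  then have s1: "s \<le> 1" using power2_le_imp_le[of s 1] by simp
  have s0: "0 \<le> s" unfolding s_def using pos by (intro divide_nonneg_nonneg sum_nonneg) (auto intro: less_imp_le)
  \<comment> \<open>\<open>s\<close> is the Hellinger affinity of H with the constant 1. From 0
    \<le> s \<le> 1 it follows that \<open>1 - s\<close> is at most \<open>1 - s\<^sup>2\<close>,
    the variance of the roots.\<close>
  have "?n * (1 - s) \<le> ?n * (1 - s\<^sup>2)"
    using n s0 s1 by (intro mult_left_mono) (auto simp: power2_eq_square intro: mult_left_le)
  also have "\<dots> = (\<Sum>i\<in>I. (sqrt (H i) - s)\<^sup>2)"
    unfolding sum_square_dev[OF I s_def] sq by (simp add: algebra_simps)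
  also have "\<dots> \<le> (\<Sum>i\<in>I. H i * ln (H i)) - card I * (1 * ln 1)"
    by (rule sqrt_dev_le_sum_xlnx[OF I pos _ s_def]) (use mean n in auto)
  finally have ns: "?n * (1 - s) \<le> (\<Sum>i\<in>I. H i * ln (H i))" by simp
  have "(\<Sum>i\<in>I. (sqrt (H i) - 1)\<^sup>2) = 2 * (?n * (1 - s))"
  proof -
    have "(sqrt (H i) - 1)\<^sup>2 = (sqrt (H i))\<^sup>2 - 2 * sqrt (H i) + 1" for i
      by (simp add: power2_diff)
    then show ?thesis
      by (simp only: sum.distrib sum_subtractf sum_distrib_left[symmetric] sq S) (simp add: algebra_simps)
  qed
  then have A: "(\<Sum>i\<in>I. (sqrt (H i) - 1)\<^sup>2) \<le> 2 * (\<Sum>i\<in>I. H i * ln (H i))" using ns by simp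
  have "(\<Sum>i\<in>I. (sqrt (H i) + 1)\<^sup>2) \<le> (\<Sum>i\<in>I. 2 * (H i + 1))"
  proof (rule sum_mono)
    fix i assume "i \<in> I"
    then show "(sqrt (H i) + 1)\<^sup>2 \<le> 2 * (H i + 1)"
      using square_diff_le[of "sqrt (H i)" "-1"] pos[of i] by (simp add: less_imp_le)
  qed
  also have "\<dots> = 4 * ?n" using mean by (simp add: sum.distrib flip: sum_distrib_left)
  finally have B: "(\<Sum>i\<in>I. (sqrt (H i) + 1)\<^sup>2) \<le> 4 * ?n" .
  have "(\<Sum>i\<in>I. \<bar>H i - 1\<bar>) = (\<Sum>i\<in>I. \<bar>sqrt (H i) - 1\<bar> * \<bar>sqrt (H i) + 1\<bar>)"
  proof (rule sum.cong[OF refl])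
    fix i assume "i \<in> I"
    then have "H i - 1 = (sqrt (H i) - 1) * (sqrt (H i) + 1)"
      using pos[of i] by (simp add: algebra_simps)
    then show "\<bar>H i - 1\<bar> = \<bar>sqrt (H i) - 1\<bar> * \<bar>sqrt (H i) + 1\<bar>" by (simp add: abs_mult)
  qed
  also have "\<dots> \<le> L2_set (\<lambda>i. sqrt (H i) - 1) I * L2_set (\<lambda>i. sqrt (H i) + 1) I" by (rule L2_set_mult_ineq)
  finally have "(\<Sum>i\<in>I. \<bar>H i - 1\<bar>)\<^sup>2 \<le> (L2_set (\<lambda>i. sqrt (H i) - 1) I * L2_set (\<lambda>i. sqrt (H i) + 1) I)\<^sup>2"
    by (intro power_mono sum_nonneg) auto
  also have "\<dots> = (\<Sum>i\<in>I. (sqrt (H i) - 1)\<^sup>2) * (\<Sum>i\<in>I. (sqrt (H i) + 1)\<^sup>2)"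
    by (simp add: power_mult_distrib L2_set_def sum_nonneg)
  also have "\<dots> \<le> (2 * (\<Sum>i\<in>I. H i * ln (H i))) * (4 * ?n)"
    using A B sum_nonneg[of I "\<lambda>i. (sqrt (H i) - 1)\<^sup>2"] by (intro mult_mono) (auto intro: sum_nonneg)
  finally show ?thesis by (simp add: mult_ac)
qed

text \<open>Each step contracts the entropy of the density by the factor \<open>1 - \<beta>\<close>.
  Initially it is at most \<open>card W * ln q\<close> per coloring, which is why only the logarithm
  of this quantity enters the time.\<close>

lemma mixing_from_entropy_decay:
  fixes \<alpha> :: real
  assumes W: "W \<noteq> {}" and q: "q \<ge> 3" and \<alpha>: "\<alpha> > 0"
    and ATE: "\<And>F. (\<And>X. 0 < F X) \<Longrightarrow> ent W F \<le> \<alpha> * (\<Sum>e\<in>W. ent {e} F)"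
    and x: "x \<in> Om" and t: "real t \<ge> \<alpha> * (card W * q) * ln (512 * card W * ln q)"
  shows "tv_dist (chain_law gstep x t) (pmf_of_set Om) \<le> 1 / 4"
proof -
  let ?n = "real (card Om)" and ?N = "real (card W)"
  have q1: "q \<ge> 1" using q by simp
  have N: "?N \<ge> 1" using W finite_W by (simp add: Suc_le_eq card_gt_0_iff)
  have lnq: "ln (real q) > 0" using q by simp
  have Ome: "Om \<noteq> {}" using x by auto
  then have n: "?n \<ge> 1" using finite_Om by (simp add: Suc_le_eq card_gt_0_iff)
  \<comment> \<open>The density is averaged with the constant 1 because tensorization is available
    for strictly positive functions only. This commutes with the step and halves the distance to
    uniformity.\<close>
  define H where "H t X = 1 / 2 + ?n / 2 * pmf (chain_law gstep x t) X" for t X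
  define S where "S t = (\<Sum>X\<in>Om. H t X * ln (H t X))" for t
  define \<beta> where "\<beta> = 1 / (\<alpha> * (?N * q))"
  have \<beta>: "\<beta> > 0" unfolding \<beta>_def using \<alpha> N q by simp
  have pos: "0 < H t X" for t X unfolding H_def using n by (intro add_pos_nonneg) auto
  have "(\<Sum>X\<in>Om. pmf (chain_law gstep x t) X) = 1" for t
    by (rule sum_pmf_eq_1[OF finite_Om set_chain_law[OF W q1 x]])
  then have mean: "(\<Sum>X\<in>Om. H t X) = ?n" for t
    unfolding H_def sum.distrib sum_distrib_left[symmetric] by simp
  have step: "H (Suc t) X = avg_upd (H t) X" if X: "X \<in> Om" for t X
    unfolding H_def pmf_chain_law_Suc[OF W q1 x X] avg_upd_def using q N
    by (simp add: sum.distrib add_divide_distrib sum_divide_distrib sum_distrib_left mult.assoc)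
  have S_ent: "ent W (H t) = S t" for t
  proof -
    have "cex W (H t) X = 1" for X unfolding cex_def fiber_all mean using n by simp
    then show ?thesis unfolding ent_def S_def by simp
  qed
  have S0: "0 \<le> S t" for t
  proof -
    have "0 \<le> (\<Sum>X\<in>Om. \<bar>H t X - 1\<bar>)\<^sup>2" by simp
    also have "\<dots> \<le> 8 * ?n * S t"
      unfolding S_def by (rule sum_abs_le_entropy[OF finite_Om Ome pos mean])
    finally show ?thesis using n by (simp add: zero_le_mult_iff)
  qed
  have "S (Suc t) \<le> (1 - \<beta>) * S t" for t
  proof -
    have "S (Suc t) = (\<Sum>X\<in>Om. avg_upd (H t) X * ln (avg_upd (H t) X))"
      unfolding S_def using step by (intro sum.cong) auto
    also have "\<dots> \<le> S t - (\<Sum>e\<in>W. ent {e} (H t)) / (card W * q)"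
      unfolding S_def by (rule ent_avg_upd_le[OF W q1]) (rule pos)
    also have "\<dots> \<le> S t - \<beta> * S t"
    proof -
      have "S t \<le> \<alpha> * (\<Sum>e\<in>W. ent {e} (H t))" using ATE[of "H t"] pos S_ent[of t] by simp
      then have "\<beta> * S t \<le> \<beta> * (\<alpha> * (\<Sum>e\<in>W. ent {e} (H t)))" using \<beta> by (intro mult_left_mono) auto
      also have "\<dots> = (\<Sum>e\<in>W. ent {e} (H t)) / (card W * q)" unfolding \<beta>_def using \<alpha> N q by simp
      finally show ?thesis by simp
    qed
    finally show ?thesis by (simp add: algebra_simps)
  qed
  then have dec: "S (Suc t) \<le> exp (- \<beta>) * S t" for t
    using mult_right_mono[OF _ S0[of t], of "1 - \<beta>" "exp (- \<beta>)"] exp_ge_add_one_self[of "- \<beta>"]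
    by (smt (verit))
  have decay: "S t \<le> exp (- \<beta> * t) * S 0" for t
  proof (induction t)
    case (Suc t)
    have "S (Suc t) \<le> exp (- \<beta>) * (exp (- \<beta> * t) * S 0)"
      using dec[of t] mult_left_mono[OF Suc, of "exp (- \<beta>)"] exp_ge_zero[of "- \<beta>"] by linarith
    also have "\<dots> = exp (- \<beta> * Suc t) * S 0" by (simp add: algebra_simps flip: exp_add)
    finally show ?case .
  qed simp
  have init: "S 0 \<le> ?n * (?N * ln q)"
  proof -
    have H: "H 0 X \<le> ?n" for X
    proof -
      have "H 0 X \<le> 1 / 2 + ?n / 2 * 1" unfolding H_def by (intro add_left_mono mult_left_mono pmf_le_1) simp
      then show ?thesis using n by simp
    qed
    have "S 0 \<le> (\<Sum>X\<in>Om. H 0 X * ln ?n)"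
      unfolding S_def
    proof (intro sum_mono mult_left_mono)
      fix X show "ln (H 0 X) \<le> ln ?n" using H[of X] pos[of 0 X] n by (subst ln_le_cancel_iff) linarith+
      show "0 \<le> H 0 X" using pos[of 0 X] by simp
    qed
    also have "\<dots> = ?n * ln ?n" by (simp add: mean flip: sum_distrib_right)
    also have "ln ?n \<le> ln (real q ^ card W)"
    proof -
      have "card Om \<le> card (W \<rightarrow>\<^sub>E {1..q})"
        unfolding Om_def using finite_W by (intro card_mono) (auto intro: finite_PiE)
      also have "\<dots> = q ^ card W" using finite_W by (simp add: card_PiE)
      finally have "?n \<le> real q ^ card W" by (metis of_nat_le_iff of_nat_power)
      then show ?thesis using n q by (subst ln_le_cancel_iff) auto
    qed
    also have "\<dots> = ?N * ln q" using q by (simp add: ln_realpow)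
    finally show ?thesis using n by simp
  qed
  have arg: "512 * ?N * ln q > 0" using N lnq by simp
  have "S t \<le> exp (- \<beta> * t) * (?n * (?N * ln q))"
    using decay[of t] mult_left_mono[OF init exp_ge_zero[of "- \<beta> * t"]] by linarith
  also have "\<dots> \<le> 1 / (512 * ?N * ln q) * (?n * (?N * ln q))"
  proof (rule mult_right_mono)
    have "\<beta> * (\<alpha> * (?N * q) * ln (512 * ?N * ln q)) \<le> \<beta> * t" using t \<beta> by (intro mult_left_mono) auto
    also have "\<beta> * (\<alpha> * (?N * q) * ln (512 * ?N * ln q)) = ln (512 * ?N * ln q)"
      unfolding \<beta>_def using \<alpha> N q by simp
    finally have "exp (- \<beta> * t) \<le> exp (- ln (512 * ?N * ln q))" by simp
    also have "\<dots> = 1 / (512 * ?N * ln q)" using arg by (simp add: exp_minus inverse_eq_divide)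
    finally show "exp (- \<beta> * t) \<le> 1 / (512 * ?N * ln q)" .
    show "0 \<le> ?n * (?N * ln q)" using lnq by simp
  qed
  also have "\<dots> = ?n / 512" using N lnq by simp
  \<comment> \<open>512 = 8 * 64: the comparison with entropy then bounds the total deviation of H
    from 1 by \<open>?n / 8\<close>, and undoing the halving gives 1/4.\<close>
  finally have St: "S t \<le> ?n / 512" .
  have "(\<Sum>X\<in>Om. \<bar>H t X - 1\<bar>)\<^sup>2 \<le> 8 * ?n * S t"
    unfolding S_def by (rule sum_abs_le_entropy[OF finite_Om Ome pos mean])
  also have "\<dots> \<le> 8 * ?n * (?n / 512)" using St n by (intro mult_left_mono) auto
  also have "\<dots> = (?n / 8)\<^sup>2" by (simp add: power2_eq_square)
  finally have "(\<Sum>X\<in>Om. \<bar>H t X - 1\<bar>)\<^sup>2 \<le> (?n / 8)\<^sup>2" .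
  from power2_le_imp_le[OF this] have L1: "(\<Sum>X\<in>Om. \<bar>H t X - 1\<bar>) \<le> ?n / 8" using n by linarith
  have "tv_dist (chain_law gstep x t) (pmf_of_set Om) \<le> (\<Sum>X\<in>Om. \<bar>pmf (chain_law gstep x t) X - pmf (pmf_of_set Om) X\<bar>)"
    by (rule tv_dist_le_sum) (use finite_Om Ome set_chain_law[OF W q1 x] in \<open>auto simp: set_pmf_of_set\<close>)
  also have "\<dots> = (\<Sum>X\<in>Om. 2 / ?n * \<bar>H t X - 1\<bar>)"
  proof (rule sum.cong[OF refl])
    fix X assume X: "X \<in> Om"
    have "pmf (chain_law gstep x t) X - pmf (pmf_of_set Om) X = 2 / ?n * (H t X - 1)"
      unfolding H_def using X n finite_Om Ome by (simp add: field_simps)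
    then show "\<bar>pmf (chain_law gstep x t) X - pmf (pmf_of_set Om) X\<bar> = 2 / ?n * \<bar>H t X - 1\<bar>"
      using n by (simp only: abs_mult abs_divide)
  qed
  also have "\<dots> \<le> 2 / ?n * (?n / 8)"
    unfolding sum_distrib_left[symmetric] using L1 n by (intro mult_left_mono) auto
  also have "\<dots> = 1 / 4" using n by simp
  finally show ?thesis .
qed

end

section \<open>Rooted trees\<close>

lemma is_walk_append:
  "xs \<noteq> [] \<Longrightarrow> ys \<noteq> [] \<Longrightarrow> is_walk V E (xs @ ys) \<longleftrightarrow> is_walk V E xs \<and> is_walk V E ys \<and> {last xs, hd ys} \<in> E"
  unfolding is_walk_def by (auto simp: successively_append_iff)

lemma is_walk_single: "is_walk V E [x] \<longleftrightarrow> x \<in> V"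
  unfolding is_walk_def by simp

lemma is_walk_mono: "is_walk V E xs \<Longrightarrow> E \<subseteq> F \<Longrightarrow> is_walk V F xs"
  unfolding is_walk_def by (auto elim!: successively_mono)

lemma is_walk_rev: "is_walk V E xs \<Longrightarrow> is_walk V E (rev xs)"
  unfolding is_walk_def by (auto simp: insert_commute)

lemma walk_between_snoc:
  assumes "walk_between V E u xs v" "w \<in> V" "{v, w} \<in> E"
  shows "walk_between V E u (xs @ [w]) w"
proof -
  have "xs \<noteq> []" using assms unfolding walk_between_def is_walk_def by auto
  then show ?thesis using assms unfolding walk_between_def by (simp add: is_walk_append is_walk_single)
qed

lemma walk_between_rev: "walk_between V E u xs v \<Longrightarrow> walk_between V E v (rev xs) u"
  unfolding walk_between_def using is_walk_rev by (auto simp: hd_rev last_rev)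

lemma walk_between_trans:
  assumes "walk_between V E u xs v" "walk_between V E v ys w"
  shows "\<exists>zs. walk_between V E u zs w"
proof -
  have ne: "xs \<noteq> []" "ys \<noteq> []" using assms unfolding walk_between_def is_walk_def by auto
  obtain y zs where ys: "ys = y # zs" using ne(2) by (cases ys) auto
  show ?thesis
  proof (cases "zs = []")
    case True
    then have "w = v" using assms(2) ys unfolding walk_between_def by auto
    then show ?thesis using assms(1) by blast
  next
    case False
    have "is_walk V E ([y] @ zs)" using assms(2) ys unfolding walk_between_def by auto
    then have "is_walk V E zs" "{y, hd zs} \<in> E" using is_walk_append[of "[y]" zs V E] False by auto
    then have "walk_between V E u (xs @ zs) w"
      using assms ys ne False unfolding walk_between_def by (simp add: is_walk_append)
    then show ?thesis ..
  qed
qed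

lemma distinct_walk:
  assumes "walk_between V E u xs v"
  shows "\<exists>ys. walk_between V E u ys v \<and> distinct ys"
  using assms
proof (induction "length xs" arbitrary: xs rule: less_induct)
  case less
  show ?case
  proof (cases "distinct xs")
    case False
    then obtain as bs cs y where xs: "xs = as @ [y] @ bs @ [y] @ cs" using not_distinct_decomp by blast
    have w: "is_walk V E xs" "hd xs = u" "last xs = v" using less.prems unfolding walk_between_def by auto
    have "is_walk V E (as @ [y] @ cs)"
      using w(1) unfolding xs is_walk_def by (auto simp: successively_append_iff successively_Cons)
    moreover have "hd (as @ [y] @ cs) = u" using w(2) unfolding xs by (cases as) auto
    moreover have "last (as @ [y] @ cs) = v" using w(3) unfolding xs by (cases cs) auto
    ultimately have "walk_between V E u (as @ [y] @ cs) v" unfolding walk_between_def by simp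
    then show ?thesis using less.hyps[of "as @ [y] @ cs"] unfolding xs by simp
  qed (use less.prems in blast)
qed

section \<open>Parent edges and depth\<close>

locale rooted_tree =
  fixes V :: "'a set" and E :: "'a set set" and r :: 'a
  assumes tree: "is_tree V E" and r: "r \<in> V"
begin

abbreviation d :: "'a \<Rightarrow> nat" where
  "d v \<equiv> gdist V E r v"

lemma finite_V: "finite V" and edge: "e \<in> E \<Longrightarrow> e \<subseteq> V \<and> card e = 2"
  and connected: "u \<in> V \<Longrightarrow> v \<in> V \<Longrightarrow> \<exists>xs. walk_between V E u xs v" and acyclic: "\<not> is_cycle V E xs"
  using tree unfolding is_tree_def simple_graph_def connected_graph_def by auto

lemma finite_E: "finite E"
  using edge finite_V by (intro finite_subset[of E "Pow V"]) auto

lemma edge_neq: "{u, v} \<in> E \<Longrightarrow> u \<in> V \<and> v \<in> V \<and> u \<noteq> v"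
  using edge[of "{u, v}"] by (auto simp: card_insert_if)

lemma shortest_walk:
  assumes "v \<in> V"
  shows "\<exists>xs. walk_between V E r xs v \<and> length xs = Suc (d v)"
proof -
  obtain xs where xs: "walk_between V E r xs v" using connected[OF r assms] by blast
  then have "length xs = Suc (length xs - 1)" unfolding walk_between_def is_walk_def by (cases xs) auto
  with xs have "\<exists>k xs. walk_between V E r xs v \<and> length xs = Suc k" by blast
  then show ?thesis unfolding gdist_def by (rule LeastI_ex)
qed

lemma d_le: "walk_between V E r xs v \<Longrightarrow> length xs = Suc k \<Longrightarrow> d v \<le> k"
  unfolding gdist_def by (rule Least_le) blast

lemma d_root: "d r = 0"
  using d_le[of "[r]" r 0] r by (simp add: walk_between_def is_walk_single)

lemma ex_parent:
  assumes v: "v \<in> V" "v \<noteq> r"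
  shows "\<exists>u. {u, v} \<in> E \<and> Suc (d u) = d v"
proof -
  obtain xs where xs: "walk_between V E r xs v" "length xs = Suc (d v)" using shortest_walk[OF v(1)] by blast
  obtain ys y where ys: "xs = ys @ [y]" using xs(2) by (cases xs rule: rev_cases) auto
  have y: "y = v" using xs(1) unfolding ys walk_between_def by simp
  have ne: "ys \<noteq> []" using xs(1) v(2) unfolding ys walk_between_def by auto
  have "is_walk V E ys" "{last ys, v} \<in> E" "hd ys = r"
    using xs(1) ne unfolding ys walk_between_def by (auto simp: is_walk_append y)
  moreover have "length ys = Suc (length ys - 1)" using ne by (cases ys) auto
  ultimately have "d (last ys) \<le> length ys - 1" by (intro d_le[of ys]) (auto simp: walk_between_def)
  moreover have "d v \<le> Suc (d (last ys))"
  proof -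
    have u: "last ys \<in> V" using edge_neq[OF \<open>{last ys, v} \<in> E\<close>] by simp
    obtain zs where zs: "walk_between V E r zs (last ys)" "length zs = Suc (d (last ys))"
      using shortest_walk[OF u] by blast
    show ?thesis using d_le[OF walk_between_snoc[OF zs(1) v(1) \<open>{last ys, v} \<in> E\<close>]] zs(2) by simp
  qed
  moreover have "d v = length ys" using xs(2) unfolding ys by simp
  ultimately have "Suc (d (last ys)) = d v" using ne by (cases ys) auto
  then show ?thesis using \<open>{last ys, v} \<in> E\<close> by blast
qed

definition parent :: "'a \<Rightarrow> 'a" where
  "parent v = (if v = r then r else SOME u. {u, v} \<in> E \<and> Suc (d u) = d v)"

lemma parent:
  assumes "v \<in> V" "v \<noteq> r"
  shows "{parent v, v} \<in> E" "Suc (d (parent v)) = d v" "parent v \<in> V"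
proof -
  have "{parent v, v} \<in> E \<and> Suc (d (parent v)) = d v"
    using someI_ex[OF ex_parent[OF assms]] assms unfolding parent_def by simp
  then show "{parent v, v} \<in> E" "Suc (d (parent v)) = d v" "parent v \<in> V" using edge_neq by auto
qed

text \<open>At the root this is a singleton, which is not an edge.\<close>

definition up :: "'a \<Rightarrow> 'a set" where
  "up v = {v, parent v}"

lemma up_root: "up r = {r}"
  unfolding up_def parent_def by simp

lemma inj_up: "inj_on up V"
proof (rule inj_onI, rule ccontr)
  fix u v assume u: "u \<in> V" and v: "v \<in> V" and eq: "up u = up v" and uv: "u \<noteq> v"
  then have uv': "parent v = u" "parent u = v" unfolding up_def doubleton_eq_iff using uv by blast+
  have "parent r = r" unfolding parent_def by simp
  then have "u \<noteq> r" "v \<noteq> r" using uv uv' by metis+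
  then show False using parent(2)[OF u] parent(2)[OF v] unfolding uv' by simp
qed

lemma walk_to_root:
  assumes "v \<in> V"
  shows "\<exists>xs. walk_between V (up ` (V - {r})) r xs v"
  using assms
proof (induction "d v" arbitrary: v rule: less_induct)
  case less
  show ?case
  proof (cases "v = r")
    case True
    then have "walk_between V (up ` (V - {r})) r [r] v" using r by (simp add: walk_between_def is_walk_single)
    then show ?thesis ..
  next
    case False
    note p = parent[OF less.prems False]
    obtain xs where "walk_between V (up ` (V - {r})) r xs (parent v)" using less.hyps[of "parent v"] p by auto
    moreover have "{parent v, v} \<in> up ` (V - {r})"
      by (rule image_eqI[of _ _ v]) (use less.prems False in \<open>auto simp: up_def\<close>)
    ultimately have "walk_between V (up ` (V - {r})) r (xs @ [v]) v"
      using less.prems by (intro walk_between_snoc)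
    then show ?thesis ..
  qed
qed

lemma up_subset: "up ` (V - {r}) \<subseteq> E"
  using parent(1) unfolding up_def by (auto simp: insert_commute)

text \<open>Parent edges already connect all vertices. Another edge would close a simple path of
  parent edges to a cycle; that path has at least three vertices because the edge is not itself a
  parent edge.\<close>

lemma E_eq: "E = up ` (V - {r})"
proof (intro equalityI up_subset subsetI, rule ccontr)
  fix e assume e: "e \<in> E" and out: "e \<notin> up ` (V - {r})"
  obtain u v where uv: "e = {u, v}" using edge[OF e] by (auto simp: card_2_iff)
  have V: "u \<in> V" "v \<in> V" "u \<noteq> v" using edge_neq e uv by auto
  obtain xs where xs: "walk_between V (up ` (V - {r})) r xs u" using walk_to_root[OF V(1)] ..
  obtain ys where ys: "walk_between V (up ` (V - {r})) r ys v" using walk_to_root[OF V(2)] ..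
  obtain zs where "walk_between V (up ` (V - {r})) u zs v"
    using walk_between_trans[OF walk_between_rev[OF xs] ys] ..
  from distinct_walk[OF this] obtain zs where zs: "walk_between V (up ` (V - {r})) u zs v" "distinct zs" by (elim exE conjE)
  have w: "is_walk V (up ` (V - {r})) zs" "hd zs = u" "last zs = v" "zs \<noteq> []"
    using zs unfolding walk_between_def is_walk_def by auto
  have "length zs \<ge> 3"
  proof (rule ccontr)
    assume "\<not> length zs \<ge> 3"
    then consider "length zs = 0" | "length zs = 1" | "length zs = 2" by linarith
    then show False
    proof cases
      case 2 then show False using w V by (auto simp: length_Suc_conv)
    next
      case 3
      then obtain a b where "zs = [a, b]" by (auto simp: numeral_2_eq_2 length_Suc_conv)
      then show False using w out uv unfolding is_walk_def by auto
    qed (use w in auto)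
  qed
  then have "is_cycle V E zs"
    using w zs(2) is_walk_mono[OF w(1) up_subset] e uv unfolding is_cycle_def by (simp add: insert_commute)
  then show False using acyclic by blast
qed

lemma edge_cases:
  assumes "e \<in> E"
  obtains v where "v \<in> V" "v \<noteq> r" "e = up v"
  using assms E_eq by blast

lemma up_edge: "v \<in> V \<Longrightarrow> v \<noteq> r \<Longrightarrow> up v \<in> E"
  using up_subset by auto

lemma card_E: "card E + 1 = card V"
proof -
  have "card (up ` (V - {r})) = card (V - {r})" by (intro card_image inj_on_subset[OF inj_up]) auto
  then have "card E = card (V - {r})" using E_eq by simp
  then show ?thesis using finite_V r card_gt_0_iff[of V] by auto
qed

lemma edges_at:
  assumes v: "v \<in> V"
  shows "{e\<in>E. v \<in> e} = up ` {u\<in>V - {r}. parent u = v} \<union> (if v = r then {} else {up v})"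
proof -
  have *: "e \<in> up ` {u\<in>V - {r}. parent u = v} \<union> (if v = r then {} else {up v})" if e: "e \<in> E" "v \<in> e" for e
  proof -
    obtain u where u: "u \<in> V" "u \<noteq> r" "e = up u" by (rule edge_cases[OF e(1)])
    then show ?thesis using e(2) unfolding up_def by auto
  qed
  have "v \<in> up u" if "parent u = v" for u using that unfolding up_def by auto
  moreover have "v \<in> up v" unfolding up_def by auto
  ultimately have "up ` {u\<in>V - {r}. parent u = v} \<union> (if v = r then {} else {up v}) \<subseteq> {e\<in>E. v \<in> e}"
    using v up_edge by auto
  moreover have "{e\<in>E. v \<in> e} \<subseteq> up ` {u\<in>V - {r}. parent u = v} \<union> (if v = r then {} else {up v})"
    using * by blast
  ultimately show ?thesis by (rule equalityI[rotated])
qed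

lemma vdegree_eq:
  assumes v: "v \<in> V"
  shows "vdegree E v = card {u\<in>V - {r}. parent u = v} + (if v = r then 0 else 1)"
proof -
  let ?C = "{u\<in>V - {r}. parent u = v}"
  have c: "card (up ` ?C) = card ?C" by (intro card_image inj_on_subset[OF inj_up]) auto
  have "up v \<notin> up ` ?C"
  proof
    assume "up v \<in> up ` ?C"
    then obtain u where "u \<in> ?C" "up v = up u" by blast
    then have "u = v" using inj_up v by (auto dest: inj_onD)
    then show False using \<open>u \<in> ?C\<close> parent(2)[of v] by auto
  qed
  then show ?thesis unfolding vdegree_def edges_at[OF v] using c finite_V by auto
qed

text \<open>The lower endpoint of an edge, through which parent and depth are transported from
  vertices to edges.\<close>

definition low :: "'a set \<Rightarrow> 'a" where
  "low = inv_into V up"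

lemma low_up: "v \<in> V \<Longrightarrow> low (up v) = v"
  unfolding low_def by (rule inv_into_f_f[OF inj_up])

text \<open>The virtual root edge is \<open>{r} = up r\<close>, which makes
  \<open>up (parent (low e))\<close> the parent of every edge without a case distinction. Distinct
  edges meet exactly if their lower endpoints are parent and child or have the same parent.\<close>

lemma edge_tree:
  fixes \<Delta> q :: nat
  assumes \<Delta>: "2 \<le> \<Delta>" and q: "\<Delta> + 2 \<le> q" and deg: "\<And>v. v \<in> V \<Longrightarrow> vdegree E v \<le> \<Delta>"
  shows "edge_tree E adjacent_edges q {r} (\<lambda>e. up (parent (low e))) (\<lambda>e. d (low e)) \<Delta>"
proof
  show "finite E" by (rule finite_E)
  show "adjacent_edges f e" if "adjacent_edges e f" for e f :: "'a set"
    using that unfolding adjacent_edges_def by auto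
  show "\<not> adjacent_edges e e" for e :: "'a set" unfolding adjacent_edges_def by simp
  show "{r} \<notin> E" using edge[of "{r}"] by auto
  have parV: "parent v \<in> V" if "v \<in> V" for v using parent(3)[OF that] r unfolding parent_def by (cases "v = r") auto
  show "up (parent (low e)) \<in> insert {r} E" if "e \<in> E" for e
  proof -
    obtain v where v: "v \<in> V" "v \<noteq> r" "e = up v" by (rule edge_cases[OF \<open>e \<in> E\<close>])
    then show ?thesis using parV[OF v(1)] low_up[OF v(1)] up_root up_edge by (cases "parent v = r") auto
  qed
  show "d (low (up (parent (low e)))) < d (low e)" if "e \<in> E" for e
  proof -
    obtain v where v: "v \<in> V" "v \<noteq> r" "e = up v" by (rule edge_cases[OF \<open>e \<in> E\<close>])
    then show ?thesis using parent[OF v(1,2)] by (simp add: low_up)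
  qed
  show "adjacent_edges e f \<longleftrightarrow> e \<noteq> f \<and> (up (parent (low e)) = f \<or> up (parent (low f)) = e
      \<or> up (parent (low e)) = up (parent (low f)))" if ef: "e \<in> E" "f \<in> E" for e f
  proof -
    obtain u where u: "u \<in> V" "u \<noteq> r" "e = up u" by (rule edge_cases[OF ef(1)])
    obtain v where v: "v \<in> V" "v \<noteq> r" "f = up v" by (rule edge_cases[OF ef(2)])
    have eq: "up x = up y \<longleftrightarrow> x = y" if "x \<in> V" "y \<in> V" for x y using inj_up that by (auto dest: inj_onD)
    have lows: "low e = u" "low f = v" unfolding u(3) v(3) by (simp_all add: low_up u v)
    have "e \<inter> f \<noteq> {} \<longleftrightarrow> u = v \<or> parent u = v \<or> parent v = u \<or> parent u = parent v"
      unfolding u(3) v(3) up_def by auto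
    moreover have "e = f \<longleftrightarrow> u = v" unfolding u(3) v(3) by (rule eq[OF u(1) v(1)])
    moreover have "up (parent u) = f \<longleftrightarrow> parent u = v" unfolding v(3) by (rule eq[OF parV[OF u(1)] v(1)])
    moreover have "up (parent v) = e \<longleftrightarrow> parent v = u" unfolding u(3) by (rule eq[OF parV[OF v(1)] u(1)])
    moreover have "up (parent u) = up (parent v) \<longleftrightarrow> parent u = parent v"
      by (rule eq[OF parV[OF u(1)] parV[OF v(1)]])
    ultimately show ?thesis unfolding adjacent_edges_def lows by blast
  qed
  have children: "{f\<in>E. up (parent (low f)) = up v} = up ` {u\<in>V - {r}. parent u = v}" if "v \<in> V" for v
  proof -
    have "up (parent u) = up v \<longleftrightarrow> parent u = v" if "u \<in> V" for u
      using inj_up parV[OF that] \<open>v \<in> V\<close> by (auto dest: inj_onD)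
    note eq = this
    show ?thesis
    proof (intro equalityI subsetI)
      fix f assume f: "f \<in> {f\<in>E. up (parent (low f)) = up v}"
      then obtain u where u: "u \<in> V" "u \<noteq> r" "f = up u" by (blast elim: edge_cases)
      then have "parent u = v" using f eq[OF u(1)] by (simp add: low_up)
      then show "f \<in> up ` {u\<in>V - {r}. parent u = v}" using u by blast
    next
      fix f assume "f \<in> up ` {u\<in>V - {r}. parent u = v}"
      then obtain u where u: "u \<in> V" "u \<noteq> r" "parent u = v" "f = up u" by blast
      then show "f \<in> {f\<in>E. up (parent (low f)) = up v}" using up_edge[of u] by (simp add: low_up)
    qed
  qed
  have card_up: "card (up ` {u\<in>V - {r}. parent u = v}) = card {u\<in>V - {r}. parent u = v}" for v
    by (intro card_image inj_on_subset[OF inj_up]) auto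
  show "Suc (card {f\<in>E. up (parent (low f)) = e}) \<le> \<Delta>" if "e \<in> E" for e
  proof -
    obtain v where v: "v \<in> V" "v \<noteq> r" "e = up v" by (rule edge_cases[OF \<open>e \<in> E\<close>])
    show ?thesis unfolding v(3) children[OF v(1)] card_up using deg[OF v(1)] vdegree_eq[OF v(1)] v(2) by simp
  qed
  have "{f\<in>E. up (parent (low f)) = {r}} = up ` {u\<in>V - {r}. parent u = r}"
    using children[OF r] by (simp only: up_root)
  moreover have "card {u\<in>V - {r}. parent u = r} \<le> \<Delta>" using deg[OF r] vdegree_eq[OF r] by linarith
  ultimately show "card {f\<in>E. up (parent (low f)) = {r}} \<le> \<Delta>" by (simp only: card_up)
qed (use \<Delta> q in auto)

lemma d_low: "e \<in> E \<Longrightarrow> low e \<in> V"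
  by (erule edge_cases) (simp add: low_up)

text \<open>The level sizes at least double.\<close>

lemma complete_tree_depth:
  assumes \<Delta>: "3 \<le> \<Delta>" and nonleaf: "\<And>v. v \<in> V \<Longrightarrow> \<not> is_leaf E v \<Longrightarrow> vdegree E v = \<Delta>"
    and leaf: "\<And>v. v \<in> V \<Longrightarrow> is_leaf E v \<Longrightarrow> d v = h" and card: "card V \<ge> 2"
  shows "\<And>v. v \<in> V \<Longrightarrow> d v \<le> h" "2 ^ h \<le> card V" "1 \<le> h"
proof -
  let ?C = "\<lambda>v. {u\<in>V - {r}. parent u = v}"
  have "Max (d ` V) \<in> d ` V" using finite_V r by (intro Max_in) auto
  then obtain m where m: "m \<in> V" "d m = Max (d ` V)" by auto
  have max: "d v \<le> d m" if "v \<in> V" for v unfolding m(2) using that finite_V by (intro Max_ge) auto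
  \<comment> \<open>A deepest vertex has no child and is therefore a leaf, so the common level of
    the leaves is the maximal depth.\<close>
  have "?C m = {}" using parent(2) max by fastforce
  then have c0: "card (?C m) = 0" by (simp only: card.empty)
  have "is_leaf E m" unfolding is_leaf_def vdegree_eq[OF m(1)] c0 by simp
  then have h: "d m = h" using leaf m by auto
  then show dh: "d v \<le> h" if "v \<in> V" for v using max[OF that] by simp
  obtain w where w: "w \<in> V" "w \<noteq> r"
  proof -
    have "\<not> V \<subseteq> {r}" using card card_mono[of "{r}" V] by auto
    then show ?thesis using that by blast
  qed
  show "1 \<le> h" using parent(2)[OF w] dh[OF w(1)] by simp
  have two: "2 \<le> card (?C v)" if "v \<in> V" "d v < h" for v
  proof -
    have "\<not> is_leaf E v" using leaf[of v] that by auto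
    then show ?thesis using nonleaf[OF that(1)] vdegree_eq[OF that(1)] \<Delta> by (auto split: if_splits)
  qed
  have "2 ^ k \<le> card {v\<in>V. d v = k}" if "k \<le> h" for k
    using that
  proof (induction k)
    case 0
    have "r \<in> {v\<in>V. d v = 0}" using r d_root by simp
    then show ?case using finite_V by (simp add: Suc_le_eq card_gt_0_iff) blast
  next
    case (Suc k)
    let ?L = "{v\<in>V. d v = k}"
    have sub: "(\<Union>v\<in>?L. ?C v) \<subseteq> {v\<in>V. d v = Suc k}" using parent(2) by fastforce
    have "2 ^ Suc k \<le> card ?L * 2" using Suc by simp
    also have "\<dots> = (\<Sum>v\<in>?L. 2)" by simp
    also have "\<dots> \<le> (\<Sum>v\<in>?L. card (?C v))" using two Suc.prems by (intro sum_mono) auto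
    also have "\<dots> = card (\<Union>v\<in>?L. ?C v)" using finite_V by (intro card_UN_disjoint[symmetric]) auto
    also have "\<dots> \<le> card {v\<in>V. d v = Suc k}" using sub finite_V by (intro card_mono) auto
    finally show ?case .
  qed
  then have "2 ^ h \<le> card {v\<in>V. d v = h}" by simp
  also have "\<dots> \<le> card V" using finite_V by (intro card_mono) auto
  finally show "2 ^ h \<le> card V" .
qed

end

section \<open>Mixing times\<close>

text \<open>The summand 1 pays for rounding the real time bound up to an integer.\<close>

lemma glauber_mixing_time_le:
  fixes \<alpha> :: real
  assumes E: "finite E" "E \<noteq> {}" and q: "q \<ge> 4" and \<alpha>: "\<alpha> > 0"
    and ATE: "\<And>F. (\<And>X. 0 < F X) \<Longrightarrow>
      col_graph.ent E adjacent_edges q E F \<le> \<alpha> * (\<Sum>e\<in>E. col_graph.ent E adjacent_edges q {e} F)"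
  shows "ereal_of_enat (glauber_mixing_time E q) \<le> ereal (\<alpha> * (card E * q) * ln (512 * card E * ln q) + 1)"
proof -
  interpret G: col_graph E adjacent_edges q
    by unfold_locales (use E in \<open>auto simp: adjacent_edges_def\<close>)
  have Om: "G.Om = proper_edge_colorings E q"
    unfolding G.Om_def proper_edge_colorings_def ..
  have step: "G.gstep = glauber_step E q"
    unfolding G.gstep_def[abs_def] G.upd_def glauber_step_def[abs_def] ..
  let ?b = "\<alpha> * (card E * q) * ln (512 * card E * ln q)"
  define t where "t = nat \<lceil>?b\<rceil>"
  have "real t \<ge> ?b" unfolding t_def by linarith
  then have "tv_dist (chain_law (glauber_step E q) x t) (uniform_coloring E q) \<le> 1 / 4"
    if "x \<in> proper_edge_colorings E q" for x
    using G.mixing_from_entropy_decay[OF E(2) _ \<alpha> ATE, of x t] that q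
    unfolding Om step uniform_coloring_def by simp
  then have "glauber_mixing_time E q \<le> enat t"
    unfolding glauber_mixing_time_def mixing_time_def by (intro INF_lower) simp
  then have "ereal_of_enat (glauber_mixing_time E q) \<le> ereal_of_enat (enat t)"
    by (simp only: ereal_of_enat_le_iff)
  also have "\<dots> \<le> ereal (?b + 1)"
  proof -
    have "1 \<le> card E" using E by (simp add: Suc_le_eq card_gt_0_iff)
    have "exp 1 \<le> (4 :: real)" using exp_le by simp
    then have "1 \<le> ln (real q)" using q by (subst ln_ge_iff) auto
    then have "1 * 1 \<le> 512 * real (card E) * ln q" using \<open>1 \<le> card E\<close> by (intro mult_mono) auto
    then have "0 \<le> ln (512 * card E * ln q)" by simp
    then have "0 \<le> ?b" using \<alpha> by simp
    then show ?thesis unfolding t_def by simp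
  qed
  finally show ?thesis .
qed

text \<open>Chosen so that ln n \<ge> ln 2 absorbs both the constant inside the logarithm and the
  rounding term into n M ln n.\<close>

definition mix_const :: "real \<Rightarrow> nat \<Rightarrow> real" where
  "mix_const a q = a * q * (1 + ln (512 * ln q) / ln 2) + 1 / ln 2"

lemma mix_const_bound:
  fixes a M :: real and n N q :: nat
  assumes "a \<ge> 0" "M \<ge> 1" "1 \<le> N" "N \<le> n" "n \<ge> 2" "q \<ge> 4"
  shows "a * M * (real N * q) * ln (512 * N * ln q) + 1 \<le> mix_const a q * n * M * ln n"
proof -
  have "exp 1 \<le> (4 :: real)" using exp_le by simp
  then have lq: "1 \<le> ln (real q)" using assms by (subst ln_ge_iff) auto
  then have l0: "0 \<le> ln (512 * ln q)" by simp
  have ln2: "ln 2 > (0 :: real)" by simp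
  have ln: "ln 2 \<le> ln (real n)" "0 \<le> ln (real n)" using assms by simp_all
  have "ln (512 * N * ln q) = ln (real N) + ln (512 * ln q)"
    using assms lq ln_mult[of "real N" "512 * ln q"] by (simp add: mult_ac)
  also have "\<dots> \<le> ln (real n) + ln (real n) * (ln (512 * ln q) / ln 2)"
  proof (rule add_mono)
    show "ln (real N) \<le> ln (real n)" using assms by simp
    have "ln 2 * (ln (512 * ln q) / ln 2) \<le> ln (real n) * (ln (512 * ln q) / ln 2)"
      using ln l0 ln2 by (intro mult_right_mono divide_nonneg_pos) auto
    then show "ln (512 * ln q) \<le> ln (real n) * (ln (512 * ln q) / ln 2)" using ln2 by simp
  qed
  finally have le: "ln (512 * N * ln q) \<le> ln n * (1 + ln (512 * ln q) / ln 2)" by (simp add: algebra_simps)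
  have p: "0 \<le> ln n * (1 + ln (512 * ln q) / ln 2)"
    using ln ln2 l0 by (intro mult_nonneg_nonneg add_nonneg_nonneg divide_nonneg_pos) linarith+
  have "a * M * (real N * q) * ln (512 * N * ln q) \<le> a * M * (real N * q) * (ln n * (1 + ln (512 * ln q) / ln 2))"
    using assms le by (intro mult_left_mono) auto
  also have "\<dots> \<le> a * M * (real n * q) * (ln n * (1 + ln (512 * ln q) / ln 2))"
    using assms p by (intro mult_right_mono mult_left_mono) auto
  also have "\<dots> = a * q * (1 + ln (512 * ln q) / ln 2) * (n * M * ln n)" by (simp add: mult_ac)
  finally have 1: "a * M * (real N * q) * ln (512 * N * ln q) \<le> a * q * (1 + ln (512 * ln q) / ln 2) * (n * M * ln n)" .
  have "1 * 1 * ln 2 \<le> real n * M * ln n" using assms ln ln2 by (intro mult_mono) auto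
  then have 2: "1 \<le> 1 / ln 2 * (n * M * ln n)" using ln2 by (simp add: pos_le_divide_eq)
  have "mix_const a q * n * M * ln n
      = a * q * (1 + ln (512 * ln q) / ln 2) * (n * M * ln n) + 1 / ln 2 * (n * M * ln n)"
    unfolding mix_const_def by (simp only: distrib_right mult.assoc)
  then show ?thesis using 1 2 by linarith
qed

lemma mix_const_pos: "a \<ge> 0 \<Longrightarrow> q \<ge> 4 \<Longrightarrow> mix_const a q > 0"
proof -
  assume a: "a \<ge> 0" and q: "q \<ge> 4"
  have "exp 1 \<le> (4 :: real)" using exp_le by simp
  then have lq: "1 \<le> ln (real q)" using q by (subst ln_ge_iff) auto
  then have "0 \<le> ln (512 * ln q)" by simp
  then show ?thesis unfolding mix_const_def using a by (intro add_nonneg_pos mult_nonneg_nonneg) auto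
qed

lemma tree_const_pos: "2 \<le> \<Delta> \<Longrightarrow> 0 < q \<Longrightarrow> 0 < tree_const \<Delta> q"
  unfolding tree_const_def star_const_def by simp

lemma path_const_pos: "2 \<le> \<Delta> \<Longrightarrow> 0 < q \<Longrightarrow> 0 < path_const \<Delta> q"
  unfolding path_const_def star_const_def by simp

lemma (in rooted_tree) glauber_mixing_time_depth:
  assumes \<Delta>: "2 \<le> \<Delta>" and q: "\<Delta> + 2 \<le> q" and deg: "\<And>v. v \<in> V \<Longrightarrow> vdegree E v \<le> \<Delta>"
    and n: "card V \<ge> 2" and M: "\<And>v. v \<in> V \<Longrightarrow> d v \<le> M" "1 \<le> M"
  shows "ereal_of_enat (glauber_mixing_time E q)
    \<le> ereal (mix_const (tree_const \<Delta> q * (2 * real q)) q * card V * M * ln (card V))"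
proof -
  interpret T: edge_tree E adjacent_edges q "{r}" "\<lambda>e. up (parent (low e))" "\<lambda>e. d (low e)" \<Delta>
    by (rule edge_tree[OF \<Delta> q deg])
  let ?a = "tree_const \<Delta> q * (2 * real q)"
  have E: "card E \<ge> 1" "card E \<le> card V" "E \<noteq> {}" using card_E n by auto
  have a: "?a > 0" using tree_const_pos[OF \<Delta>, of q] q by simp
  have "ereal_of_enat (glauber_mixing_time E q) \<le> ereal (?a * M * (card E * q) * ln (512 * card E * ln q) + 1)"
  proof (rule glauber_mixing_time_le[OF finite_E E(3)])
    fix F :: "('a set \<Rightarrow> nat) \<Rightarrow> real" assume F: "\<And>X. 0 < F X"
    have "T.ent E F \<le> tree_const \<Delta> q * real M * (2 * q) * (\<Sum>e\<in>E. T.ent {e} F)"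
      by (rule T.ent_le_depth[OF F]) (use M d_low in auto)
    then show "T.ent E F \<le> ?a * M * (\<Sum>e\<in>E. T.ent {e} F)" by (simp add: mult_ac)
  qed (use a M q \<Delta> in auto)
  also have "\<dots> \<le> ereal (mix_const ?a q * card V * M * ln (card V))"
    using mix_const_bound[of ?a "real M" "card E" "card V" q] a M E n q \<Delta> by simp
  finally show ?thesis .
qed

lemma (in rooted_tree) glauber_mixing_time_path:
  assumes q: "4 \<le> q" and deg: "\<And>v. v \<in> V \<Longrightarrow> vdegree E v \<le> 2" and n: "card V \<ge> 2"
  shows "ereal_of_enat (glauber_mixing_time E q)
    \<le> ereal (mix_const (path_const 2 q * (2 * real q)) q * card V * ln (card V))"
proof -
  interpret T: edge_tree E adjacent_edges q "{r}" "\<lambda>e. up (parent (low e))" "\<lambda>e. d (low e)" 2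
    by (rule edge_tree[OF _ _ deg]) (use q in auto)
  let ?a = "path_const 2 q * (2 * real q)"
  have E: "card E \<ge> 1" "card E \<le> card V" "E \<noteq> {}" using card_E n by auto
  have a: "?a > 0" using path_const_pos[of 2 q] q by simp
  have "ereal_of_enat (glauber_mixing_time E q) \<le> ereal (?a * (card E * q) * ln (512 * card E * ln q) + 1)"
  proof (rule glauber_mixing_time_le[OF finite_E E(3) q a])
    fix F :: "('a set \<Rightarrow> nat) \<Rightarrow> real" assume F: "\<And>X. 0 < F X"
    show "T.ent E F \<le> ?a * (\<Sum>e\<in>E. T.ent {e} F)" using T.ent_le_path[OF refl F] by simp
  qed
  also have "\<dots> \<le> ereal (mix_const ?a q * card V * ln (card V))"
    using mix_const_bound[of ?a 1 "card E" "card V" q] a E n q by simp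
  finally show ?thesis .
qed

text \<open>On one vertex the bounds to be proved are 0 because ln 1 = 0, so the mixing time must
  vanish exactly. The only coloring is the empty one, and at time 0 its law is already
  uniform.\<close>

lemma glauber_mixing_time_single:
  assumes "is_tree V E" "card V < 2"
  shows "glauber_mixing_time E q = 0"
proof -
  have "E = {}"
  proof (rule ccontr)
    assume "E \<noteq> {}"
    then obtain e where e: "e \<subseteq> V" "card e = 2" "finite V"
      using assms(1) unfolding is_tree_def simple_graph_def by auto
    then show False using card_mono[of V e] assms(2) by simp
  qed
  then have S: "proper_edge_colorings E q = {\<lambda>_. undefined}" unfolding proper_edge_colorings_def by auto
  have tv: "tv_dist p p \<le> 1 / 4" for p :: "('a set \<Rightarrow> nat) pmf"
    unfolding tv_dist_def by simp
  have "glauber_mixing_time E q \<le> enat 0"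
    unfolding glauber_mixing_time_def mixing_time_def
    by (rule INF_lower) (use tv in \<open>simp add: S uniform_coloring_def pmf_of_set_singleton\<close>)
  then show ?thesis by (simp add: zero_enat_def[symmetric])
qed

text \<open>For \<Delta> \<ge> 3 the second logarithm is the bound ln n / ln 2 for the depth. For
  \<Delta> = 2 a single logarithm is enough and is weakened by ln n \<ge> ln 2. Adding the two
  constants covers both cases.\<close>

lemma regular_complete_tree_mixing:
  fixes V :: "'a set"
  assumes \<Delta>: "2 \<le> \<Delta>" and q: "\<Delta> + 2 \<le> q" and T: "regular_complete_tree \<Delta> V E" and n: "2 \<le> card V"
  shows "ereal_of_enat (glauber_mixing_time E q)
    \<le> ereal ((mix_const (tree_const \<Delta> q * (2 * real q)) q + mix_const (path_const 2 q * (2 * real q)) q) / ln 2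
        * card V * (ln (card V))\<^sup>2)"
proof -
  let ?t = "mix_const (tree_const \<Delta> q * (2 * real q)) q" and ?p = "mix_const (path_const 2 q * (2 * real q)) q"
  let ?n = "real (card V)"
  have tree: "is_tree V E" and nonleaf: "\<And>v. v \<in> V \<Longrightarrow> \<not> is_leaf E v \<Longrightarrow> vdegree E v = \<Delta>"
    using T unfolding regular_complete_tree_def by auto
  obtain r h where r: "r \<in> V" and leaf: "\<And>v. v \<in> V \<Longrightarrow> is_leaf E v \<Longrightarrow> gdist V E r v = h"
    using T unfolding regular_complete_tree_def by auto
  interpret R: rooted_tree V E r by unfold_locales (rule tree r)+
  have deg: "vdegree E v \<le> \<Delta>" if "v \<in> V" for v
    using nonleaf[OF that] \<Delta> unfolding is_leaf_def by linarith
  have pos: "0 < ?t" "0 < ?p"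
    using tree_const_pos[OF \<Delta>, of q] path_const_pos[of 2 q] q \<Delta> by (auto intro!: mix_const_pos)
  have ln2: "ln 2 > (0 :: real)" "ln 2 \<le> ln ?n" "0 \<le> ln ?n" using n by simp_all
  have sq: "0 \<le> ?n * (ln ?n)\<^sup>2" by simp
  show ?thesis
  proof (cases "\<Delta> = 2")
    case True
    have "ereal_of_enat (glauber_mixing_time E q) \<le> ereal (?p * ?n * ln ?n)"
      using R.glauber_mixing_time_path[OF _ _ n] q deg True by simp
    also have "?p * ?n * ln ?n \<le> ?p / ln 2 * (?n * (ln ?n)\<^sup>2)"
    proof -
      have "ln ?n * ln 2 \<le> (ln ?n)\<^sup>2" unfolding power2_eq_square using ln2 by (intro mult_left_mono) linarith+
      then have "ln ?n \<le> (ln ?n)\<^sup>2 / ln 2" using ln2(1) by (simp only: pos_le_divide_eq)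
      then have "?p * ?n * ln ?n \<le> ?p * ?n * ((ln ?n)\<^sup>2 / ln 2)" using pos by (intro mult_left_mono) auto
      then show ?thesis by simp
    qed
    also have "\<dots> \<le> (?t + ?p) / ln 2 * (?n * (ln ?n)\<^sup>2)"
      using pos ln2 sq by (intro mult_right_mono divide_right_mono) auto
    finally show ?thesis by (simp add: mult.assoc)
  next
    case False
    then have \<Delta>3: "3 \<le> \<Delta>" using \<Delta> by simp
    note depth = R.complete_tree_depth[OF \<Delta>3 nonleaf leaf n]
    have "ereal_of_enat (glauber_mixing_time E q) \<le> ereal (?t * ?n * h * ln ?n)"
      by (rule R.glauber_mixing_time_depth[OF \<Delta> q deg n depth(1,3)])
    also have "?t * ?n * h * ln ?n \<le> ?t / ln 2 * (?n * (ln ?n)\<^sup>2)"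
    proof -
      have "real 2 ^ h \<le> ?n" using depth(2) by (metis of_nat_le_iff of_nat_power)
      then have "ln (2 ^ h) \<le> ln ?n" using n by (subst ln_le_cancel_iff) auto
      then have "real h * ln 2 \<le> ln ?n" by (simp add: ln_realpow)
      then have "real h \<le> ln ?n / ln 2" using ln2 by (simp add: pos_le_divide_eq)
      then have "?t * ?n * ln ?n * h \<le> ?t * ?n * ln ?n * (ln ?n / ln 2)"
        using pos ln2 by (intro mult_left_mono) auto
      then show ?thesis by (simp add: power2_eq_square mult_ac)
    qed
    also have "\<dots> \<le> (?t + ?p) / ln 2 * (?n * (ln ?n)\<^sup>2)"
      using pos ln2 sq by (intro mult_right_mono divide_right_mono) auto
    finally show ?thesis by (simp add: mult.assoc)
  qed
qed

text \<open>The depth from any root is at most the diameter. A root of maximum degree is taken since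
  its degree exhibits an edge, hence a second vertex.\<close>

lemma tree_mixing:
  fixes V :: "'a set"
  assumes \<Delta>: "2 \<le> \<Delta>" and q: "\<Delta> + 2 \<le> q" and tree: "is_tree V E" and max: "max_degree V E = \<Delta>"
  shows "ereal_of_enat (glauber_mixing_time E q)
    \<le> ereal (mix_const (tree_const \<Delta> q * (2 * real q)) q * card V * gdiameter V E * ln (card V))"
proof -
  have fin: "finite V" and ne: "V \<noteq> {}" and edge: "\<And>e. e \<in> E \<Longrightarrow> e \<subseteq> V \<and> card e = 2"
    using tree unfolding is_tree_def simple_graph_def connected_graph_def by auto
  have deg: "vdegree E v \<le> \<Delta>" if "v \<in> V" for v
    unfolding max[symmetric] max_degree_def using that fin by (intro Max_ge) auto
  have "\<Delta> \<in> vdegree E ` V" unfolding max[symmetric] max_degree_def using fin ne by (intro Max_in) auto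
  then obtain r where r: "r \<in> V" "vdegree E r = \<Delta>" by auto
  then have "{e\<in>E. r \<in> e} \<noteq> {}" using \<Delta> unfolding vdegree_def by (metis card.empty not_numeral_le_zero)
  then obtain e where "e \<in> E" by auto
  then have n: "2 \<le> card V" using edge[of e] card_mono[OF fin, of e] by simp
  interpret R: rooted_tree V E r by unfold_locales (rule tree r)+
  have d: "gdist V E r v \<le> gdiameter V E" if "v \<in> V" for v
    unfolding gdiameter_def using that r fin by (intro Max_ge) auto
  have "\<not> V \<subseteq> {r}" using n card_mono[of "{r}" V] by auto
  then obtain w where w: "w \<in> V" "w \<noteq> r" by blast
  have "1 \<le> gdiameter V E" using R.parent(2)[OF w] d[OF w(1)] by simp
  then show ?thesis by (intro R.glauber_mixing_time_depth \<Delta> q deg n d)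
qed

theorem theorem1p3:
  fixes \<Delta> q :: nat
  assumes "\<Delta> \<ge> 2" and "q \<ge> \<Delta> + 2"
  shows "(\<exists>C::real. C > 0 \<and> (\<forall>(V :: 'a set) E. regular_complete_tree \<Delta> V E \<longrightarrow>
            ereal_of_enat (glauber_mixing_time E q)
              \<le> ereal (C * real (card V) * (ln (real (card V)))\<^sup>2)))
       \<and> (\<exists>C::real. C > 0 \<and> (\<forall>(V :: 'a set) E. is_tree V E \<and> max_degree V E = \<Delta> \<longrightarrow>
            ereal_of_enat (glauber_mixing_time E q)
              \<le> ereal (C * real (card V) * real (gdiameter V E) * ln (real (card V)))))"
proof (intro conjI)
  let ?t = "mix_const (tree_const \<Delta> q * (2 * real q)) q" and ?p = "mix_const (path_const 2 q * (2 * real q)) q"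
  have pos: "0 < ?t" "0 < ?p"
    using tree_const_pos[of \<Delta> q] path_const_pos[of 2 q] assms by (auto intro!: mix_const_pos)
  have "ereal_of_enat (glauber_mixing_time E q) \<le> ereal ((?t + ?p) / ln 2 * card V * (ln (card V))\<^sup>2)"
    if T: "regular_complete_tree \<Delta> V E" for V :: "'a set" and E
  proof (cases "2 \<le> card V")
    case False
    then have "glauber_mixing_time E q = 0"
      using T by (intro glauber_mixing_time_single[of V]) (auto simp: regular_complete_tree_def)
    then show ?thesis using pos by (simp add: zero_ereal_def[symmetric])
  qed (use regular_complete_tree_mixing[OF _ _ T] assms in simp)
  then show "\<exists>C::real. C > 0 \<and> (\<forall>(V :: 'a set) E. regular_complete_tree \<Delta> V E \<longrightarrow>
      ereal_of_enat (glauber_mixing_time E q) \<le> ereal (C * real (card V) * (ln (real (card V)))\<^sup>2))"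
    using pos by (intro exI[of _ "(?t + ?p) / ln 2"]) auto
  show "\<exists>C::real. C > 0 \<and> (\<forall>(V :: 'a set) E. is_tree V E \<and> max_degree V E = \<Delta> \<longrightarrow>
      ereal_of_enat (glauber_mixing_time E q)
        \<le> ereal (C * real (card V) * real (gdiameter V E) * ln (real (card V))))"
    using pos tree_mixing[OF assms] by (intro exI[of _ ?t]) auto
qed

end
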